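(* Let $\mathcal{U}$ be the uniform coalescence process and $\mathcal{S}$ the size-biased coalescence process, each started from $n$ singleton clusters, and let $\tau_c(\mathcal{U})$ and $\tau_c(\mathcal{S})$ denote their coalescence times. Then: (1) There is an absolute constant $c>0$ such that $$\mathbb{P}\Big(\tau_c(\mathcal{U}) \ge c\,\log n\cdot \frac{\log\log n}{\log\log\log n}\Big)\longrightarrow 1\qquad\text{as } n\to\infty .$$ (2) There are absolute constants $0<c'<C'$ such that $$\mathbb{P}\big(c'\log n\le \tau_c(\mathcal{S})\le C'\log n\big)\longrightarrow 1\qquad\text{as } n\to\infty .$$
   Context: There are $n$ agents. A configuration is a partition of the agents into clusters $\mathcal{C}_1,\dots,\mathcal{C}_\kappa$; initially every agent is its own cluster. The process evolves in synchronous rounds. In each round, given the current clusters and independently for different clusters: - each cluster flips a fair coin to decide whether it issues a request or accepts requests in this round; - each issuing cluster picks an agent uniformly among all $n$ agents and sends a merge request to the cluster containing it, i.e. it contacts cluster $\mathcal{C}_j$ with probability $|\mathcal{C}_j|/n$ (a request to itself has no effect; requests received by a cluster that is itself issuing are ignored); - each accepting cluster selects at most one of its incoming requests, by the rule below, and merges with the cluster which issued that request. Since every cluster either issues one request or accepts at most one, the merges in a round are between disjoint pairs of clusters. Uniform process $\mathcal{U}$: an accepting cluster that has at least one incoming request selects one of them uniformly at random. Size-biased process $\mathcal{S}$: an accepting cluster $\mathcal{C}_i$ ignores requests from clusters of size larger than $|\mathcal{C}_i|$; among the other incoming requests (if any) it selects one issued by a cluster of smallest size (ties broken arbitrarily).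 The coalescence time $\tau_c$ is the number of rounds until only one cluster remains. $\log$ is the natural logarithm. *)

theory Defs
  imports "HOL-Probability.Probability"
begin

text \<open>
  The agents are the natural numbers below n, a cluster is a set of agents, and a configuration
  is a partition of the agents.
\<close>

type_synonym cluster = "nat set"

definition configs :: "nat \<Rightarrow> cluster set set" where
  "configs n = {C. partition_on {..<n} C}"

definition singletons :: "nat \<Rightarrow> cluster set" where
  "singletons n = (\<lambda>a. {a}) ` {..<n}"


text \<open>
  In one round, action i = None means that cluster i accepts requests, and action i = Some a means
  that it issues a request, addressed to the cluster containing agent a.
\<close>

type_synonym actions = "cluster \<Rightarrow> nat option"

definition actions_pmf :: "nat \<Rightarrow> cluster set \<Rightarrow> actions pmf" where
  "actions_pmf n C = Pi_pmf C None (\<lambda>_.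
     bind_pmf (bernoulli_pmf (1/2)) (\<lambda>issue.
       if issue then map_pmf Some (pmf_of_set {..<n}) else return_pmf None))"

definition incoming :: "cluster set \<Rightarrow> actions \<Rightarrow> cluster \<Rightarrow> cluster set" where
  "incoming C act i = {j \<in> C. \<exists>a \<in> i. act j = Some a}"


text \<open>
  A selection maps an accepting cluster to the request it selects, given by the issuing cluster;
  it is None for clusters that issue a request or select none.
\<close>

type_synonym selection = "cluster \<Rightarrow> cluster option"

definition merge_clusters :: "cluster set \<Rightarrow> selection \<Rightarrow> cluster set" where
  "merge_clusters C s = {i \<union> j | i j. i \<in> C \<and> s i = Some j}
             \<union> {i \<in> C. s i = None \<and> (\<forall>k \<in> C. s k \<noteq> Some i)}"

definition selects_from ::
    "(cluster \<Rightarrow> cluster set) \<Rightarrow> cluster set \<Rightarrow> actions \<Rightarrow> selection \<Rightarrow> bool" where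
  "selects_from cand C act s \<longleftrightarrow>
     (\<forall>i. if i \<in> C \<and> act i = None \<and> cand i \<noteq> {} then \<exists>j \<in> cand i. s i = Some j else s i = None)"

text \<open>
  A rule gives the law of the selection of a round. It may depend on the configurations at the start
  of all previous rounds (as a list), on the current configuration and on all actions of the round;
  choices of different clusters may be correlated.
\<close>

type_synonym rule = "cluster set list \<Rightarrow> cluster set \<Rightarrow> actions \<Rightarrow> selection pmf"

definition uniform_rule :: rule where
  "uniform_rule hist C act =
     Pi_pmf {i \<in> C. act i = None \<and> incoming C act i \<noteq> {}} None
       (\<lambda>i. map_pmf Some (pmf_of_set (incoming C act i)))"

definition smallest_incoming :: "cluster set \<Rightarrow> actions \<Rightarrow> cluster \<Rightarrow> cluster set" where
  "smallest_incoming C act i =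
     {j. is_arg_min card (\<lambda>j. j \<in> incoming C act i \<and> card j \<le> card i) j}"

text \<open>The freedom left by this predicate is exactly the arbitrary breaking of ties.\<close>

definition size_biased_rule :: "rule \<Rightarrow> bool" where
  "size_biased_rule \<rho> \<longleftrightarrow>
     (\<forall>hist C act. \<forall>s \<in> set_pmf (\<rho> hist C act). selects_from (smallest_incoming C act) C act s)"


definition round_pmf ::
    "nat \<Rightarrow> (cluster set \<Rightarrow> actions \<Rightarrow> selection pmf) \<Rightarrow> cluster set \<Rightarrow> cluster set pmf" where
  "round_pmf n r C = bind_pmf (actions_pmf n C) (\<lambda>act. map_pmf (merge_clusters C) (r C act))"

text \<open>
  The law of the configuration after t rounds given the configurations after 0, ..., t - 1 rounds.
  It is restricted to the finite set of configurations, which has full measure, because the type of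
  configurations is uncountable; see the lemmas at the end of this theory.
\<close>

definition transition :: "nat \<Rightarrow> rule \<Rightarrow> nat \<Rightarrow> (nat \<Rightarrow> cluster set) \<Rightarrow> cluster set measure" where
  "transition n \<rho> t \<omega> = restrict_space (measure_pmf
     (case t of 0 \<Rightarrow> return_pmf (singletons n)
      | Suc k \<Rightarrow> round_pmf n (\<rho> (map \<omega> [0..<k])) (\<omega> k))) (configs n)"

text \<open>
  The law of the whole trajectory, where \<omega> t is the configuration after t rounds, as given by the
  Ionescu-Tulcea theorem.
\<close>

definition process :: "nat \<Rightarrow> rule \<Rightarrow> (nat \<Rightarrow> cluster set) measure" where
  "process n \<rho> =
     projective_family.lim UNIV
       (Ionescu_Tulcea.CI (transition n \<rho>) (\<lambda>_. count_space (configs n)))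
       (\<lambda>_. count_space (configs n))"

definition coalescence_time :: "(nat \<Rightarrow> cluster set) \<Rightarrow> enat" where
  "coalescence_time \<omega> = Inf (enat ` {t. card (\<omega> t) = 1})"


text \<open>The processes are well defined, and their coalescence times are random variables.\<close>

lemma configs_finite: "finite (configs n)"
  by (rule finite_subset[of _ "Pow (Pow {..<n})"]) (auto simp: configs_def partition_on_def)

lemma singletons_in_configs: "singletons n \<in> configs n"
  by (auto simp: configs_def singletons_def partition_on_def pairwise_def disjnt_def)

lemma config_finite: "C \<in> configs n \<Longrightarrow> finite C"
  by (auto simp: configs_def intro: finite_elements)

definition proper_rule :: "nat \<Rightarrow> rule \<Rightarrow> bool" where
  "proper_rule n \<rho> \<longleftrightarrow> (\<forall>hist act. \<forall>C \<in> configs n. \<forall>s \<in> set_pmf (\<rho> hist C act).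
     \<exists>cand. (\<forall>i. cand i \<subseteq> incoming C act i) \<and> selects_from cand C act s)"

lemma merge_in_configs:
  assumes C: "C \<in> configs n" and cand: "\<And>i. cand i \<subseteq> incoming C act i"
    and s: "selects_from cand C act s"
  shows "merge_clusters C s \<in> configs n"
proof -
  have part: "\<Union>C = {..<n}" "{} \<notin> C"
    and disj: "\<And>p q x. p \<in> C \<Longrightarrow> q \<in> C \<Longrightarrow> x \<in> p \<Longrightarrow> x \<in> q \<Longrightarrow> p = q"
    using C by (auto simp: configs_def partition_on_def pairwise_def disjnt_def)
  have sel: "i \<in> C \<and> act i = None \<and> j \<in> C \<and> (\<exists>a \<in> i. act j = Some a)" if "s i = Some j" for i j
  proof -
    have *: "i \<in> C \<and> act i = None \<and> (\<exists>j \<in> cand i. s i = Some j)"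
      using s that unfolding selects_from_def
      by (metis option.distinct(1))
    then have "j \<in> cand i" using that by auto
    with cand[of i] * show ?thesis by (auto simp: incoming_def)
  qed
  have inj: "i = i'" if "s i = Some j" "s i' = Some j" for i i' j
    using sel[OF that(1)] sel[OF that(2)] disj[of i i'] by (metis option.inject)
  have noissue: "s j = None" if "s i = Some j" for i j
    using sel[OF that] sel[of j] by (cases "s j") auto
  define B where "B i = (case s i of Some j \<Rightarrow> i \<union> j | None \<Rightarrow> i)" for i
  define D where "D = {i \<in> C. \<forall>k \<in> C. s k \<noteq> Some i}"
  have M: "merge_clusters C s = B ` D"
  proof (intro equalityI subsetI)
    fix x assume "x \<in> merge_clusters C s"
    then consider i j where "x = i \<union> j" "i \<in> C" "s i = Some j" | "x \<in> D" "s x = None"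
      by (auto simp: merge_clusters_def D_def)
    then show "x \<in> B ` D"
    proof cases
      case 1
      then have "i \<in> D" using noissue[of _ i] by (auto simp: D_def)
      with 1 show ?thesis by (auto simp: B_def intro!: image_eqI[of _ _ i])
    next
      case 2
      then show ?thesis by (auto simp: B_def intro!: image_eqI[of _ _ x])
    qed
  next
    fix x assume "x \<in> B ` D"
    then obtain i where "i \<in> D" "x = B i" by auto
    then show "x \<in> merge_clusters C s"
      by (cases "s i") (auto simp: merge_clusters_def D_def B_def)
  qed
  have "\<Union>(merge_clusters C s) = \<Union>C"
  proof (intro equalityI subsetI)
    fix x assume "x \<in> \<Union>(merge_clusters C s)"
    then show "x \<in> \<Union>C" using sel by (auto simp: merge_clusters_def)
  next
    fix x assume "x \<in> \<Union>C"
    then obtain j where j: "j \<in> C" "x \<in> j" by auto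
    show "x \<in> \<Union>(merge_clusters C s)"
    proof (cases "\<exists>k \<in> C. s k = Some j")
      case True
      then show ?thesis using j by (auto simp: merge_clusters_def)
    next
      case False
      then have "j \<in> D" using j by (auto simp: D_def)
      moreover have "x \<in> B j" using j by (auto simp: B_def split: option.splits)
      ultimately show ?thesis unfolding M by auto
    qed
  qed
  moreover have "{} \<notin> merge_clusters C s"
    using part(2) by (auto simp: merge_clusters_def)
  moreover have "disjnt p q" if pq: "p \<in> merge_clusters C s" "q \<in> merge_clusters C s" "p \<noteq> q" for p q
  proof (rule ccontr)
    assume "\<not> disjnt p q"
    then obtain x where x: "x \<in> p" "x \<in> q" by (auto simp: disjnt_def)
    obtain i k where ik: "i \<in> D" "k \<in> D" "p = B i" "q = B k" using pq M by auto
    have mem: "\<exists>y \<in> C. x \<in> y \<and> (y = l \<or> s l = Some y)" if "l \<in> D" "x \<in> B l" for l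
      using that sel[of l] by (auto simp: B_def D_def split: option.splits)
    obtain y z where yz: "y \<in> C" "x \<in> y" "y = i \<or> s i = Some y" "z \<in> C" "x \<in> z" "z = k \<or> s k = Some z"
      using mem[of i] mem[of k] ik x by blast
    have "y = z" using disj yz by blast
    then have "i = k"
      using yz ik(1,2) inj sel by (auto simp: D_def)
    then show False using ik pq by auto
  qed
  ultimately show ?thesis
    using part by (auto simp: configs_def partition_on_def pairwise_def)
qed

lemma proper_uniform_rule: "proper_rule n uniform_rule"
  unfolding proper_rule_def
proof (intro allI ballI)
  fix hist act C s
  assume C: "C \<in> configs n" and s: "s \<in> set_pmf (uniform_rule hist C act)"
  let ?A = "{i \<in> C. act i = None \<and> incoming C act i \<noteq> {}}"
  have fin: "finite C" using C by (rule config_finite)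
  then have fin': "finite (incoming C act i)" for i by (simp add: incoming_def)
  have s': "s \<in> PiE_dflt ?A None
      (set_pmf \<circ> (\<lambda>i. map_pmf Some (pmf_of_set (incoming C act i))))"
    using s fin unfolding uniform_rule_def by (subst (asm) set_Pi_pmf) auto
  have "selects_from (incoming C act) C act s"
    unfolding selects_from_def
  proof (intro allI)
    fix i
    show "if i \<in> C \<and> act i = None \<and> incoming C act i \<noteq> {}
          then \<exists>j \<in> incoming C act i. s i = Some j else s i = None"
      using s' fin' by (auto simp: PiE_dflt_def dest!: spec[of _ i])
  qed
  then show "\<exists>cand. (\<forall>i. cand i \<subseteq> incoming C act i) \<and> selects_from cand C act s" by blast
qed

lemma proper_size_biased_rule: "size_biased_rule \<rho> \<Longrightarrow> proper_rule n \<rho>"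
  unfolding proper_rule_def size_biased_rule_def
  by (intro allI ballI exI[of _ "smallest_incoming _ _"])
     (auto simp: smallest_incoming_def is_arg_min_def)

lemma size_biased_rule_exists: "\<exists>\<rho>. size_biased_rule \<rho>"
proof
  let ?c = "\<lambda>C act i. smallest_incoming C act i"
  show "size_biased_rule (\<lambda>hist C act. return_pmf (\<lambda>i.
      if i \<in> C \<and> act i = None \<and> ?c C act i \<noteq> {} then Some (SOME j. j \<in> ?c C act i) else None))"
    unfolding size_biased_rule_def selects_from_def
    by (auto simp: some_in_eq)
qed

lemma round_in_configs:
  assumes "proper_rule n \<rho>" "C \<in> configs n"
  shows "set_pmf (round_pmf n (\<rho> hist) C) \<subseteq> configs n"
proof
  fix D assume "D \<in> set_pmf (round_pmf n (\<rho> hist) C)"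
  then obtain act s where s: "s \<in> set_pmf (\<rho> hist C act)" "D = merge_clusters C s"
    by (auto simp: round_pmf_def)
  then obtain cand where "\<forall>i. cand i \<subseteq> incoming C act i" "selects_from cand C act s"
    using assms unfolding proper_rule_def by blast
  then show "D \<in> configs n"
    using merge_in_configs[OF assms(2)] s by blast
qed

theorem process_Ionescu_Tulcea:
  assumes "proper_rule n \<rho>"
  shows "Ionescu_Tulcea (transition n \<rho>) (\<lambda>_. count_space (configs n))"
proof -
  have PiM: "PiM {0..<t} (\<lambda>_. count_space (configs n)) = count_space (PiE {0..<t} (\<lambda>_. configs n))"
    for t :: nat by (rule count_space_PiM_finite) (simp_all add: configs_finite countable_finite)
  have prob: "prob_space (transition n \<rho> t \<omega>)"
    if \<omega>: "\<omega> \<in> PiE {0..<t} (\<lambda>_. configs n)"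
    for t :: nat and \<omega>
  proof -
    have sub: "set_pmf (case t of 0 \<Rightarrow> return_pmf (singletons n)
        | Suc k \<Rightarrow> round_pmf n (\<rho> (map \<omega> [0..<k])) (\<omega> k)) \<subseteq> configs n"
    proof (cases t)
      case 0
      then show ?thesis using singletons_in_configs by simp
    next
      case (Suc k)
      then have "\<omega> k \<in> configs n" using \<omega> by (auto simp: PiE_iff)
      with Suc show ?thesis using round_in_configs[OF assms] by auto
    qed
    show ?thesis
      unfolding transition_def
      by (rule prob_spaceI)
         (simp add: emeasure_restrict_space space_restrict_space
            measure_pmf.emeasure_eq_1_AE AE_measure_pmf_iff subsetD[OF sub])
  qed
  have sets: "sets (transition n \<rho> t \<omega>) = sets (count_space (configs n))" for t \<omega>
    unfolding transition_def by (auto simp: sets_restrict_space_iff sets_restrict_space)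
  show ?thesis
    by (rule Ionescu_Tulcea.intro)
       (auto simp: PiM space_subprob_algebra prob prob_space_imp_subprob_space sets)
qed

lemma sets_process:
  assumes "proper_rule n \<rho>"
  shows "sets (process n \<rho>) = sets (PiM UNIV (\<lambda>_. count_space (configs n)))"
proof -
  interpret Ionescu_Tulcea "transition n \<rho>" "\<lambda>_. count_space (configs n)"
    by (rule process_Ionescu_Tulcea[OF assms])
  show ?thesis by (simp add: process_def PF.sets_lim)
qed

lemma prob_space_process:
  assumes "proper_rule n \<rho>"
  shows "prob_space (process n \<rho>)"
proof -
  interpret Ionescu_Tulcea "transition n \<rho>" "\<lambda>_. count_space (configs n)"
    by (rule process_Ionescu_Tulcea[OF assms])
  have "prob_space (distr (process n \<rho>) (PiM {} (\<lambda>_. count_space (configs n))) (\<lambda>x. restrict x {}))"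
    unfolding process_def by (subst distr_lim) (auto intro: PF.prob_space_P)
  then show ?thesis
    by (rule prob_space_distrD[rotated])
       (auto intro!: measurable_restrict simp: measurable_cong_sets[OF sets_process[OF assms] refl])
qed

lemma coalescence_time_measurable:
  assumes "proper_rule n \<rho>"
  shows "coalescence_time \<in> process n \<rho> \<rightarrow>\<^sub>M count_space UNIV"
proof -
  have [measurable]: "(\<lambda>\<omega>. card (\<omega> t)) \<in> process n \<rho> \<rightarrow>\<^sub>M count_space UNIV" for t
    unfolding measurable_cong_sets[OF sets_process[OF assms] refl]
    by (rule measurable_compose[OF measurable_component_singleton]) auto
  have eq: "coalescence_time = (\<lambda>\<omega>. INF t. if card (\<omega> t) = 1 then enat t else \<infinity>)"
    by (rule ext, unfold coalescence_time_def, intro antisym INF_greatest Inf_greatest)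
       (auto intro: Inf_lower INF_lower2)
  show ?thesis
    unfolding eq by measurable
qed

end

theory Submission
  imports Defs "HOL-Real_Asymp.Real_Asymp"
begin

text \<open>
  Uniform process. For a configuration with \<open>k\<close> clusters of relative sizes \<open>w i\<close>, consider
  \<open>h s\<close>, the average of \<open>1 - exp (- s k (w i))\<close> over the clusters. One round shrinks the number of
  clusters by a factor \<open>\<rho> = 1 - h (1/2) / 2\<close> and replaces \<open>h s\<close> by
  \<open>h (\<rho> s) (1 + (h (\<rho> s + 1/2) - h (\<rho> s)) / (2 \<rho>))\<close>, up to fluctuations controlled by a variance bound.
  Concavity of \<open>h\<close> makes \<open>h 1\<close> non-increasing in time. As long as \<open>h 1 \<ge> \<epsilon>\<close>, the value of \<open>h\<close> at
  \<open>2 / \<epsilon>\<close> drops in every round by at least \<open>exp (- O((1 / \<epsilon>) ln (1 / \<epsilon>)))\<close>, so \<open>h 1\<close> falls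
  below \<open>\<epsilon>\<close>, a constant times \<open>ln ln ln n / ln ln n\<close>, within \<open>o(ln n)\<close> rounds. From then on
  a round removes only an \<open>O(\<epsilon>)\<close> fraction of the clusters.

  Size-biased process. Let \<open>Q\<close> be the average of \<open>(k (w i))\<^sup>2\<close> and \<open>A\<close> the average of
  \<open>min 1 (k (w i))\<close>; then \<open>Q A \<ge> 1/2\<close>. A round merges on average at least \<open>k A / 32\<close> pairs,
  which decreases \<open>Q\<close> by a constant and \<open>ln k\<close> by a multiple of \<open>A\<close>, whereas accepting the smallest
  request increases \<open>Q\<close> by at most \<open>O(sqrt A)\<close> on average. For a large constant \<open>c\<close> and a
  small \<open>l\<close>, \<open>exp (l (Q + c ln k))\<close> therefore contracts by a constant factor per round until one
  cluster is left.
\<close>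

section \<open>The law of finite trajectories\<close>

text \<open>In both parts the relative sizes \<open>k (w i)\<close> have mean 1. For the uniform
  process the iteration for \<open>h\<close> closes because a merge of sizes \<open>a\<close> and
  \<open>b\<close> lowers the sum of \<open>1 - q ^ size\<close> by
  \<open>(1 - q ^ a) (1 - q ^ b)\<close>, and the chance to receive no request is itself nearly an
  exponential of the size. The increment that makes \<open>h\<close> drop at
  \<open>2 / \<epsilon>\<close> is carried up from a scale below \<open>\<epsilon>\<close> through
  about \<open>(8 / \<epsilon>) ln (2 / \<epsilon>)\<close> cells of a geometric grid, one per
  round, with a bounded loss factor each; the choice of \<open>\<epsilon>\<close> keeps the
  resulting number of rounds below about \<open>sqrt (ln n)\<close>, so that even a halving of the
  clusters in each of them is affordable. A variance bound suffices because at least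
  \<open>sqrt n\<close> clusters remain: failures are polynomially rare, against polylogarithmically
  many rounds and scales. For the size-biased process neither part of the exponent contracts alone:
  the decrease of \<open>Q\<close> beats its growth only for small \<open>A\<close>, and the
  logarithm supplies the decrease when \<open>A\<close> is not small.\<close>

primrec trajectory_pmf :: "nat \<Rightarrow> rule \<Rightarrow> nat \<Rightarrow> cluster set list pmf" where
  "trajectory_pmf n \<rho> 0 = return_pmf [singletons n]"
| "trajectory_pmf n \<rho> (Suc t) = bind_pmf (trajectory_pmf n \<rho> t)
     (\<lambda>h. map_pmf (\<lambda>C. h @ [C]) (round_pmf n (\<rho> (butlast h)) (last h)))"

lemma trajectory_pmf_support:
  assumes "proper_rule n \<rho>" "h \<in> set_pmf (trajectory_pmf n \<rho> t)"
  shows "length h = Suc t \<and> set h \<subseteq> configs n"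
  using assms(2)
proof (induction t arbitrary: h)
  case 0
  then show ?case by (simp add: singletons_in_configs)
next
  case (Suc t)
  then obtain h0 C where h0: "h0 \<in> set_pmf (trajectory_pmf n \<rho> t)" "h = h0 @ [C]"
    and C: "C \<in> set_pmf (round_pmf n (\<rho> (butlast h0)) (last h0))" by auto
  have IH: "length h0 = Suc t" "set h0 \<subseteq> configs n" using Suc.IH[OF h0(1)] by auto
  then have "last h0 \<in> configs n" by (metis last_in_set length_0_conv nat.distinct(1) subsetD)
  then show ?case using IH h0(2) C round_in_configs[OF assms(1)] by (auto dest: subsetD)
qed

text \<open>Finite-dimensional marginals of the Ionescu-Tulcea limit, computed by peeling off one
  kernel at a time. \<open>butlast h\<close> and \<open>last h\<close> stand for the history
  \<open>map \<omega> [0..<k]\<close> and the state \<open>\<omega> k\<close> in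
  \<open>transition\<close>. Finite products of the state spaces are discrete, so every function on
  them is measurable.\<close>

lemma nn_integral_process:
  assumes \<rho>: "proper_rule n \<rho>"
  shows "(\<integral>\<^sup>+\<omega>. f (map \<omega> [0..<Suc t]) \<partial>process n \<rho>) = (\<integral>\<^sup>+h. f h \<partial>trajectory_pmf n \<rho> t)"
proof -
  interpret Ionescu_Tulcea "transition n \<rho>" "\<lambda>_. count_space (configs n)"
    by (rule process_Ionescu_Tulcea[OF \<rho>])
  have PiM: "PiM {0..<t} (\<lambda>_. count_space (configs n)) = count_space (PiE {0..<t} (\<lambda>_. configs n))"
    for t :: nat by (rule count_space_PiM_finite) (simp_all add: configs_finite countable_finite)
  let ?M = "\<lambda>t::nat. PiM {0..<t} (\<lambda>_. count_space (configs n))"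
  have und: "(\<lambda>_. undefined) \<in> space (?M 0)" by (auto simp: space_PiM)
  have tr: "(\<integral>\<^sup>+y. g y \<partial>transition n \<rho> (Suc k) \<omega>) =
      (\<integral>\<^sup>+y. g y \<partial>round_pmf n (\<rho> (map \<omega> [0..<k])) (\<omega> k))"
    if "\<omega> k \<in> configs n" for k \<omega> g
  proof -
    \<comment> \<open>The restriction to \<open>configs n\<close> in \<open>transition\<close> loses
      nothing, because a round almost surely ends there.\<close>
    have "AE y in measure_pmf (round_pmf n (\<rho> (map \<omega> [0..<k])) (\<omega> k)). y \<in> configs n"
      using round_in_configs[OF \<rho> that] by (auto simp: AE_measure_pmf_iff)
    then show ?thesis unfolding transition_def
      by (subst nn_integral_restrict_space) (auto intro!: nn_integral_cong_AE elim!: AE_mp)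
  qed
  have step: "(\<integral>\<^sup>+x. g x \<partial>C 0 (Suc t) (\<lambda>_. undefined))
      = (\<integral>\<^sup>+x. (\<integral>\<^sup>+y. g (x(t := y)) \<partial>transition n \<rho> t x) \<partial>C 0 t (\<lambda>_. undefined))"
    for g :: "(nat \<Rightarrow> cluster set) \<Rightarrow> ennreal" and t
  proof -
    have g: "g \<in> borel_measurable (?M (Suc t))" unfolding PiM by simp
    have "(\<integral>\<^sup>+x. g x \<partial>C 0 (Suc t) (\<lambda>_. undefined))
        = (\<integral>\<^sup>+x. (\<integral>\<^sup>+y. g y \<partial>eP t x) \<partial>C 0 t (\<lambda>_. undefined))"
      using g by (simp add: nn_integral_bind[where B="?M (Suc t)"] measurable_cong_sets[OF sets_C[OF und] refl])
    also have "\<dots> = (\<integral>\<^sup>+x. (\<integral>\<^sup>+y. g (x(t := y)) \<partial>transition n \<rho> t x) \<partial>C 0 t (\<lambda>_. undefined))"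
      by (rule nn_integral_cong) (simp add: space_C[OF und] nn_integral_eP[OF _ g])
    finally show ?thesis .
  qed
  have main: "(\<integral>\<^sup>+x. f (map x [0..<Suc t]) \<partial>C 0 (Suc t) (\<lambda>_. undefined)) = (\<integral>\<^sup>+h. f h \<partial>trajectory_pmf n \<rho> t)"
    for f t
  proof (induction t arbitrary: f)
    case 0
    have "(\<integral>\<^sup>+y. f [y] \<partial>transition n \<rho> 0 (\<lambda>_. undefined)) = f [singletons n]"
      unfolding transition_def
      by (subst nn_integral_restrict_space) (auto simp: singletons_in_configs)
    moreover have "g \<in> borel_measurable (?M 0)" for g :: "(nat \<Rightarrow> cluster set) \<Rightarrow> ennreal"
      unfolding PiM by simp
    ultimately show ?case
      unfolding step unfolding C.simps by (subst nn_integral_return[OF und]) auto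
  next
    case (Suc t)
    let ?g = "\<lambda>h. \<integral>\<^sup>+y. f (h @ [y]) \<partial>round_pmf n (\<rho> (butlast h)) (last h)"
    have "(\<integral>\<^sup>+x. f (map x [0..<Suc (Suc t)]) \<partial>C 0 (Suc (Suc t)) (\<lambda>_. undefined))
      = (\<integral>\<^sup>+x. ?g (map x [0..<Suc t]) \<partial>C 0 (Suc t) (\<lambda>_. undefined))"
      unfolding step[where t="Suc t"]
    proof (rule nn_integral_cong)
      fix x assume "x \<in> space (C 0 (Suc t) (\<lambda>_. undefined))"
      then have "x t \<in> configs n" by (simp add: space_C[OF und] space_PiM PiE_iff del: C.simps)
      moreover have "map (x(Suc t := y)) [0..<Suc (Suc t)] = map x [0..<Suc t] @ [y]" for y by simp
      ultimately show "(\<integral>\<^sup>+y. f (map (x(Suc t := y)) [0..<Suc (Suc t)]) \<partial>transition n \<rho> (Suc t) x)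
          = ?g (map x [0..<Suc t])" by (simp add: tr butlast_append)
    qed
    also have "\<dots> = (\<integral>\<^sup>+h. f h \<partial>trajectory_pmf n \<rho> (Suc t))"
      unfolding Suc.IH[of ?g] trajectory_pmf.simps by (simp only: nn_integral_bind_pmf nn_integral_map_pmf)
    finally show ?case .
  qed
  \<comment> \<open>\<open>CI J\<close> is the law built up to the end of \<open>J\<close>,
    projected to \<open>J\<close>; for an initial segment the projection is trivial.\<close>
  have CI: "CI {0..<Suc t} = C 0 (Suc t) (\<lambda>_. undefined)"
  proof -
    have "up_to {0..<Suc t} = Suc t"
      using up_to_less[of "{0..<Suc t}" t] up_to_iff[of "{0..<Suc t}" "Suc t"] by simp
    then show ?thesis unfolding CI_def
      using distr_C[OF order_refl und, of "Suc t"] by (simp only: add_0)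
  qed
  have "(\<integral>\<^sup>+\<omega>. f (map \<omega> [0..<Suc t]) \<partial>process n \<rho>)
      = (\<integral>\<^sup>+\<omega>. f (map (restrict \<omega> {0..<Suc t}) [0..<Suc t]) \<partial>process n \<rho>)"
    by (intro nn_integral_cong arg_cong[where f=f]) auto
  also have "\<dots> = (\<integral>\<^sup>+x. f (map x [0..<Suc t]) \<partial>distr (process n \<rho>) (?M (Suc t)) (\<lambda>x. restrict x {0..<Suc t}))"
  proof (subst nn_integral_distr)
    show "(\<lambda>x. restrict x {0..<Suc t}) \<in> process n \<rho> \<rightarrow>\<^sub>M ?M (Suc t)"
      by (auto intro!: measurable_restrict simp: measurable_cong_sets[OF sets_process[OF \<rho>] refl])
    show "(\<lambda>x. f (map x [0..<Suc t])) \<in> borel_measurable (distr (process n \<rho>) (?M (Suc t)) (\<lambda>x. restrict x {0..<Suc t}))"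
      unfolding PiM by (simp add: measurable_distr_eq1)
  qed (rule refl)
  also have "\<dots> = (\<integral>\<^sup>+h. f h \<partial>trajectory_pmf n \<rho> t)"
    unfolding process_def by (simp only: distr_lim finite_atLeastLessThan CI main)
  finally show ?thesis .
qed

lemma emeasure_process:
  assumes \<rho>: "proper_rule n \<rho>"
  shows "emeasure (process n \<rho>) {\<omega> \<in> space (process n \<rho>). P (map \<omega> [0..<Suc t])}
    = emeasure (trajectory_pmf n \<rho> t) {h. P h}"
proof -
  have PiM: "PiM {0..<Suc t} (\<lambda>_. count_space (configs n)) = count_space (PiE {0..<Suc t} (\<lambda>_. configs n))"
    by (rule count_space_PiM_finite) (simp_all add: configs_finite countable_finite)
  have "(\<lambda>\<omega>. restrict \<omega> {0..<Suc t}) \<in> process n \<rho> \<rightarrow>\<^sub>M PiM {0..<Suc t} (\<lambda>_. count_space (configs n))"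
    by (auto intro!: measurable_restrict simp: measurable_cong_sets[OF sets_process[OF \<rho>] refl])
  then have "(\<lambda>\<omega>. P (map (restrict \<omega> {0..<Suc t}) [0..<Suc t])) \<in> process n \<rho> \<rightarrow>\<^sub>M count_space UNIV"
    unfolding PiM by (rule measurable_compose) simp
  moreover have "map (restrict \<omega> {0..<Suc t}) [0..<Suc t] = map \<omega> [0..<Suc t]" for \<omega> :: "nat \<Rightarrow> cluster set"
    by auto
  ultimately have "(\<lambda>\<omega>. P (map \<omega> [0..<Suc t])) \<in> process n \<rho> \<rightarrow>\<^sub>M count_space UNIV" by (simp del: upt_Suc)
  then have "{\<omega> \<in> space (process n \<rho>). P (map \<omega> [0..<Suc t])} \<in> sets (process n \<rho>)"
    by (simp add: pred_def del: upt_Suc)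
  then have "emeasure (process n \<rho>) {\<omega> \<in> space (process n \<rho>). P (map \<omega> [0..<Suc t])}
      = (\<integral>\<^sup>+\<omega>. indicator {h. P h} (map \<omega> [0..<Suc t]) \<partial>process n \<rho>)"
    by (subst nn_integral_indicator[symmetric])
       (auto intro!: nn_integral_cong split: split_indicator simp del: upt_Suc nn_integral_indicator)
  also have "\<dots> = emeasure (trajectory_pmf n \<rho> t) {h. P h}"
    unfolding nn_integral_process[OF \<rho>] by simp
  finally show ?thesis .
qed

section \<open>Product distributions\<close>

lemma integrable_pmf_bounded:
  fixes f :: "'a \<Rightarrow> real"
  assumes "\<And>x. \<bar>f x\<bar> \<le> K"
  shows "integrable (measure_pmf p) f"
  by (rule measure_pmf.integrable_const_bound[of _ K]) (use assms in auto)

lemma expectation_bind_pmf_bounded: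
  fixes f :: "'a \<Rightarrow> real"
  assumes "\<And>x. \<bar>f x\<bar> \<le> K"
  shows "measure_pmf.expectation (bind_pmf p q) f
    = measure_pmf.expectation p (\<lambda>x. measure_pmf.expectation (q x) f)"
proof -
  \<comment> \<open>The shift by \<open>K\<close> makes the integrand nonnegative, so that the
    identity can be taken from \<open>nn_integral\<close>.\<close>
  let ?g = "\<lambda>x. f x + K"
  have g0: "0 \<le> ?g x" for x using assms[of x] by linarith
  have g: "\<bar>?g x\<bar> \<le> 2 * K" for x using assms[of x] by linarith
  have gi: "integrable (measure_pmf M) ?g" for M by (rule integrable_pmf_bounded[OF g])
  have fi: "integrable (measure_pmf M) f" for M by (rule integrable_pmf_bounded[OF assms])
  have h0: "0 \<le> measure_pmf.expectation (q x) ?g" for x by (rule integral_nonneg_AE) (simp add: g0)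
  have h1: "measure_pmf.expectation (q x) ?g \<le> 2 * K" for x
    using integral_mono[OF gi, of "q x" "\<lambda>_. 2 * K"] abs_le_D1[OF g] by simp
  have hi: "integrable (measure_pmf p) (\<lambda>x. measure_pmf.expectation (q x) ?g)"
    by (rule integrable_pmf_bounded[of _ "2 * K"]) (use h0 h1 in simp)
  have "ennreal (measure_pmf.expectation (bind_pmf p q) ?g) = (\<integral>\<^sup>+x. \<integral>\<^sup>+y. ?g y \<partial>q x \<partial>p)"
    by (subst nn_integral_eq_integral[symmetric, OF gi]) (use g0 in simp_all)
  also have "\<dots> = (\<integral>\<^sup>+x. ennreal (measure_pmf.expectation (q x) ?g) \<partial>p)"
    by (rule nn_integral_cong) (rule nn_integral_eq_integral[OF gi], use g0 in simp)
  also have "\<dots> = ennreal (measure_pmf.expectation p (\<lambda>x. measure_pmf.expectation (q x) ?g))"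
    by (rule nn_integral_eq_integral[OF hi]) (simp add: h0)
  finally have eq: "measure_pmf.expectation (bind_pmf p q) ?g
      = measure_pmf.expectation p (\<lambda>x. measure_pmf.expectation (q x) ?g)"
    by (subst (asm) ennreal_inj) (auto intro!: integral_nonneg_AE simp: g0 h0)
  have "integrable (measure_pmf p) (\<lambda>x. measure_pmf.expectation (q x) f)"
    using Bochner_Integration.integrable_diff[OF hi, of "\<lambda>_. K"] fi by simp
  then show ?thesis using eq fi by simp
qed

lemma Pi_pmf_prob_subset:
  assumes "finite A" "A' \<subseteq> A"
  shows "measure_pmf.prob (Pi_pmf A d p) {f. \<forall>x\<in>A'. f x \<in> B x} = (\<Prod>x\<in>A'. measure_pmf.prob (p x) (B x))"
proof -
  have "{f. \<forall>x\<in>A'. f x \<in> B x} = Pi A (\<lambda>x. if x \<in> A' then B x else UNIV)"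
    using assms(2) by (fastforce simp: Pi_iff)
  then have "measure_pmf.prob (Pi_pmf A d p) {f. \<forall>x\<in>A'. f x \<in> B x}
      = (\<Prod>x\<in>A. measure_pmf.prob (p x) (if x \<in> A' then B x else UNIV))"
    by (simp only: measure_Pi_pmf_Pi[OF assms(1)])
  also have "\<dots> = (\<Prod>x\<in>A'. measure_pmf.prob (p x) (B x))"
    using assms by (intro prod.mono_neutral_cong_right) auto
  finally show ?thesis .
qed

lemma integral_Pi_pmf_insert:
  fixes F :: "('a \<Rightarrow> 'b) \<Rightarrow> real"
  assumes "finite A" "x \<notin> A" and K: "\<And>f. \<bar>F f\<bar> \<le> K"
  shows "measure_pmf.expectation (Pi_pmf (insert x A) d p) F
    = measure_pmf.expectation (Pi_pmf A d p) (\<lambda>f. measure_pmf.expectation (p x) (\<lambda>y. F (f(x := y))))"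
proof -
  have "Pi_pmf (insert x A) d p = bind_pmf (Pi_pmf A d p) (\<lambda>f. map_pmf (\<lambda>y. f(x := y)) (p x))"
    unfolding Pi_pmf_insert'[OF assms(1,2)]
    by (subst bind_commute_pmf) (simp add: map_pmf_def)
  moreover have "measure_pmf.expectation (bind_pmf (Pi_pmf A d p) (\<lambda>f. map_pmf (\<lambda>y. f(x := y)) (p x))) F
      = measure_pmf.expectation (Pi_pmf A d p)
          (\<lambda>f. measure_pmf.expectation (map_pmf (\<lambda>y. f(x := y)) (p x)) F)"
    by (rule expectation_bind_pmf_bounded[OF K])
  ultimately show ?thesis by (simp add: comp_def)
qed

text \<open>An Efron-Stein type inequality, by induction on the coordinates. Averaging out the new
  coordinate leaves a function with the same difference bound, to which the induction hypothesis
  applies; the new coordinate itself adds at most the square of \<open>c\<close>.\<close>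

lemma Pi_pmf_variance_bounded_differences:
  fixes F :: "('a \<Rightarrow> 'b) \<Rightarrow> real"
  assumes "finite A" and "\<And>f. \<bar>F f\<bar> \<le> K"
    and "\<And>f x v. x \<in> A \<Longrightarrow> \<bar>F (f(x := v)) - F f\<bar> \<le> c"
  shows "measure_pmf.expectation (Pi_pmf A d p)
      (\<lambda>f. (F f - measure_pmf.expectation (Pi_pmf A d p) F)\<^sup>2) \<le> real (card A) * c\<^sup>2"
  using assms
proof (induction A arbitrary: F rule: finite_induct)
  case empty
  then show ?case by simp
next
  case (insert x A)
  let ?g = "\<lambda>f. measure_pmf.expectation (p x) (\<lambda>y. F (f(x := y)))"
  let ?P = "Pi_pmf A d p"
  define \<mu> where "\<mu> = measure_pmf.expectation ?P ?g"
  have K: "\<bar>F f\<bar> \<le> K" for f by (rule insert.prems)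
  have int: "integrable (measure_pmf (p x)) (\<lambda>y. F (f(x := y)))" for f
    by (rule integrable_pmf_bounded[of _ K]) (rule K)
  have abs_int: "\<bar>measure_pmf.expectation (p x) h\<bar> \<le> B" if "\<And>y. \<bar>h y\<bar> \<le> B" for h :: "'b \<Rightarrow> real" and B
  proof -
    have "integrable (measure_pmf (p x)) h" by (rule integrable_pmf_bounded[of _ B]) (rule that)
    then have "\<bar>measure_pmf.expectation (p x) h\<bar> \<le> measure_pmf.expectation (p x) (\<lambda>y. \<bar>h y\<bar>)"
      by simp
    also have "\<dots> \<le> measure_pmf.expectation (p x) (\<lambda>y. B)"
      using \<open>integrable _ h\<close> that by (intro integral_mono) auto
    finally show ?thesis by simp
  qed
  have gK: "\<bar>?g f\<bar> \<le> K" for f by (rule abs_int) (rule K)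
  have mu: "measure_pmf.expectation (Pi_pmf (insert x A) d p) F = \<mu>"
    unfolding \<mu>_def by (rule integral_Pi_pmf_insert[OF insert.hyps K])
  have muK: "\<bar>\<mu>\<bar> \<le> K"
  proof -
    have "integrable (measure_pmf ?P) ?g" by (rule integrable_pmf_bounded[of _ K]) (rule gK)
    then have "\<bar>\<mu>\<bar> \<le> measure_pmf.expectation ?P (\<lambda>y. \<bar>?g y\<bar>)"
      unfolding \<mu>_def by simp
    also have "\<dots> \<le> measure_pmf.expectation ?P (\<lambda>y. K)"
      using \<open>integrable _ ?g\<close> gK by (intro integral_mono) auto
    finally show ?thesis by simp
  qed
  have K0: "K \<ge> 0" using K[of undefined] by linarith
  have sq: "\<bar>(s - r)\<^sup>2\<bar> \<le> (2*K)\<^sup>2" if "\<bar>s\<bar> \<le> K" "\<bar>r\<bar> \<le> K" for s r :: real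
  proof -
    have "\<bar>s - r\<bar> \<le> 2 * K" using that by linarith
    then show ?thesis by (metis abs_ge_zero abs_power2 power2_abs power_mono)
  qed
  have inner: "measure_pmf.expectation (p x) (\<lambda>y. (F (f(x := y)) - \<mu>)\<^sup>2) \<le> c\<^sup>2 + (?g f - \<mu>)\<^sup>2" for f
  proof -
    let ?h = "\<lambda>y. F (f(x := y))"
    have i2: "integrable (measure_pmf (p x)) (\<lambda>y. (?h y - ?g f)\<^sup>2)"
      by (rule integrable_pmf_bounded[of _ "(2*K)\<^sup>2"]) (rule sq[OF K gK])
    \<comment> \<open>Expansion around the conditional mean \<open>?g f\<close>; the mixed term has
      mean zero.\<close>
    have "measure_pmf.expectation (p x) (\<lambda>y. (?h y - \<mu>)\<^sup>2)
      = measure_pmf.expectation (p x) (\<lambda>y. (?h y - ?g f)\<^sup>2 + 2 * (?g f - \<mu>) * (?h y - ?g f) + (?g f - \<mu>)\<^sup>2)"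
      by (rule Bochner_Integration.integral_cong) (auto simp: power2_eq_square algebra_simps)
    also have "\<dots> = measure_pmf.expectation (p x) (\<lambda>y. (?h y - ?g f)\<^sup>2)
       + 2 * (?g f - \<mu>) * measure_pmf.expectation (p x) (\<lambda>y. ?h y - ?g f) + (?g f - \<mu>)\<^sup>2"
      using i2 int by simp
    also have "measure_pmf.expectation (p x) (\<lambda>y. ?h y - ?g f) = 0" using int by simp
    also have "measure_pmf.expectation (p x) (\<lambda>y. (?h y - ?g f)\<^sup>2) \<le> c\<^sup>2"
    proof (rule order.trans[OF integral_mono[OF i2, of "\<lambda>_. c\<^sup>2"]])
      fix y
      have "\<bar>?h y - ?g f\<bar> = \<bar>measure_pmf.expectation (p x) (\<lambda>z. ?h y - ?h z)\<bar>" using int by simp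
      also have "\<dots> \<le> c"
      proof (rule abs_int)
        show "\<bar>?h y - ?h z\<bar> \<le> c" for z using insert.prems(2)[of x "f(x := z)" y] by (simp only: fun_upd_upd insertI1)
      qed
      finally show "(?h y - ?g f)\<^sup>2 \<le> c\<^sup>2" by (metis abs_ge_zero power2_abs power_mono)
    qed simp_all
    finally show ?thesis by (simp only: mult_zero_right add_0_right)
  qed
  have IH: "measure_pmf.expectation ?P (\<lambda>f. (?g f - \<mu>)\<^sup>2) \<le> real (card A) * c\<^sup>2"
    unfolding \<mu>_def
  proof (rule insert.IH)
    fix f z v assume z: "z \<in> A"
    then have zx: "z \<noteq> x" using insert.hyps by auto
    have "?g (f(z := v)) - ?g f = measure_pmf.expectation (p x) (\<lambda>y. F ((f(z := v))(x := y)) - F (f(x := y)))"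
      using int by simp
    moreover have "\<bar>F ((f(z := v))(x := y)) - F (f(x := y))\<bar> \<le> c" for y
      using insert.prems(2)[of z "f(x := y)" v] z unfolding fun_upd_twist[OF zx] by (simp only: insertI2)
    ultimately show "\<bar>?g (f(z := v)) - ?g f\<bar> \<le> c"
      by (simp only: abs_int)
  qed (rule gK)
  have sq2: "\<bar>(F f - \<mu>)\<^sup>2\<bar> \<le> (2*K)\<^sup>2" for f by (rule sq[OF K muK])
  have "measure_pmf.expectation (Pi_pmf (insert x A) d p) (\<lambda>f. (F f - \<mu>)\<^sup>2)
    = measure_pmf.expectation ?P (\<lambda>f. measure_pmf.expectation (p x) (\<lambda>y. (F (f(x := y)) - \<mu>)\<^sup>2))"
    by (rule integral_Pi_pmf_insert[OF insert.hyps sq2])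
  also have "\<dots> \<le> measure_pmf.expectation ?P (\<lambda>f. c\<^sup>2 + (?g f - \<mu>)\<^sup>2)"
  proof (rule integral_mono[OF _ _ inner])
    show "integrable (measure_pmf ?P) (\<lambda>f. measure_pmf.expectation (p x) (\<lambda>y. (F (f(x := y)) - \<mu>)\<^sup>2))"
      by (rule integrable_pmf_bounded) (rule abs_int[OF sq2])
    show "integrable (measure_pmf ?P) (\<lambda>f. c\<^sup>2 + (?g f - \<mu>)\<^sup>2)"
      by (intro Bochner_Integration.integrable_add integrable_pmf_bounded[OF sq[OF gK muK]]) simp
  qed
  also have "\<dots> = c\<^sup>2 + measure_pmf.expectation ?P (\<lambda>f. (?g f - \<mu>)\<^sup>2)"
    by (subst Bochner_Integration.integral_add) (auto intro: integrable_pmf_bounded[OF sq[OF gK muK]])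
  also have "\<dots> \<le> real (card (insert x A)) * c\<^sup>2"
    using IH insert.hyps by (simp add: algebra_simps)
  finally show ?case unfolding mu .
qed

text \<open>By exchangeability every index is equally likely to be picked from the random subset.\<close>

lemma random_subset_average:
  fixes u :: "'a \<Rightarrow> real" and p :: real
  assumes fin: "finite J" and "J \<noteq> {}" and p: "0 \<le> p" "p \<le> 1"
  shows "measure_pmf.expectation (Pi_pmf J False (\<lambda>_. bernoulli_pmf p))
      (\<lambda>b. (\<Sum>j\<in>{j\<in>J. b j}. u j) / real (card {j\<in>J. b j}))
    = (1 - (1 - p) ^ card J) * (\<Sum>j\<in>J. u j) / real (card J)"
proof -
  let ?P = "Pi_pmf J False (\<lambda>_. bernoulli_pmf p)"
  let ?N = "\<lambda>b. {j\<in>J. b j}"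
  define e where "e j = measure_pmf.expectation ?P (\<lambda>b. of_bool (b j) / real (card (?N b)))" for j
  have bd: "\<bar>of_bool (b j) / real (card (?N b))\<bar> \<le> 1" for b j
    by (auto simp: divide_simps)
  have int: "integrable (measure_pmf ?P) (\<lambda>b. of_bool (b j) / real (card (?N b)))" for j
    by (rule integrable_pmf_bounded[OF bd])
  have sym: "e j = e k" if jk: "j \<in> J" "k \<in> J" for j k
  proof -
    let ?t = "Transposition.transpose j k"
    have bij: "bij_betw ?t J J"
      using jk by (intro bij_betwI[of _ _ _ ?t]) (auto simp: Transposition.transpose_def)
    have "?P = map_pmf (\<lambda>b. b \<circ> ?t) ?P"
      by (rule Pi_pmf_bij_betw[OF fin bij]) (use jk in \<open>auto simp: Transposition.transpose_def\<close>)
    then have "e j = measure_pmf.expectation (map_pmf (\<lambda>b. b \<circ> ?t) ?P)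
        (\<lambda>b. of_bool (b j) / real (card (?N b)))"
      unfolding e_def by simp
    also have "\<dots> = measure_pmf.expectation ?P (\<lambda>b. of_bool (b k) / real (card {i\<in>J. b (?t i)}))"
      by (simp add: comp_def)
    also have "(\<lambda>b. card {i\<in>J. b (?t i)}) = (\<lambda>b. card (?N b))"
    proof
      fix b
      show "card {i\<in>J. b (?t i)} = card (?N b)"
        by (rule bij_betw_same_card[of ?t], rule bij_betwI[of _ _ _ ?t])
          (use jk in \<open>auto simp: Transposition.transpose_def split: if_splits\<close>)
    qed
    finally show ?thesis unfolding e_def .
  qed
  obtain i0 where i0: "i0 \<in> J" using assms by auto
  have eq: "e j = e i0" if "j \<in> J" for j using sym[OF that i0] .
  have sum_e: "measure_pmf.expectation ?P (\<lambda>b. (\<Sum>j\<in>?N b. v j) / real (card (?N b))) = (\<Sum>j\<in>J. v j * e j)"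
    for v :: "'a \<Rightarrow> real"
  proof -
    have "(\<Sum>j\<in>?N b. v j) / real (card (?N b)) = (\<Sum>j\<in>J. v j * (of_bool (b j) / real (card (?N b))))" for b
    proof -
      have "(\<Sum>j\<in>?N b. v j) = (\<Sum>j\<in>J. v j * of_bool (b j))"
        using fin by (intro sum.mono_neutral_cong_left) auto
      then show ?thesis by (simp add: sum_divide_distrib)
    qed
    moreover have "measure_pmf.expectation ?P (\<lambda>b. \<Sum>j\<in>J. v j * (of_bool (b j) / real (card (?N b))))
        = (\<Sum>j\<in>J. v j * e j)"
      unfolding e_def integral_mult_right_zero[symmetric]
      by (rule Bochner_Integration.integral_sum) (rule integrable_mult_right, rule int)
    ultimately show ?thesis by (simp only:)
  qed
  define S where "S = {b. ?N b = {}}"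
  have empty_prob: "measure_pmf.prob ?P S = (1 - p) ^ card J"
  proof -
    have "S = {b. \<forall>j\<in>J. b j \<in> {False}}" by (auto simp: S_def)
    then show ?thesis using Pi_pmf_prob_subset[OF fin order_refl, of False "\<lambda>_. bernoulli_pmf p" "\<lambda>_. {False}"] p
      by (simp add: measure_pmf_single)
  qed
  \<comment> \<open>Weights identically 1 determine the common value: the average is 1 unless the
    subset is empty, where \<open>0 / 0 = 0\<close>; hence the factor
    \<open>1 - (1 - p) ^ card J\<close>.\<close>
  have "(\<Sum>j\<in>J. e j) = measure_pmf.expectation ?P (\<lambda>b. (\<Sum>j\<in>?N b. 1) / real (card (?N b)))"
    using sum_e[of "\<lambda>_. 1"] by simp
  also have "\<dots> = measure_pmf.expectation ?P (\<lambda>b. 1 - indicator S b)"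
    using fin by (intro Bochner_Integration.integral_cong) (auto simp: indicator_def S_def)
  also have "\<dots> = 1 - (1 - p) ^ card J"
    by (subst Bochner_Integration.integral_diff) (auto simp: empty_prob intro!: integrable_pmf_bounded[of _ 1] split: split_indicator)
  finally have "real (card J) * e i0 = 1 - (1 - p) ^ card J" using eq by simp
  then have "e i0 = (1 - (1 - p) ^ card J) / real (card J)"
    using fin assms(2) by (auto simp: field_simps)
  then show ?thesis unfolding sum_e using eq by (simp add: sum_distrib_right[symmetric] sum_divide_distrib[symmetric] mult.commute)
qed

section \<open>Merging clusters\<close>

lemma configs_disjoint:
  assumes "C \<in> configs n" "i \<in> C" "j \<in> C" "x \<in> i" "x \<in> j"
  shows "i = j"
  using assms by (auto simp: configs_def partition_on_def pairwise_def disjnt_def)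

lemma configs_nonempty: "C \<in> configs n \<Longrightarrow> i \<in> C \<Longrightarrow> i \<noteq> {}"
  by (auto simp: configs_def partition_on_def)

lemma configs_subset: "C \<in> configs n \<Longrightarrow> i \<in> C \<Longrightarrow> i \<subseteq> {..<n}"
  by (auto simp: configs_def partition_on_def)

lemma configs_finite_cluster: "C \<in> configs n \<Longrightarrow> i \<in> C \<Longrightarrow> finite i"
  by (rule finite_subset[OF configs_subset finite_lessThan])

lemma configs_card_pos: "C \<in> configs n \<Longrightarrow> i \<in> C \<Longrightarrow> 0 < card i"
  using configs_nonempty configs_finite_cluster by (simp add: card_gt_0_iff)

lemma configs_sum_card:
  assumes "C \<in> configs n"
  shows "(\<Sum>i\<in>C. card i) = n"
proof -
  have "card (\<Union>C) = (\<Sum>i\<in>C. card i)"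
    using assms configs_finite_cluster[OF assms] by (intro card_Union_disjoint)
      (simp_all add: configs_def partition_on_def pairwise_def)
  then show ?thesis using assms by (simp add: configs_def partition_on_def)
qed

text \<open>What both rules have in common: the pairs \<open>(i, the (s i))\<close> form a matching
  of \<open>C\<close>, each pair indexed by its accepting cluster.\<close>

definition valid_selection :: "cluster set \<Rightarrow> selection \<Rightarrow> bool" where
  "valid_selection C s \<longleftrightarrow>
     (\<forall>i j. s i = Some j \<longrightarrow> i \<in> C \<and> j \<in> C \<and> s j = None) \<and>
     (\<forall>i i' j. s i = Some j \<longrightarrow> s i' = Some j \<longrightarrow> i = i')"

definition merging :: "cluster set \<Rightarrow> selection \<Rightarrow> cluster set" where
  "merging C s = {i \<in> C. s i \<noteq> None}"

lemma selects_from_SomeD: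
  assumes "selects_from cand C act s" "s i = Some j"
  shows "i \<in> C \<and> act i = None \<and> j \<in> cand i"
  using assms unfolding selects_from_def by (metis option.distinct(1) option.inject)

text \<open>A selected cluster issues and therefore selects nothing itself; its request names one
  agent, which lies in a single cluster, so no two accepting clusters select the same one.\<close>

lemma valid_selectionI:
  assumes C: "C \<in> configs n" and cand: "\<And>i. cand i \<subseteq> incoming C act i"
    and s: "selects_from cand C act s"
  shows "valid_selection C s"
proof -
  have sel: "i \<in> C \<and> act i = None \<and> j \<in> C \<and> (\<exists>a \<in> i. act j = Some a)" if "s i = Some j" for i j
    using selects_from_SomeD[OF s that] cand[of i] by (auto simp: incoming_def)
  have "s j = None" if "s i = Some j" for i j
    using sel[OF that] sel[of j] by (cases "s j") auto
  moreover have "i = i'" if "s i = Some j" "s i' = Some j" for i i' j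
    using sel[OF that(1)] sel[OF that(2)] configs_disjoint[OF C, of i i'] by (metis option.inject)
  ultimately show ?thesis using sel unfolding valid_selection_def by blast
qed

section \<open>Effect of a matching on sums over the clusters\<close>

context
  fixes C n s
  assumes C: "C \<in> configs n" and s: "valid_selection C s"
begin

lemma merging_partner: "i \<in> merging C s \<Longrightarrow> the (s i) \<in> C - merging C s"
  using s by (auto simp: merging_def valid_selection_def)

lemma merging_partner_inj: "inj_on (\<lambda>i. the (s i)) (merging C s)"
  using s unfolding inj_on_def merging_def valid_selection_def by force

lemma merging_disjoint: "i \<in> merging C s \<Longrightarrow> i \<inter> the (s i) = {}"
  using merging_partner[of i] configs_disjoint[OF C, of i "the (s i)"]
  by (fastforce simp: merging_def)

lemma merging_finite: "finite (merging C s)"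
  using config_finite[OF C] by (simp add: merging_def)

lemma merging_card: "2 * card (merging C s) \<le> card C"
proof -
  have "card (merging C s) + card ((\<lambda>i. the (s i)) ` merging C s)
      = card (merging C s \<union> (\<lambda>i. the (s i)) ` merging C s)"
    using merging_partner by (intro card_Un_disjoint[symmetric]) (auto simp: merging_finite)
  also have "\<dots> \<le> card C"
    using merging_partner config_finite[OF C] by (intro card_mono) (auto simp: merging_def)
  finally show ?thesis by (simp add: card_image[OF merging_partner_inj])
qed

text \<open>The new configuration splits into the unions of matched pairs and the unmatched
  clusters. Applied to a constant, to \<open>1 - q ^ k\<close> and to squares, this gives the change
  of every functional that is followed below.\<close>

lemma sum_merge_clusters:
  fixes f :: "nat \<Rightarrow> real"
  shows "(\<Sum>x\<in>merge_clusters C s. f (card x)) = (\<Sum>i\<in>C. f (card i))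
    + (\<Sum>i\<in>merging C s. f (card i + card (the (s i))) - f (card i) - f (card (the (s i))))"
proof -
  let ?A = "merging C s" and ?p = "\<lambda>i. the (s i)"
  let ?R = "C - ?A - ?p ` ?A"
  have fin: "finite C" by (rule config_finite[OF C])
  have M: "merge_clusters C s = (\<lambda>i. i \<union> ?p i) ` ?A \<union> ?R"
  proof (intro equalityI subsetI)
    fix x assume "x \<in> merge_clusters C s"
    then consider i j where "x = i \<union> j" "i \<in> C" "s i = Some j"
      | "x \<in> C" "s x = None" "\<forall>k\<in>C. s k \<noteq> Some x"
      by (auto simp: merge_clusters_def)
    then show "x \<in> (\<lambda>i. i \<union> ?p i) ` ?A \<union> ?R"
    proof cases
      case 1
      then have "i \<in> ?A" "x = i \<union> ?p i" by (auto simp: merging_def)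
      then show ?thesis by blast
    qed (auto simp: merging_def)
  next
    fix x assume "x \<in> (\<lambda>i. i \<union> ?p i) ` ?A \<union> ?R"
    then show "x \<in> merge_clusters C s"
    proof
      assume "x \<in> (\<lambda>i. i \<union> ?p i) ` ?A"
      then obtain i where "i \<in> C" "x = i \<union> ?p i" "s i = Some (?p i)" by (auto simp: merging_def)
      then show ?thesis unfolding merge_clusters_def by blast
    next
      assume x: "x \<in> ?R"
      have "s k \<noteq> Some x" if "k \<in> C" for k
      proof
        assume "s k = Some x"
        then have "x \<in> ?p ` ?A" using that by (auto simp: merging_def intro!: image_eqI[of _ _ k])
        then show False using x by blast
      qed
      then show ?thesis using x by (simp add: merge_clusters_def merging_def)
    qed
  qed
  have inj: "inj_on (\<lambda>i. i \<union> ?p i) ?A"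
  proof (rule inj_onI)
    fix i i' assume ii: "i \<in> ?A" "i' \<in> ?A" "i \<union> ?p i = i' \<union> ?p i'"
    obtain x where x: "x \<in> i" using ii(1) configs_nonempty[OF C] by (auto simp: merging_def)
    then have "x \<in> i' \<or> x \<in> ?p i'" using ii by auto
    then show "i = i'"
      using configs_disjoint[OF C _ _ x, of i'] configs_disjoint[OF C _ _ x, of "?p i'"]
        merging_partner[OF ii(2)] ii by (auto simp: merging_def)
  qed
  have disj: "(\<lambda>i. i \<union> ?p i) ` ?A \<inter> ?R = {}"
  proof (rule ccontr)
    assume "\<not> ?thesis"
    then obtain i where i: "i \<in> ?A" "i \<union> ?p i \<in> ?R" by auto
    obtain x where x: "x \<in> i" using i(1) configs_nonempty[OF C] by (auto simp: merging_def)
    then have "i \<union> ?p i = i" using i configs_disjoint[OF C, of "i \<union> ?p i" i x] by (auto simp: merging_def)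
    then show False using i by (auto simp: merging_def)
  qed
  have sub: "?p ` ?A \<subseteq> C - ?A" "?A \<subseteq> C"
    using merging_partner by blast (auto simp: merging_def)
  have "(\<Sum>x\<in>merge_clusters C s. f (card x)) = (\<Sum>i\<in>?A. f (card (i \<union> ?p i))) + (\<Sum>i\<in>?R. f (card i))"
    unfolding M by (subst sum.union_disjoint)
      (auto simp: fin merging_finite disj sum.reindex[OF inj] comp_def)
  also have "(\<Sum>i\<in>?A. f (card (i \<union> ?p i))) = (\<Sum>i\<in>?A. f (card i + card (?p i)))"
  proof (rule sum.cong[OF refl])
    fix i assume i: "i \<in> ?A"
    then have "finite i" "finite (?p i)"
      using configs_finite_cluster[OF C] merging_partner[OF i] by (auto simp: merging_def)
    then show "f (card (i \<union> ?p i)) = f (card i + card (?p i))"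
      using merging_disjoint[OF i] by (simp add: card_Un_disjoint)
  qed
  also have "(\<Sum>i\<in>?R. f (card i)) = (\<Sum>i\<in>C. f (card i)) - (\<Sum>i\<in>?A. f (card i)) - (\<Sum>i\<in>?p ` ?A. f (card i))"
    using fin sub by (simp add: sum_diff)
  also have "(\<Sum>i\<in>?p ` ?A. f (card i)) = (\<Sum>i\<in>?A. f (card (?p i)))"
    by (simp add: sum.reindex[OF merging_partner_inj])
  finally show ?thesis by (simp add: sum_subtractf)
qed

lemma card_merge_clusters: "real (card (merge_clusters C s)) = real (card C) - real (card (merging C s))"
  using sum_merge_clusters[of "\<lambda>_. 1"] by (simp add: sum_negf)

end

text \<open>A generating function of the cluster sizes: \<open>q = 0\<close> counts clusters, and
  \<open>q = exp (- s k / n)\<close> leads to the Laplace transform at scale \<open>s\<close>. The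
  form \<open>1 - q ^ m\<close> makes a merge act by subtracting a product.\<close>

definition size_transform :: "real \<Rightarrow> cluster set \<Rightarrow> real" where
  "size_transform q C = (\<Sum>i\<in>C. 1 - q ^ card i)"

lemma size_transform_merge_clusters:
  assumes "C \<in> configs n" "valid_selection C s"
  shows "size_transform q (merge_clusters C s) = size_transform q C
    - (\<Sum>i\<in>merging C s. (1 - q ^ card i) * (1 - q ^ card (the (s i))))"
proof -
  have "1 - q ^ (a + b) - (1 - q ^ a) - (1 - q ^ b) = - ((1 - q ^ a) * (1 - q ^ b))" for a b
    by (simp add: power_add algebra_simps)
  then show ?thesis
    unfolding size_transform_def sum_merge_clusters[OF assms, of "\<lambda>k. 1 - q ^ k"]
    by (simp add: sum_negf)
qed

section \<open>Law of a single request and of the requests received by a cluster\<close>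

definition request_pmf :: "nat \<Rightarrow> nat option pmf" where
  "request_pmf n = bind_pmf (bernoulli_pmf (1/2)) (\<lambda>issue.
       if issue then map_pmf Some (pmf_of_set {..<n}) else return_pmf None)"

lemma actions_pmf_eq: "actions_pmf n C = Pi_pmf C None (\<lambda>_. request_pmf n)"
  by (simp add: actions_pmf_def request_pmf_def)

lemma expectation_request_pmf:
  fixes f :: "nat option \<Rightarrow> real"
  assumes "0 < n" and "\<And>x. \<bar>f x\<bar> \<le> K"
  shows "measure_pmf.expectation (request_pmf n) f = (f None + (\<Sum>a<n. f (Some a)) / real n) / 2"
  unfolding request_pmf_def using assms(1)
  by (subst expectation_bind_pmf_bounded[OF assms(2)])
     (auto simp: integral_pmf_of_set field_simps lessThan_empty_iff)

lemma prob_request_pmf: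
  assumes "0 < n"
  shows "measure_pmf.prob (request_pmf n) X = (of_bool (None \<in> X) + real (card {a. a < n \<and> Some a \<in> X}) / real n) / 2"
proof -
  have "measure_pmf.prob (request_pmf n) X = measure_pmf.expectation (request_pmf n) (indicator X)" by simp
  also have "\<dots> = (indicator X None + (\<Sum>a<n. indicator X (Some a)) / real n) / 2"
    by (rule expectation_request_pmf[OF assms, of _ 1]) (auto split: split_indicator)
  also have "(\<Sum>a<n. indicator X (Some a)) = (\<Sum>a\<in>{a. a < n \<and> Some a \<in> X}. 1::real)"
    by (intro sum.mono_neutral_cong_right) (auto split: split_indicator)
  finally show ?thesis by (simp add: indicator_def)
qed

lemma prob_request_pmf_hit:
  assumes "0 < n" "i \<subseteq> {..<n}"
  shows "measure_pmf.prob (request_pmf n) {v. \<exists>a\<in>i. v = Some a} = real (card i) / (2 * real n)"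
proof -
  have "{a. a < n \<and> a \<in> i} = i" using assms by auto
  then show ?thesis using prob_request_pmf[OF assms(1), of "{v. \<exists>a\<in>i. v = Some a}"] by simp
qed

lemma request_pmf_hit:
  assumes "0 < n" "i \<subseteq> {..<n}"
  shows "map_pmf (\<lambda>v. \<exists>a\<in>i. v = Some a) (request_pmf n) = bernoulli_pmf (real (card i) / (2 * real n))"
proof (rule pmf_eqI)
  fix b
  have c: "card i \<le> n" using card_mono[OF _ assms(2)] by simp
  then have r: "0 \<le> real (card i) / (2 * real n)" "real (card i) / (2 * real n) \<le> 1"
    using assms(1) by (auto simp: field_simps)
  have T: "measure_pmf.prob (request_pmf n) {v. \<exists>a\<in>i. v = Some a} = real (card i) / (2 * real n)"
    by (rule prob_request_pmf_hit[OF assms])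
  have F: "measure_pmf.prob (request_pmf n) {v. \<not> (\<exists>a\<in>i. v = Some a)} = 1 - real (card i) / (2 * real n)"
    unfolding T[symmetric] by (subst measure_pmf.prob_compl[symmetric]) (auto intro!: arg_cong[where f="measure _"])
  show "pmf (map_pmf (\<lambda>v. \<exists>a\<in>i. v = Some a) (request_pmf n)) b = pmf (bernoulli_pmf (real (card i) / (2 * real n))) b"
    using T F r by (cases b) (simp_all add: pmf_map vimage_def)
qed

text \<open>With probability 1/2 the cluster \<open>i\<close> accepts; independently, every other
  cluster hits \<open>i\<close> with probability \<open>card i / (2 n)\<close>. The incoming set is
  thus a Bernoulli subset of \<open>C - {i}\<close>, to which \<open>random_subset_average\<close>
  applies.\<close>

lemma incoming_expectation:
  assumes n: "0 < n" and C: "C \<in> configs n" and i: "i \<in> C" and k: "2 \<le> card C"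
    and u: "\<And>j. 0 \<le> u j" "\<And>j. u j \<le> (1::real)"
  shows "measure_pmf.expectation (actions_pmf n C) (\<lambda>act. if act i = None
      then (\<Sum>j\<in>incoming C act i. u j) / real (card (incoming C act i)) else 0)
    = (1 - (1 - real (card i) / (2 * real n)) ^ (card C - 1)) * (\<Sum>j\<in>C - {i}. u j) / (2 * real (card C - 1))"
proof -
  let ?J = "C - {i}"
  let ?F = "\<lambda>act. if act i = None then (\<Sum>j\<in>incoming C act i. u j) / real (card (incoming C act i)) else 0"
  let ?hit = "\<lambda>v. \<exists>a\<in>i. v = Some a"
  let ?G = "\<lambda>b. (\<Sum>j\<in>{j\<in>?J. b j}. u j) / real (card {j\<in>?J. b j})"
  let ?w = "real (card i) / (2 * real n)"
  have fin: "finite C" by (rule config_finite[OF C])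
  have J: "finite ?J" "i \<notin> ?J" "insert i ?J = C" "?J \<noteq> {}" "card ?J = card C - 1"
    using fin i k card_mono[of "{i}" C] by (auto simp: card_Diff_singleton)
  have i_sub: "i \<subseteq> {..<n}" by (rule configs_subset[OF C i])
  have w: "0 \<le> ?w" "?w \<le> 1" using card_mono[OF _ i_sub] n by (auto simp: field_simps)
  have bd: "\<bar>(\<Sum>j\<in>S. u j) / real (card S)\<bar> \<le> 1" for S
  proof -
    have "(\<Sum>j\<in>S. u j) \<le> real (card S)" using sum_mono[of S u "\<lambda>_. 1"] u by simp
    moreover have "0 \<le> (\<Sum>j\<in>S. u j)" by (rule sum_nonneg) (rule u)
    ultimately show ?thesis by (auto simp: divide_simps)
  qed
  have "measure_pmf.expectation (actions_pmf n C) ?F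
      = measure_pmf.expectation (Pi_pmf ?J None (\<lambda>_. request_pmf n))
         (\<lambda>f. measure_pmf.expectation (request_pmf n) (\<lambda>y. ?F (f(i := y))))"
    unfolding actions_pmf_eq
    by (subst J(3)[symmetric], rule integral_Pi_pmf_insert[OF J(1,2), of _ 1]) (use bd in auto)
  also have "(\<lambda>f. measure_pmf.expectation (request_pmf n) (\<lambda>y. ?F (f(i := y)))) = (\<lambda>f. ?G (?hit \<circ> f) / 2)"
  proof
    fix f
    have inc: "incoming C (f(i := None)) i = {j\<in>?J. (?hit \<circ> f) j}"
      using i by (auto simp: incoming_def)
    have "measure_pmf.expectation (request_pmf n) (\<lambda>y. ?F (f(i := y))) = (?F (f(i := None)) + (\<Sum>a<n. ?F (f(i := Some a))) / real n) / 2"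
      by (rule expectation_request_pmf[OF n, of _ 1]) (use bd in auto)
    then show "measure_pmf.expectation (request_pmf n) (\<lambda>y. ?F (f(i := y))) = ?G (?hit \<circ> f) / 2"
      by (simp add: inc)
  qed
  also have "measure_pmf.expectation (Pi_pmf ?J None (\<lambda>_. request_pmf n)) (\<lambda>f. ?G (?hit \<circ> f) / 2)
      = measure_pmf.expectation (map_pmf (\<lambda>h. ?hit \<circ> h) (Pi_pmf ?J None (\<lambda>_. request_pmf n))) ?G / 2"
    by (simp only: integral_map_pmf integral_divide_zero)
  also have "map_pmf (\<lambda>h. ?hit \<circ> h) (Pi_pmf ?J None (\<lambda>_. request_pmf n)) = Pi_pmf ?J False (\<lambda>_. bernoulli_pmf ?w)"
    using Pi_pmf_map[OF J(1), of ?hit None False "\<lambda>_. request_pmf n"] request_pmf_hit[OF n i_sub] by simp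
  also have "measure_pmf.expectation \<dots> ?G = (1 - (1 - ?w) ^ card ?J) * (\<Sum>j\<in>?J. u j) / real (card ?J)"
    by (rule random_subset_average[OF J(1,4) w])
  finally show ?thesis unfolding J(5) by simp
qed

section \<open>Fluctuations of a uniform round\<close>

lemma configs_card_containing:
  assumes C: "C \<in> configs n"
  shows "card {i \<in> C. \<exists>a\<in>i. v = Some a} \<le> 1"
proof -
  have "i = j" if "i \<in> {i \<in> C. \<exists>a\<in>i. v = Some a}" "j \<in> {i \<in> C. \<exists>a\<in>i. v = Some a}" for i j
    using that configs_disjoint[OF C, of i j] by auto
  then show ?thesis
    using card_le_Suc0_iff_eq[of "{i \<in> C. \<exists>a\<in>i. v = Some a}"] config_finite[OF C] by simp
qed

text \<open>Conditional mean of the weight of the selected partner given the actions;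
  \<open>0 / 0 = 0\<close> covers an accepting cluster without requests.\<close>

definition mean_incoming :: "(cluster \<Rightarrow> real) \<Rightarrow> cluster set \<Rightarrow> actions \<Rightarrow> cluster \<Rightarrow> real" where
  "mean_incoming u C act i = (if act i = None
     then (\<Sum>j\<in>incoming C act i. u j) / real (card (incoming C act i)) else 0)"

lemma mean_incoming_bounds:
  assumes "\<And>j. 0 \<le> u j" "\<And>j. u j \<le> 1"
  shows "0 \<le> mean_incoming u C act i" "mean_incoming u C act i \<le> 1"
proof -
  have "(\<Sum>j\<in>S. u j) \<le> real (card S)" for S using sum_mono[of S u "\<lambda>_. 1"] assms by simp
  moreover have "0 \<le> (\<Sum>j\<in>S. u j)" for S by (rule sum_nonneg) (rule assms)
  ultimately show "0 \<le> mean_incoming u C act i" "mean_incoming u C act i \<le> 1"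
    by (auto simp: mean_incoming_def divide_simps)
qed

text \<open>For \<open>u i = 1 - q ^ card i\<close> this is the loss of
  \<open>size_transform q\<close> in the round. Written as a sum over the fixed set
  \<open>C\<close>, it visibly has bounded differences.\<close>

definition selection_weight :: "(cluster \<Rightarrow> real) \<Rightarrow> cluster set \<Rightarrow> selection \<Rightarrow> real" where
  "selection_weight u C s = (\<Sum>i\<in>C. u i * (case s i of None \<Rightarrow> 0 | Some j \<Rightarrow> u j))"

lemma selection_weight_eq:
  assumes "finite C"
  shows "selection_weight u C s = (\<Sum>i\<in>merging C s. u i * u (the (s i)))"
  unfolding selection_weight_def merging_def using assms
  by (intro sum.mono_neutral_cong_right) auto

definition mean_selection_weight :: "nat \<Rightarrow> (cluster \<Rightarrow> real) \<Rightarrow> cluster set \<Rightarrow> real" where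
  "mean_selection_weight n u C = (\<Sum>i\<in>C. u i *
     ((1 - (1 - real (card i) / (2 * real n)) ^ (card C - 1)) * (\<Sum>j\<in>C - {i}. u j) / (2 * real (card C - 1))))"

context
  fixes u :: "cluster \<Rightarrow> real" and C n
  assumes u: "\<And>j. 0 \<le> u j" "\<And>j. u j \<le> 1"
    and C: "C \<in> configs n" and n: "0 < n"
begin

private lemma sum_bound:
  assumes "\<And>i. 0 \<le> v i" "\<And>i. v i \<le> (1::real)"
  shows "\<bar>\<Sum>i\<in>C. u i * v i\<bar> \<le> real (card C)"
proof -
  have "\<bar>u i * v i\<bar> \<le> 1" for i
    using u[of i] assms[of i] by (simp add: mult_le_one)
  then have "(\<Sum>i\<in>C. \<bar>u i * v i\<bar>) \<le> (\<Sum>i\<in>C. 1)" by (intro sum_mono)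
  then show ?thesis by (intro order.trans[OF sum_abs]) simp
qed

lemma mean_incoming_sum_bound: "\<bar>\<Sum>i\<in>C. u i * mean_incoming u C act i\<bar> \<le> real (card C)"
  using mean_incoming_bounds[of u] u by (intro sum_bound) auto

lemma selection_weight_bound: "\<bar>selection_weight u C s\<bar> \<le> real (card C)"
  unfolding selection_weight_def using u by (intro sum_bound) (auto split: option.split)

lemma expectation_mean_incoming:
  assumes k: "2 \<le> card C"
  shows "measure_pmf.expectation (actions_pmf n C) (\<lambda>act. \<Sum>i\<in>C. u i * mean_incoming u C act i)
    = mean_selection_weight n u C"
proof -
  have int: "integrable (measure_pmf (actions_pmf n C)) (\<lambda>act. mean_incoming u C act i)" for i
    by (rule integrable_pmf_bounded[of _ 1]) (use mean_incoming_bounds[of u] u in auto)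
  have "measure_pmf.expectation (actions_pmf n C) (\<lambda>act. \<Sum>i\<in>C. u i * mean_incoming u C act i)
      = (\<Sum>i\<in>C. u i * measure_pmf.expectation (actions_pmf n C) (\<lambda>act. mean_incoming u C act i))"
    using int by (subst Bochner_Integration.integral_sum) auto
  also have "\<dots> = mean_selection_weight n u C"
    unfolding mean_selection_weight_def mean_incoming_def
    by (intro sum.cong refl) (simp only: incoming_expectation[OF n C _ k u])
  finally show ?thesis .
qed

text \<open>Changing the action of \<open>j\<close> affects only the averages at \<open>j\<close>,
  at the old addressee and at the new addressee. Each changes by at most 1, which gives the
  difference bound 3 and the factor 9.\<close>

lemma variance_mean_incoming:
  assumes k: "2 \<le> card C"
  shows "measure_pmf.expectation (actions_pmf n C)
    (\<lambda>act. ((\<Sum>i\<in>C. u i * mean_incoming u C act i) - mean_selection_weight n u C)\<^sup>2) \<le> 9 * real (card C)"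
proof -
  let ?Y = "\<lambda>act. \<Sum>i\<in>C. u i * mean_incoming u C act i"
  have fin: "finite C" by (rule config_finite[OF C])
  have diff: "\<bar>?Y (act(j := v)) - ?Y act\<bar> \<le> 3" if j: "j \<in> C" for act j v
  proof -
    let ?D = "{j} \<union> ({i \<in> C. \<exists>a\<in>i. act j = Some a} \<union> {i \<in> C. \<exists>a\<in>i. v = Some a})"
    have D: "?D \<subseteq> C" "card ?D \<le> 3"
      using j configs_card_containing[OF C, of "act j"] configs_card_containing[OF C, of v]
        card_Un_le[of "{j}" "{i \<in> C. \<exists>a\<in>i. act j = Some a} \<union> {i \<in> C. \<exists>a\<in>i. v = Some a}"]
        card_Un_le[of "{i \<in> C. \<exists>a\<in>i. act j = Some a}" "{i \<in> C. \<exists>a\<in>i. v = Some a}"] by auto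
    have same: "mean_incoming u C (act(j := v)) i = mean_incoming u C act i" if "i \<in> C - ?D" for i
    proof -
      have "incoming C (act(j := v)) i = incoming C act i" using that by (auto simp: incoming_def)
      then show ?thesis using that by (auto simp: mean_incoming_def)
    qed
    have "\<bar>?Y (act(j := v)) - ?Y act\<bar> = \<bar>\<Sum>i\<in>C. u i * (mean_incoming u C (act(j := v)) i - mean_incoming u C act i)\<bar>"
      by (simp add: sum_subtractf algebra_simps)
    also have "(\<Sum>i\<in>C. u i * (mean_incoming u C (act(j := v)) i - mean_incoming u C act i))
        = (\<Sum>i\<in>?D. u i * (mean_incoming u C (act(j := v)) i - mean_incoming u C act i))"
      using D(1) fin same by (intro sum.mono_neutral_right) auto
    also have "\<bar>\<dots>\<bar> \<le> (\<Sum>i\<in>?D. \<bar>u i * (mean_incoming u C (act(j := v)) i - mean_incoming u C act i)\<bar>)"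
      by (rule sum_abs)
    also have "\<dots> \<le> (\<Sum>i\<in>?D. 1)"
    proof (rule sum_mono)
      fix i
      have "\<bar>mean_incoming u C (act(j := v)) i - mean_incoming u C act i\<bar> \<le> 1"
        using mean_incoming_bounds[of u C act i] mean_incoming_bounds[of u C "act(j := v)" i] u by auto
      then show "\<bar>u i * (mean_incoming u C (act(j := v)) i - mean_incoming u C act i)\<bar> \<le> 1"
        using u[of i] by (simp add: abs_mult mult_le_one)
    qed
    also have "\<dots> \<le> 3" using D(2) by simp
    finally show ?thesis .
  qed
  have "measure_pmf.expectation (actions_pmf n C) (\<lambda>act. (?Y act - measure_pmf.expectation (actions_pmf n C) ?Y)\<^sup>2)
      \<le> real (card C) * 3\<^sup>2"
    unfolding actions_pmf_eq
    by (rule Pi_pmf_variance_bounded_differences[OF fin mean_incoming_sum_bound diff])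
  then show ?thesis unfolding expectation_mean_incoming[OF k] by simp
qed

lemma expectation_uniform_rule:
  "measure_pmf.expectation (uniform_rule hist C act) (selection_weight u C)
    = (\<Sum>i\<in>C. u i * mean_incoming u C act i)"
proof -
  let ?A = "{i \<in> C. act i = None \<and> incoming C act i \<noteq> {}}"
  let ?P = "uniform_rule hist C act"
  let ?g = "\<lambda>v. case v of None \<Rightarrow> 0 | Some j \<Rightarrow> u j"
  have fin: "finite ?A" using config_finite[OF C] by simp
  have int: "integrable (measure_pmf ?P) (\<lambda>s. ?g (s i))" for i
    by (rule integrable_pmf_bounded[of _ 1]) (use u in \<open>auto split: option.split\<close>)
  have "measure_pmf.expectation ?P (\<lambda>s. ?g (s i)) = mean_incoming u C act i" if i: "i \<in> C" for i
  proof -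
    have "measure_pmf.expectation ?P (\<lambda>s. ?g (s i)) = measure_pmf.expectation (map_pmf (\<lambda>s. s i) ?P) ?g"
      by simp
    also have "map_pmf (\<lambda>s. s i) ?P = (if i \<in> ?A then map_pmf Some (pmf_of_set (incoming C act i)) else return_pmf None)"
      unfolding uniform_rule_def by (rule Pi_pmf_component[OF fin])
    also have "measure_pmf.expectation \<dots> ?g = mean_incoming u C act i"
      using i config_finite[OF C] by (auto simp: mean_incoming_def integral_pmf_of_set incoming_def)
    finally show ?thesis .
  qed
  then show ?thesis
    unfolding selection_weight_def using int by (subst Bochner_Integration.integral_sum) auto
qed

text \<open>Given the actions, the selections are independent, and each influences only its own
  summand, by at most 1.\<close>

lemma variance_uniform_rule:
  "measure_pmf.expectation (uniform_rule hist C act)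
    (\<lambda>s. (selection_weight u C s - (\<Sum>i\<in>C. u i * mean_incoming u C act i))\<^sup>2) \<le> real (card C)"
proof -
  let ?A = "{i \<in> C. act i = None \<and> incoming C act i \<noteq> {}}"
  let ?g = "\<lambda>v. case v of None \<Rightarrow> 0 | Some j \<Rightarrow> u j"
  have finC: "finite C" by (rule config_finite[OF C])
  then have fin: "finite ?A" by simp
  have diff: "\<bar>selection_weight u C (s(j := v)) - selection_weight u C s\<bar> \<le> 1" if j: "j \<in> ?A" for s j v
  proof -
    have "selection_weight u C (s(j := v)) - selection_weight u C s = (\<Sum>i\<in>C. u i * (?g ((s(j := v)) i) - ?g (s i)))"
      unfolding selection_weight_def by (simp add: sum_subtractf algebra_simps)
    also have "\<dots> = (\<Sum>i\<in>{j}. u i * (?g ((s(j := v)) i) - ?g (s i)))"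
      using finC j by (intro sum.mono_neutral_right) auto
    finally have "\<bar>selection_weight u C (s(j := v)) - selection_weight u C s\<bar> = u j * \<bar>?g v - ?g (s j)\<bar>"
      using u[of j] by (simp add: abs_mult)
    also have "\<bar>?g v - ?g (s j)\<bar> \<le> 1"
    proof -
      have "0 \<le> ?g w \<and> ?g w \<le> 1" for w using u by (auto split: option.split)
      from this[of v] this[of "s j"] show ?thesis by linarith
    qed
    then have "u j * \<bar>?g v - ?g (s j)\<bar> \<le> 1" using u[of j] by (intro mult_le_one) auto
    finally show ?thesis .
  qed
  have "measure_pmf.expectation (uniform_rule hist C act)
    (\<lambda>s. (selection_weight u C s - measure_pmf.expectation (uniform_rule hist C act) (selection_weight u C))\<^sup>2)
    \<le> real (card ?A) * 1\<^sup>2"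
    unfolding uniform_rule_def
    by (rule Pi_pmf_variance_bounded_differences[OF fin selection_weight_bound diff])
  also have "\<dots> \<le> real (card C)" using card_mono[OF finC, of ?A] by simp
  finally show ?thesis unfolding expectation_uniform_rule .
qed

text \<open>Variance in two layers: at most \<open>9 k\<close> from the actions and at most
  \<open>k\<close> from the selections given the actions. The tail bound is then Chebyshev's
  inequality.\<close>

lemma selection_weight_deviation:
  assumes k: "2 \<le> card C" and \<delta>: "0 < \<delta>"
  shows "measure_pmf.prob (bind_pmf (actions_pmf n C) (uniform_rule hist C))
    {s. \<delta> \<le> \<bar>selection_weight u C s - mean_selection_weight n u C\<bar>} \<le> 10 * real (card C) / \<delta>\<^sup>2"
proof -
  let ?X = "selection_weight u C" and ?nu = "mean_selection_weight n u C"
  let ?Y = "\<lambda>act. \<Sum>i\<in>C. u i * mean_incoming u C act i"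
  let ?k = "real (card C)"
  let ?P = "bind_pmf (actions_pmf n C) (uniform_rule hist C)"
  have nuK: "\<bar>?nu\<bar> \<le> ?k"
  proof -
    have "integrable (measure_pmf (actions_pmf n C)) ?Y"
      by (rule integrable_pmf_bounded[OF mean_incoming_sum_bound])
    then have "\<bar>?nu\<bar> \<le> measure_pmf.expectation (actions_pmf n C) (\<lambda>act. \<bar>?Y act\<bar>)"
      unfolding expectation_mean_incoming[OF k, symmetric] by simp
    also have "\<dots> \<le> measure_pmf.expectation (actions_pmf n C) (\<lambda>_. ?k)"
      using \<open>integrable _ ?Y\<close> mean_incoming_sum_bound by (intro integral_mono) auto
    finally show ?thesis by simp
  qed
  have sq: "\<bar>(s - r)\<^sup>2\<bar> \<le> (2*?k)\<^sup>2" if "\<bar>s\<bar> \<le> ?k" "\<bar>r\<bar> \<le> ?k" for s r :: real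
  proof -
    have "\<bar>s - r\<bar> \<le> 2 * ?k" using that by linarith
    then show ?thesis by (metis abs_ge_zero abs_power2 power2_abs power_mono)
  qed
  have inner: "measure_pmf.expectation (uniform_rule hist C act) (\<lambda>s. (?X s - ?nu)\<^sup>2) \<le> ?k + (?Y act - ?nu)\<^sup>2"
    (is "measure_pmf.expectation ?Q _ \<le> _") for act
  proof -
    have i1: "integrable (measure_pmf ?Q) ?X" by (rule integrable_pmf_bounded[OF selection_weight_bound])
    have i2: "integrable (measure_pmf ?Q) (\<lambda>s. (?X s - ?Y act)\<^sup>2)"
      by (rule integrable_pmf_bounded[OF sq[OF selection_weight_bound mean_incoming_sum_bound]])
    have "measure_pmf.expectation ?Q (\<lambda>s. (?X s - ?nu)\<^sup>2)
      = measure_pmf.expectation ?Q (\<lambda>s. (?X s - ?Y act)\<^sup>2 + 2 * (?Y act - ?nu) * (?X s - ?Y act) + (?Y act - ?nu)\<^sup>2)"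
      by (rule Bochner_Integration.integral_cong) (auto simp: power2_eq_square algebra_simps)
    also have "\<dots> = measure_pmf.expectation ?Q (\<lambda>s. (?X s - ?Y act)\<^sup>2)
       + 2 * (?Y act - ?nu) * measure_pmf.expectation ?Q (\<lambda>s. ?X s - ?Y act) + (?Y act - ?nu)\<^sup>2"
      using i2 i1 by simp
    also have "measure_pmf.expectation ?Q (\<lambda>s. ?X s - ?Y act) = 0"
      using i1 by (simp add: expectation_uniform_rule)
    also have "measure_pmf.expectation ?Q (\<lambda>s. (?X s - ?Y act)\<^sup>2) \<le> ?k" by (rule variance_uniform_rule)
    finally show ?thesis by (simp only: mult_zero_right add_0_right)
  qed
  have "measure_pmf.expectation ?P (\<lambda>s. (?X s - ?nu)\<^sup>2)
    = measure_pmf.expectation (actions_pmf n C) (\<lambda>act. measure_pmf.expectation (uniform_rule hist C act) (\<lambda>s. (?X s - ?nu)\<^sup>2))"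
    by (rule expectation_bind_pmf_bounded[OF sq[OF selection_weight_bound nuK]])
  also have "\<dots> \<le> measure_pmf.expectation (actions_pmf n C) (\<lambda>act. ?k + (?Y act - ?nu)\<^sup>2)"
  proof (rule integral_mono[OF _ _ inner])
    have Ynu: "\<bar>(?Y act - ?nu)\<^sup>2\<bar> \<le> (2*?k)\<^sup>2" for act by (rule sq[OF mean_incoming_sum_bound nuK])
    then show i: "integrable (measure_pmf (actions_pmf n C)) (\<lambda>act. ?k + (?Y act - ?nu)\<^sup>2)"
      by (intro Bochner_Integration.integrable_add integrable_pmf_bounded[OF Ynu]) simp
    have "0 \<le> measure_pmf.expectation (uniform_rule hist C act) (\<lambda>s. (?X s - ?nu)\<^sup>2)" for act
      by (rule integral_nonneg_AE) simp
    moreover have "measure_pmf.expectation (uniform_rule hist C act) (\<lambda>s. (?X s - ?nu)\<^sup>2) \<le> ?k + (2 * ?k)\<^sup>2" for act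
      using inner[of act] Ynu[of act] by linarith
    ultimately show "integrable (measure_pmf (actions_pmf n C))
        (\<lambda>act. measure_pmf.expectation (uniform_rule hist C act) (\<lambda>s. (?X s - ?nu)\<^sup>2))"
      by (intro integrable_pmf_bounded[of _ "?k + (2 * ?k)\<^sup>2"]) auto
  qed
  also have "\<dots> = ?k + measure_pmf.expectation (actions_pmf n C) (\<lambda>act. (?Y act - ?nu)\<^sup>2)"
    by (subst Bochner_Integration.integral_add)
      (auto intro: integrable_pmf_bounded[OF sq[OF mean_incoming_sum_bound nuK]])
  also have "\<dots> \<le> 10 * ?k" using variance_mean_incoming[OF k] by simp
  finally have E: "measure_pmf.expectation ?P (\<lambda>s. (?X s - ?nu)\<^sup>2) \<le> 10 * ?k" .
  have eq: "{s. \<delta> \<le> \<bar>?X s - ?nu\<bar>} = {s \<in> space (measure_pmf ?P). \<delta>\<^sup>2 \<le> (?X s - ?nu)\<^sup>2}"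
    using \<delta> by (auto simp: abs_le_square_iff[symmetric])
  have "measure_pmf.prob ?P {s. \<delta> \<le> \<bar>?X s - ?nu\<bar>} \<le> measure_pmf.expectation ?P (\<lambda>s. (?X s - ?nu)\<^sup>2) / \<delta>\<^sup>2"
    unfolding eq using \<delta>
    by (intro integral_Markov_inequality_measure[where A="{}"])
      (auto intro: integrable_pmf_bounded[OF sq[OF selection_weight_bound nuK]])
  also have "\<dots> \<le> 10 * ?k / \<delta>\<^sup>2" using E by (simp add: divide_right_mono)
  finally show ?thesis .
qed

end

lemma uniform_round_deviation:
  assumes C: "C \<in> configs n" and n: "0 < n" and k: "2 \<le> card C" and \<delta>: "0 < \<delta>" and q: "0 \<le> q" "q \<le> 1"
  shows "measure_pmf.prob (round_pmf n (uniform_rule hist) C)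
    {D. \<delta> \<le> \<bar>size_transform q D - (size_transform q C - mean_selection_weight n (\<lambda>i. 1 - q ^ card i) C)\<bar>}
      \<le> 10 * real (card C) / \<delta>\<^sup>2"
proof -
  let ?u = "\<lambda>i. 1 - q ^ card i"
  let ?P = "bind_pmf (actions_pmf n C) (uniform_rule hist C)"
  have u: "0 \<le> ?u i" "?u i \<le> 1" for i :: cluster using q by (auto simp: power_le_one)
  have round: "round_pmf n (uniform_rule hist) C = map_pmf (merge_clusters C) ?P"
    by (simp add: round_pmf_def map_bind_pmf)
  have eq: "size_transform q (merge_clusters C s) = size_transform q C - selection_weight ?u C s"
    if "s \<in> set_pmf ?P" for s
  proof -
    obtain act where "s \<in> set_pmf (uniform_rule hist C act)" using \<open>s \<in> set_pmf ?P\<close> by auto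
    then obtain cand where "\<forall>i. cand i \<subseteq> incoming C act i" "selects_from cand C act s"
      using proper_uniform_rule[of n] C unfolding proper_rule_def by blast
    then have "valid_selection C s" by (intro valid_selectionI[OF C]) auto
    then show ?thesis
      using size_transform_merge_clusters[OF C] selection_weight_eq[OF config_finite[OF C]] by simp
  qed
  have "measure_pmf.prob (round_pmf n (uniform_rule hist) C)
    {D. \<delta> \<le> \<bar>size_transform q D - (size_transform q C - mean_selection_weight n ?u C)\<bar>}
    = measure_pmf.prob ?P {s. \<delta> \<le> \<bar>size_transform q (merge_clusters C s) - (size_transform q C - mean_selection_weight n ?u C)\<bar>}"
    unfolding round by (simp add: vimage_def)
  also have "\<dots> \<le> measure_pmf.prob ?P {s. \<delta> \<le> \<bar>selection_weight ?u C s - mean_selection_weight n ?u C\<bar>}"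
    by (rule measure_pmf.finite_measure_mono_AE) (auto simp: AE_measure_pmf_iff eq abs_minus_commute)
  also have "\<dots> \<le> 10 * real (card C) / \<delta>\<^sup>2"
    by (rule selection_weight_deviation[OF u C n k \<delta>])
  finally show ?thesis .
qed

section \<open>The Laplace transform of the cluster sizes\<close>

text \<open>With \<open>y\<close> half of a relative weight, the error is proportional to
  \<open>y\<close>, not merely small; as the weights sum to 1, the errors of all clusters add up to
  a constant.\<close>

lemma exp_minus_power_bound:
  fixes y :: real
  assumes y: "0 \<le> y" "y \<le> 1/2" and k: "1 \<le> k"
  shows "\<bar>exp (- (real k * y)) - (1 - y) ^ (k - 1)\<bar> \<le> 2 * y"
proof -
  let ?e = "exp (- (real k * y))"
  have e1: "?e \<le> 1" using y by simp
  have "(1 - y) ^ (k - 1) \<le> exp (- y) ^ (k - 1)"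
    using y exp_ge_add_one_self[of "- y"] by (intro power_mono) auto
  also have "\<dots> = ?e * exp y"
    using k by (simp add: exp_of_nat_mult[symmetric] exp_add[symmetric] of_nat_diff algebra_simps)
  also have "\<dots> \<le> ?e + 2 * y"
  proof -
    have "exp y \<le> 1 + 2 * y"
      using y exp_bound_lemma[of y] by simp
    then have "?e * exp y \<le> ?e * (1 + 2 * y)" by (intro mult_left_mono) auto
    moreover have "?e * (2 * y) \<le> 1 * (2 * y)" using e1 y by (intro mult_right_mono) auto
    ultimately show ?thesis by (simp add: algebra_simps)
  qed
  finally have up: "(1 - y) ^ (k - 1) \<le> ?e + 2 * y" .
  \<comment> \<open>For the lower bound, multiply \<open>exp (- y) (1 + y) \<le> 1\<close> by
    \<open>1 - y\<close> and take the \<open>k\<close>-th power; Bernoulli's inequality handles the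
    correction.\<close>
  have "exp (- y) * (1 - y\<^sup>2) \<le> 1 - y"
  proof -
    have "exp (- y) * (1 + y) \<le> 1"
      using exp_ge_add_one_self[of y] by (simp add: exp_minus field_simps)
    then have "exp (- y) * (1 + y) * (1 - y) \<le> 1 * (1 - y)" using y by (intro mult_right_mono) auto
    then show ?thesis by (simp add: power2_eq_square algebra_simps)
  qed
  then have "(exp (- y) * (1 - y\<^sup>2)) ^ k \<le> (1 - y) ^ k"
    using y by (intro power_mono) (auto simp: power_le_one)
  also have "\<dots> \<le> (1 - y) ^ (k - 1)" using y by (intro power_decreasing) auto
  finally have "?e * (1 - y\<^sup>2) ^ k \<le> (1 - y) ^ (k - 1)"
    by (simp add: power_mult_distrib exp_of_nat_mult[symmetric])
  moreover have "1 - real k * y\<^sup>2 \<le> (1 - y\<^sup>2) ^ k"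
    using Bernoulli_inequality[of "- (y\<^sup>2)" k] y by (simp add: power_le_one)
  then have "?e * (1 - real k * y\<^sup>2) \<le> ?e * (1 - y\<^sup>2) ^ k" by (intro mult_left_mono) auto
  moreover have "?e * (real k * y\<^sup>2) \<le> y"
  proof -
    have "real k * y * ?e \<le> 1"
      using exp_ge_add_one_self[of "real k * y"] by (simp add: exp_minus divide_simps, linarith)
    then have "y * (real k * y * ?e) \<le> y * 1" using y by (intro mult_left_mono) auto
    then show ?thesis by (simp add: power2_eq_square algebra_simps)
  qed
  ultimately have "?e - y \<le> (1 - y) ^ (k - 1)" by (simp add: algebra_simps)
  then show ?thesis using up y by linarith
qed

text \<open>One minus the Laplace transform of the relative size of a uniformly chosen cluster. The
  factor \<open>card C / n\<close> gives these sizes mean 1, so the transform stays below the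
  identity and can be compared between rounds.\<close>

definition laplace :: "nat \<Rightarrow> cluster set \<Rightarrow> real \<Rightarrow> real" where
  "laplace n C s = (\<Sum>i\<in>C. 1 - exp (- (s * real (card C) * real (card i) / real n))) / real (card C)"

lemma configs_sum_weight:
  assumes "C \<in> configs n" "0 < n"
  shows "(\<Sum>i\<in>C. real (card i) / real n) = 1"
  using configs_sum_card[OF assms(1)] assms(2)
  by (simp add: sum_divide_distrib[symmetric] of_nat_sum[symmetric] del: of_nat_sum)

text \<open>Two errors per cluster: \<open>1 / k\<close> for leaving \<open>i\<close> out of its own
  partners, and half its weight for the exponential in place of the power. They sum to 3/2.\<close>

lemma mean_selection_weight_approx:
  assumes C: "C \<in> configs n" and n: "0 < n" and k: "2 \<le> card C"
    and u: "\<And>j. 0 \<le> u j" "\<And>j. u j \<le> 1"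
  shows "\<bar>mean_selection_weight n u C
    - (\<Sum>i\<in>C. (1 - exp (- (real (card C) * real (card i) / (2 * real n)))) * u i) * (\<Sum>i\<in>C. u i) / (2 * real (card C))\<bar> \<le> 2"
proof -
  let ?k = "real (card C)" and ?U = "\<Sum>i\<in>C. u i"
  let ?y = "\<lambda>i. real (card i) / (2 * real n)"
  let ?pi = "\<lambda>i. 1 - (1 - ?y i) ^ (card C - 1)"
  let ?p = "\<lambda>i. 1 - exp (- (?k * real (card i) / (2 * real n)))"
  have fin: "finite C" by (rule config_finite[OF C])
  have k': "?k \<ge> 2" using k by simp
  have U: "0 \<le> ?U" "?U \<le> ?k" using sum_nonneg[of C u] sum_mono[of C u "\<lambda>_. 1"] u by auto
  have summand: "\<bar>u i * (?pi i * (\<Sum>j\<in>C - {i}. u j) / (2 * real (card C - 1))) - ?p i * u i * ?U / (2 * ?k)\<bar>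
      \<le> 1 / ?k + real (card i) / real n / 2" if i: "i \<in> C" for i
  proof -
    have c: "card i \<le> n" using card_mono[OF _ configs_subset[OF C i]] by simp
    have y: "0 \<le> ?y i" "?y i \<le> 1/2" using c n by (auto simp: field_simps)
    have pi: "0 \<le> ?pi i" "?pi i \<le> 1" using y by (auto simp: power_le_one)
    have diff: "\<bar>?pi i - ?p i\<bar> \<le> 2 * ?y i"
      using exp_minus_power_bound[OF y, of "card C"] k by (simp add: abs_minus_commute)
    have S: "(\<Sum>j\<in>C - {i}. u j) = ?U - u i" using fin i by (simp add: sum_diff1)
    have k1: "real (card C - 1) = ?k - 1" using k by simp
    have "u i * (?pi i * (\<Sum>j\<in>C - {i}. u j) / (2 * real (card C - 1))) - ?p i * u i * ?U / (2 * ?k)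
      = u i * ?pi i * ((?U - ?k * u i) / (2 * ?k * (?k - 1))) + u i * (?pi i - ?p i) * (?U / (2 * ?k))"
      unfolding S k1 using k' by (simp add: field_simps)
    also have "\<bar>\<dots>\<bar> \<le> 1 * (1 / ?k) + (2 * ?y i) * (1/2)"
    proof (intro order.trans[OF abs_triangle_ineq] add_mono)
      have 1: "\<bar>u i * ?pi i\<bar> \<le> 1" using pi u[of i] by (simp add: mult_le_one)
      have "?k * u i \<le> ?k * 1" "0 \<le> ?k * u i" using u[of i] by (intro mult_left_mono, auto)
      then have Uk: "\<bar>?U - ?k * u i\<bar> \<le> ?k" using U by linarith
      have "0 < 2 * ?k * (?k - 1)" using k' by simp
      then have "\<bar>(?U - ?k * u i) / (2 * ?k * (?k - 1))\<bar> \<le> ?k / (2 * ?k * (?k - 1))"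
        unfolding abs_divide using divide_right_mono[OF Uk, of "2 * ?k * (?k - 1)"] by (simp only: abs_of_pos less_imp_le)
      also have "\<dots> \<le> 1 / ?k" using k' by (simp add: field_simps)
      finally show "\<bar>u i * ?pi i * ((?U - ?k * u i) / (2 * ?k * (?k - 1)))\<bar> \<le> 1 * (1 / ?k)"
        unfolding abs_mult[of "u i * ?pi i"] using 1 by (intro mult_mono) auto
      have 2: "\<bar>u i * (?pi i - ?p i)\<bar> \<le> 1 * (2 * ?y i)"
        unfolding abs_mult using u[of i] diff by (intro mult_mono) auto
      have 3: "\<bar>?U / (2 * ?k)\<bar> \<le> 1/2" using U k' by (simp add: field_simps)
      show "\<bar>u i * (?pi i - ?p i) * (?U / (2 * ?k))\<bar> \<le> (2 * ?y i) * (1/2)"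
        unfolding abs_mult[of "u i * (?pi i - ?p i)"] using 2 3 y by (intro mult_mono) auto
    qed
    also have "\<dots> = 1 / ?k + real (card i) / real n / 2" using n by (simp add: field_simps)
    finally show ?thesis .
  qed
  have "\<bar>mean_selection_weight n u C - (\<Sum>i\<in>C. ?p i * u i) * ?U / (2 * ?k)\<bar>
    = \<bar>\<Sum>i\<in>C. u i * (?pi i * (\<Sum>j\<in>C - {i}. u j) / (2 * real (card C - 1))) - ?p i * u i * ?U / (2 * ?k)\<bar>"
    unfolding mean_selection_weight_def by (simp add: sum_subtractf sum_distrib_right sum_divide_distrib)
  also have "\<dots> \<le> (\<Sum>i\<in>C. 1 / ?k + real (card i) / real n / 2)"
    by (rule order.trans[OF sum_abs]) (rule sum_mono[OF summand])
  also have "\<dots> = 1 + 1/2"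
    using k' configs_sum_weight[OF C n] by (simp add: sum.distrib sum_divide_distrib[symmetric])
  finally show ?thesis by simp
qed

text \<open>\<open>laplace_step h\<close> is the expected transform after one round, renormalised by the expected number of
  remaining clusters, which is \<open>1 - h (1/2) / 2\<close> times the current one.\<close>

definition shrink_factor :: "(real \<Rightarrow> real) \<Rightarrow> real" where
  "shrink_factor h = 1 - h (1/2) / 2"

definition laplace_step :: "(real \<Rightarrow> real) \<Rightarrow> real \<Rightarrow> real" where
  "laplace_step h s = (let \<rho> = shrink_factor h in
     h (\<rho> * s) * (1 + (h (\<rho> * s + 1/2) - h (\<rho> * s)) / (2 * \<rho>)))"

text \<open>All that the deterministic analysis uses of a transform. Concavity is a cross-multiplied
  comparison of neighbouring chords, so that degenerate intervals are included.\<close>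

definition laplace_like :: "(real \<Rightarrow> real) \<Rightarrow> bool" where
  "laplace_like h \<longleftrightarrow> h 0 = 0 \<and> (\<forall>x y. 0 \<le> x \<longrightarrow> x \<le> y \<longrightarrow> h x \<le> h y)
     \<and> (\<forall>x\<ge>0. h x \<le> x) \<and> (\<forall>x. h x \<le> 1)
     \<and> (\<forall>x y z. 0 \<le> x \<longrightarrow> x \<le> y \<longrightarrow> y \<le> z \<longrightarrow> (h z - h y) * (y - x) \<le> (h y - h x) * (z - y))"

lemma laplace_like_laplace:
  assumes C: "C \<in> configs n" and n: "0 < n" and k: "0 < card C"
  shows "laplace_like (laplace n C)"
proof -
  let ?k = "real (card C)"
  let ?c = "\<lambda>i. ?k * real (card i) / real n"
  have c0: "0 \<le> ?c i" for i by simp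
  have fin: "finite C" by (rule config_finite[OF C])
  have eq: "laplace n C s = (\<Sum>i\<in>C. 1 - exp (- (s * ?c i))) / ?k" for s
    by (simp add: laplace_def mult.assoc)
  \<comment> \<open>Concavity of \<open>1 - exp (- s c)\<close>: factor out
    \<open>exp (- y c)\<close> and compare both sides with \<open>(y - x) (z - y) c\<close>.\<close>
  have conc: "(exp (- (y * c)) - exp (- (z * c))) * (y - x) \<le> (exp (- (x * c)) - exp (- (y * c))) * (z - y)"
    if "0 \<le> c" "x \<le> y" "y \<le> z" for c x y z :: real
  proof -
    have "exp (- (x * c)) = exp (- (y * c)) * exp ((y - x) * c)"
      by (simp add: exp_add[symmetric] algebra_simps)
    moreover have "exp (- (z * c)) = exp (- (y * c)) * exp (- ((z - y) * c))"
      by (simp add: exp_add[symmetric] algebra_simps)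
    moreover have "(1 - exp (- ((z - y) * c))) * (y - x) \<le> (exp ((y - x) * c) - 1) * (z - y)"
    proof -
      have "1 - exp (- ((z - y) * c)) \<le> (z - y) * c" using exp_ge_add_one_self[of "- ((z - y) * c)"] by simp
      then have "(1 - exp (- ((z - y) * c))) * (y - x) \<le> ((z - y) * c) * (y - x)"
        using that by (intro mult_right_mono) auto
      also have "\<dots> = ((y - x) * c) * (z - y)" by simp
      also have "\<dots> \<le> (exp ((y - x) * c) - 1) * (z - y)"
        using that exp_ge_add_one_self[of "(y - x) * c"] by (intro mult_right_mono) linarith+
      finally show ?thesis .
    qed
    then have "exp (- (y * c)) * ((1 - exp (- ((z - y) * c))) * (y - x)) \<le> exp (- (y * c)) * ((exp ((y - x) * c) - 1) * (z - y))"
      by (intro mult_left_mono) auto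
    ultimately show ?thesis by (simp add: algebra_simps)
  qed
  have "laplace n C x \<le> laplace n C y" if "x \<le> y" for x y
    unfolding eq using that by (intro divide_right_mono sum_mono) (auto intro!: mult_right_mono divide_right_mono mult_nonneg_nonneg)
  moreover have "laplace n C x \<le> x" for x
  proof -
    have "(\<Sum>i\<in>C. 1 - exp (- (x * ?c i))) \<le> (\<Sum>i\<in>C. x * ?c i)"
      using exp_ge_add_one_self[of "- (x * ?c i)" for i] by (intro sum_mono) (simp add: algebra_simps)
    also have "\<dots> = x * ?k * (\<Sum>i\<in>C. real (card i) / real n)"
      by (simp add: sum_distrib_left mult.assoc)
    also have "\<dots> = x * ?k" using configs_sum_weight[OF C n] by simp
    finally show ?thesis unfolding eq using k by (simp add: field_simps)
  qed
  moreover have "laplace n C x \<le> 1" for x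
    unfolding eq using k sum_mono[of C "\<lambda>i. 1 - exp (- (x * ?c i))" "\<lambda>_. 1"] by (simp add: field_simps)
  moreover have "(laplace n C z - laplace n C y) * (y - x) \<le> (laplace n C y - laplace n C x) * (z - y)"
    if "x \<le> y" "y \<le> z" for x y z
  proof -
    have "(\<Sum>i\<in>C. (exp (- (y * ?c i)) - exp (- (z * ?c i))) * (y - x))
        \<le> (\<Sum>i\<in>C. (exp (- (x * ?c i)) - exp (- (y * ?c i))) * (z - y))"
      by (rule sum_mono) (rule conc[OF c0 that])
    moreover have "(laplace n C z - laplace n C y) * (y - x) = (\<Sum>i\<in>C. (exp (- (y * ?c i)) - exp (- (z * ?c i))) * (y - x)) / ?k"
      unfolding eq by (simp add: diff_divide_distrib[symmetric] sum_subtractf[symmetric] sum_distrib_right)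
    moreover have "(laplace n C y - laplace n C x) * (z - y) = (\<Sum>i\<in>C. (exp (- (x * ?c i)) - exp (- (y * ?c i))) * (z - y)) / ?k"
      unfolding eq by (simp add: diff_divide_distrib[symmetric] sum_subtractf[symmetric] sum_distrib_right)
    ultimately show ?thesis by (simp add: divide_right_mono)
  qed
  moreover have "laplace n C 0 = 0" by (simp add: eq)
  ultimately show ?thesis unfolding laplace_like_def by blast
qed

context
  fixes h assumes h: "laplace_like h"
begin

lemma laplace_like_mono: "0 \<le> x \<Longrightarrow> x \<le> y \<Longrightarrow> h x \<le> h y"
  and laplace_like_zero: "h 0 = 0"
  and laplace_like_le: "0 \<le> x \<Longrightarrow> h x \<le> x"
  and laplace_like_le_1: "h x \<le> 1"
  and laplace_like_concave: "0 \<le> x \<Longrightarrow> x \<le> y \<Longrightarrow> y \<le> z \<Longrightarrow> (h z - h y) * (y - x) \<le> (h y - h x) * (z - y)"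
  using h unfolding laplace_like_def by blast+

lemma laplace_like_nonneg: "0 \<le> x \<Longrightarrow> 0 \<le> h x"
  using laplace_like_mono[of 0 x] laplace_like_zero by simp

lemma shrink_factor_bounds: "3/4 \<le> shrink_factor h" "shrink_factor h \<le> 1"
  using laplace_like_le[of "1/2"] laplace_like_nonneg[of "1/2"] by (auto simp: shrink_factor_def)

lemma laplace_step_bounds: "0 \<le> s \<Longrightarrow> 0 \<le> laplace_step h s \<and> laplace_step h s \<le> 2"
proof -
  assume s: "0 \<le> s"
  let ?\<rho> = "shrink_factor h"
  have \<rho>: "3/4 \<le> ?\<rho>" using shrink_factor_bounds by simp
  have p: "0 \<le> h (?\<rho> * s)" "h (?\<rho> * s) \<le> 1" using s \<rho> by (auto intro: laplace_like_nonneg laplace_like_le_1)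
  have d: "0 \<le> h (?\<rho> * s + 1/2) - h (?\<rho> * s)" "h (?\<rho> * s + 1/2) - h (?\<rho> * s) \<le> 1"
    using s \<rho> laplace_like_mono[of "?\<rho> * s" "?\<rho> * s + 1/2"] laplace_like_le_1[of "?\<rho> * s + 1/2"] p by auto
  have q: "0 \<le> 1 + (h (?\<rho> * s + 1/2) - h (?\<rho> * s)) / (2 * ?\<rho>)" "1 + (h (?\<rho> * s + 1/2) - h (?\<rho> * s)) / (2 * ?\<rho>) \<le> 2"
    using d \<rho> by (simp_all add: field_simps)
  show ?thesis unfolding laplace_step_def Let_def
    using mult_mono[OF p(2) q(2)] p q by simp
qed

end

text \<open>\<open>size_transform\<close> concentrates for a fixed \<open>q\<close>, whereas
  \<open>laplace\<close> rescales by the random number of clusters. Replacing that number by a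
  prediction \<open>x\<close> costs little, since the exponential is Lipschitz and the weights sum
  to 1.\<close>

lemma laplace_perturb:
  assumes D: "D \<in> configs n" and n: "0 < n" and s: "0 \<le> s" and x: "0 \<le> x"
  shows "\<bar>real (card D) * laplace n D s - (\<Sum>i\<in>D. 1 - exp (- (s * x * real (card i) / real n)))\<bar>
    \<le> s * \<bar>real (card D) - x\<bar>"
proof (cases "card D = 0")
  case True
  then show ?thesis using config_finite[OF D] s by auto
next
  case False
  let ?w = "\<lambda>i. real (card i) / real n"
  have lip: "\<bar>exp (- a) - exp (- b)\<bar> \<le> \<bar>a - b\<bar>" if "0 \<le> a" "0 \<le> b" for a b :: real
  proof -
    have *: "exp (- a) - exp (- b) \<le> b - a" if ab: "0 \<le> a" "a \<le> b" for a b :: real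
    proof -
      have "exp (- a) - exp (- b) = exp (- a) * (1 - exp (- (b - a)))"
        by (simp add: right_diff_distrib exp_add[symmetric])
      also have "1 - exp (- (b - a)) \<le> b - a" using exp_ge_add_one_self[of "- (b - a)"] by linarith
      then have "exp (- a) * (1 - exp (- (b - a))) \<le> 1 * (b - a)"
        using ab by (intro mult_mono) auto
      finally show ?thesis by simp
    qed
    show ?thesis
    proof (cases "a \<le> b")
      case True
      then show ?thesis using *[of a b] that by (auto simp: abs_if)
    next
      case False
      then show ?thesis using *[of b a] that by (auto simp: abs_if)
    qed
  qed
  have "real (card D) * laplace n D s - (\<Sum>i\<in>D. 1 - exp (- (s * x * real (card i) / real n)))
    = (\<Sum>i\<in>D. exp (- (s * x * ?w i)) - exp (- (s * real (card D) * ?w i)))"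
    using False by (simp add: laplace_def sum_subtractf)
  also have "\<bar>\<dots>\<bar> \<le> (\<Sum>i\<in>D. s * \<bar>real (card D) - x\<bar> * ?w i)"
  proof (rule order.trans[OF sum_abs sum_mono])
    fix i
    have "\<bar>exp (- (s * x * ?w i)) - exp (- (s * real (card D) * ?w i))\<bar> \<le> \<bar>s * x * ?w i - s * real (card D) * ?w i\<bar>"
      using s x by (intro lip) auto
    also have "\<dots> = \<bar>s * ?w i * (x - real (card D))\<bar>"
      by (intro arg_cong[where f=abs]) (simp add: algebra_simps diff_divide_distrib)
    also have "\<dots> = s * \<bar>real (card D) - x\<bar> * ?w i"
      using s by (simp add: abs_mult abs_minus_commute)
    finally show "\<bar>exp (- (s * x * ?w i)) - exp (- (s * real (card D) * ?w i))\<bar> \<le> s * \<bar>real (card D) - x\<bar> * ?w i" .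
  qed
  also have "\<dots> = s * \<bar>real (card D) - x\<bar>"
    using configs_sum_weight[OF D n] by (simp add: sum_distrib_left[symmetric] del: times_divide_eq_right)
  finally show ?thesis .
qed

text \<open>\<open>1 / N\<close> is the relative precision and \<open>S\<close> a finite set of
  scales. The factor \<open>3 + s\<close> collects the errors in the predicted count and in the
  transform; it is doubled because the count may halve.\<close>

definition regular_step :: "nat \<Rightarrow> real \<Rightarrow> real set \<Rightarrow> cluster set \<Rightarrow> cluster set \<Rightarrow> bool" where
  "regular_step n N S C D \<longleftrightarrow>
     \<bar>real (card D) - shrink_factor (laplace n C) * real (card C)\<bar> \<le> 3 * real (card C) / N \<and>
     (\<forall>s\<in>S. \<bar>laplace n D s - laplace_step (laplace n C) s\<bar> \<le> 6 * (3 + s) / N)"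

lemma round_halves:
  assumes C: "C \<in> configs n" and "proper_rule n \<rho>" and D: "D \<in> set_pmf (round_pmf n (\<rho> hist) C)"
  shows "card C \<le> 2 * card D"
proof -
  obtain act s where s: "s \<in> set_pmf (\<rho> hist C act)" "D = merge_clusters C s"
    using D by (auto simp: round_pmf_def)
  then obtain cand where "\<forall>i. cand i \<subseteq> incoming C act i" "selects_from cand C act s"
    using assms unfolding proper_rule_def by blast
  then have v: "valid_selection C s" by (intro valid_selectionI[OF C]) auto
  have "real (card D) = real (card C) - real (card (merging C s))"
    using card_merge_clusters[OF C v] s by simp
  then show ?thesis using merging_card[OF C v] by simp
qed

lemma size_transform_0:
  assumes "D \<in> configs n"
  shows "size_transform 0 D = real (card D)"
proof -
  have "(\<Sum>i\<in>D. 1 - 0 ^ card i) = (\<Sum>i\<in>D. 1::real)"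
    using configs_card_pos[OF assms] by (intro sum.cong) (auto simp: power_0_left)
  then show ?thesis by (simp add: size_transform_def)
qed

text \<open>A union bound over \<open>q = 0\<close>, which controls the count, and one
  \<open>q s\<close> per scale; each transform deviates by \<open>k / N\<close> with probability at
  most \<open>10 N^2 / k\<close>. Outside these events the step is regular by arithmetic.\<close>

lemma prob_not_regular_step:
  assumes C: "C \<in> configs n" and n: "0 < n" and k: "2 \<le> card C" and N: "0 < N" "N \<le> real (card C)"
    and S: "finite S" "\<And>s. s \<in> S \<Longrightarrow> 0 \<le> s"
  shows "measure_pmf.prob (round_pmf n (uniform_rule hist) C) {D. \<not> regular_step n N S C D}
    \<le> real (card S + 1) * (10 * N\<^sup>2 / real (card C))"
proof -
  let ?R = "round_pmf n (uniform_rule hist) C"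
  let ?h = "laplace n C" and ?k = "real (card C)"
  let ?\<rho> = "shrink_factor ?h"
  \<comment> \<open>The base uses the predicted count \<open>\<rho> k\<close>, because the variance
    bound needs a \<open>q\<close> that is fixed before the round.\<close>
  define q where "q s = exp (- (s * (?\<rho> * ?k) / real n))" for s
  define dev where "dev r D \<longleftrightarrow> ?k / N \<le> \<bar>size_transform r D - (size_transform r C - mean_selection_weight n (\<lambda>i. 1 - r ^ card i) C)\<bar>"
    for r D
  have h: "laplace_like ?h" using k by (intro laplace_like_laplace[OF C n]) simp
  have \<rho>: "3/4 \<le> ?\<rho>" "?\<rho> \<le> 1" by (rule shrink_factor_bounds[OF h])+
  \<comment> \<open>\<open>N \<le> k\<close> makes the additive error 2 of the mean at most
    \<open>2 k / N\<close>, whence the constant 3 below.\<close>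
  have k': "?k \<ge> 2" "?k / N > 0" "?k / N \<ge> 1" using k N by auto
  have dev: "measure_pmf.prob ?R {D. dev r D} \<le> 10 * N\<^sup>2 / ?k" if "0 \<le> r" "r \<le> 1" for r
  proof -
    have "measure_pmf.prob ?R {D. dev r D} \<le> 10 * ?k / (?k / N)\<^sup>2"
      unfolding dev_def by (rule uniform_round_deviation[OF C n k k'(2) that])
    also have "\<dots> = 10 * N\<^sup>2 / ?k" using k N by (simp add: power2_eq_square field_simps)
    finally show ?thesis .
  qed
  have imp: "regular_step n N S C D"
    if D: "D \<in> configs n" "card C \<le> 2 * card D" and nd: "\<not> dev 0 D" "\<And>s. s \<in> S \<Longrightarrow> \<not> dev (q s) D" for D
  proof -
    let ?k' = "real (card D)"
    have kD: "?k \<le> 2 * ?k'" using D(2) by linarith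
    have "\<bar>mean_selection_weight n (\<lambda>i. 1 - 0 ^ card i) C
        - (\<Sum>i\<in>C. (1 - exp (- (?k * real (card i) / (2 * real n)))) * (1 - 0 ^ card i)) * (\<Sum>i\<in>C. 1 - 0 ^ card i) / (2 * ?k)\<bar> \<le> 2"
      by (rule mean_selection_weight_approx[OF C n k]) (auto simp: power_0_left)
    moreover have "(\<Sum>i\<in>C. 1 - 0 ^ card i) = ?k" using size_transform_0[OF C] by (simp add: size_transform_def)
    moreover have "(\<Sum>i\<in>C. (1 - exp (- (?k * real (card i) / (2 * real n)))) * (1 - 0 ^ card i)) = ?k * ?h (1/2)"
    proof -
      have "(\<Sum>i\<in>C. (1 - exp (- (?k * real (card i) / (2 * real n)))) * (1 - 0 ^ card i))
          = (\<Sum>i\<in>C. (1 - exp (- (?k * real (card i) / (2 * real n)))))"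
        using configs_card_pos[OF C] by (intro sum.cong) (auto simp: power_0_left)
      then show ?thesis using k' by (simp add: laplace_def)
    qed
    ultimately have msw0: "\<bar>mean_selection_weight n (\<lambda>i. 1 - 0 ^ card i) C - ?k * ?h (1/2) / 2\<bar> \<le> 2"
      using k' by simp
    have "\<bar>?k' - (?k - mean_selection_weight n (\<lambda>i. 1 - 0 ^ card i) C)\<bar> < ?k / N"
      using nd(1) unfolding dev_def size_transform_0[OF C] size_transform_0[OF D(1)] by simp
    moreover have "?\<rho> * ?k = ?k - ?k * ?h (1/2) / 2" by (simp add: shrink_factor_def algebra_simps)
    ultimately have d0: "\<bar>?k' - ?\<rho> * ?k\<bar> \<le> 3 * ?k / N"
      using msw0 k'(3) unfolding abs_le_iff abs_less_iff by (simp add: algebra_simps)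
    moreover have "\<bar>laplace n D s - laplace_step ?h s\<bar> \<le> 6 * (3 + s) / N" if s: "s \<in> S" for s
    proof -
      have s0: "0 \<le> s" using S(2)[OF s] .
      have q01: "0 \<le> q s" "q s \<le> 1" using s0 \<rho> by (auto simp: q_def)
      let ?L = "?h (?\<rho> * s)" and ?L' = "?h (?\<rho> * s + 1/2)"
      have qp: "q s ^ m = exp (- (s * (?\<rho> * ?k) * real m / real n))" for m
        unfolding q_def by (simp add: exp_of_nat_mult[symmetric] algebra_simps)
      have U: "(\<Sum>i\<in>C. 1 - q s ^ card i) = ?k * ?L"
        using k' by (simp add: qp laplace_def algebra_simps)
      \<comment> \<open>\<open>(1 - a) (1 - b) = (1 - a) + (1 - b) - (1 - a b)\<close> for
        exponentials at the scales \<open>1/2\<close> and \<open>\<rho> s\<close>; their product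
        sits at \<open>\<rho> s + 1/2\<close>, the shifted argument in
        \<open>laplace_step\<close>.\<close>
      have split: "(1 - exp (- (?k * real (card i) / (2 * real n)))) * (1 - q s ^ card i)
        = (1 - exp (- (1/2 * ?k * real (card i) / real n))) + (1 - exp (- (?\<rho> * s * ?k * real (card i) / real n)))
          - (1 - exp (- ((?\<rho> * s + 1/2) * ?k * real (card i) / real n)))" for i
      proof -
        have "- ((?\<rho> * s + 1/2) * ?k * real (card i) / real n)
          = - (1/2 * ?k * real (card i) / real n) + - (?\<rho> * s * ?k * real (card i) / real n)"
          by (simp add: distrib_right add_divide_distrib)
        then have "exp (- ((?\<rho> * s + 1/2) * ?k * real (card i) / real n))
          = exp (- (1/2 * ?k * real (card i) / real n)) * exp (- (?\<rho> * s * ?k * real (card i) / real n))"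
          by (simp only: exp_add)
        moreover have "?k * real (card i) / (2 * real n) = 1/2 * ?k * real (card i) / real n" by simp
        moreover have "q s ^ card i = exp (- (?\<rho> * s * ?k * real (card i) / real n))"
          unfolding qp by (simp add: mult.assoc mult.left_commute)
        moreover have "(1 - a) * (1 - b) = (1 - a) + (1 - b) - (1 - a * b)" for a b :: real
          by (simp add: algebra_simps)
        ultimately show ?thesis by (simp only:)
      qed
      have lap: "(\<Sum>i\<in>C. 1 - exp (- (x * ?k * real (card i) / real n))) = ?k * ?h x" for x
        using k' by (simp add: laplace_def)
      have V: "(\<Sum>i\<in>C. (1 - exp (- (?k * real (card i) / (2 * real n)))) * (1 - q s ^ card i)) = ?k * (?h (1/2) + ?L - ?L')"
        unfolding split by (subst sum_subtractf) (simp only: sum.distrib lap right_diff_distrib distrib_left)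
      have "\<bar>mean_selection_weight n (\<lambda>i. 1 - q s ^ card i) C - ?k * (?h (1/2) + ?L - ?L') * (?k * ?L) / (2 * ?k)\<bar> \<le> 2"
        unfolding U[symmetric] V[symmetric]
        by (rule mean_selection_weight_approx[OF C n k]) (use q01 in \<open>auto simp: power_le_one\<close>)
      moreover have "?k * ?L - ?k * (?h (1/2) + ?L - ?L') * (?k * ?L) / (2 * ?k) = ?\<rho> * ?k * laplace_step ?h s"
      proof -
        have "kk * L - kk * (aa + L - L') * (kk * L) / (2 * kk) = r * kk * (L * (1 + (L' - L) / (2 * r)))"
          if "0 < kk" "0 < r" "aa = 2 - 2 * r" for kk r aa L L' :: real
          unfolding that(3) using that(1,2) by (simp add: field_simps)
        moreover have "0 < ?k" "0 < ?\<rho>" "?h (1/2) = 2 - 2 * ?\<rho>"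
          using k' \<rho> by (auto simp: shrink_factor_def)
        ultimately show ?thesis unfolding laplace_step_def Let_def by blast
      qed
      moreover have "\<bar>size_transform (q s) D - (?k * ?L - mean_selection_weight n (\<lambda>i. 1 - q s ^ card i) C)\<bar> < ?k / N"
        using nd(2)[OF s] unfolding dev_def size_transform_def U by simp
      ultimately have d1: "\<bar>size_transform (q s) D - ?\<rho> * ?k * laplace_step ?h s\<bar> \<le> 3 * ?k / N"
        using k'(3) unfolding abs_le_iff abs_less_iff by (simp add: algebra_simps)
      have "size_transform (q s) D = (\<Sum>i\<in>D. 1 - exp (- (s * (?\<rho> * ?k) * real (card i) / real n)))"
        by (simp add: size_transform_def qp)
      then have d2: "\<bar>?k' * laplace n D s - size_transform (q s) D\<bar> \<le> s * (3 * ?k / N)"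
        using laplace_perturb[OF D(1) n s0, of "?\<rho> * ?k"] mult_left_mono[OF d0 s0] \<rho> by simp
      have d3: "\<bar>(?\<rho> * ?k - ?k') * laplace_step ?h s\<bar> \<le> 3 * ?k / N * 2"
        unfolding abs_mult using laplace_step_bounds[OF h s0] d0 by (intro mult_mono) (auto simp: abs_minus_commute)
      \<comment> \<open>Three errors: rescaling by the true count, fluctuation of the transform, and
        the difference between predicted and true count.\<close>
      have "?k' * (laplace n D s - laplace_step ?h s) = (?k' * laplace n D s - size_transform (q s) D)
        + (size_transform (q s) D - ?\<rho> * ?k * laplace_step ?h s) + (?\<rho> * ?k - ?k') * laplace_step ?h s"
        by (simp add: algebra_simps)
      then have "\<bar>?k' * (laplace n D s - laplace_step ?h s)\<bar> \<le> s * (3 * ?k / N) + 3 * ?k / N + 3 * ?k / N * 2"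
        using d1 d2 d3 by linarith
      also have "\<dots> = (3 + s) * (3 * ?k / N)" by (simp add: algebra_simps add_divide_distrib)
      also have "\<dots> \<le> (3 + s) * (3 * (2 * ?k') / N)" using s0 N kD by (intro mult_left_mono divide_right_mono) auto
      also have "\<dots> = ?k' * (6 * (3 + s) / N)" by simp
      finally have "?k' * \<bar>laplace n D s - laplace_step ?h s\<bar> \<le> ?k' * (6 * (3 + s) / N)"
        by (simp add: abs_mult)
      moreover have "0 < ?k'" using kD k' by linarith
      ultimately show ?thesis by (rule mult_left_le_imp_le)
    qed
    ultimately show ?thesis unfolding regular_step_def by blast
  qed
  have "measure_pmf.prob ?R {D. \<not> regular_step n N S C D}
      \<le> measure_pmf.prob ?R ({D. dev 0 D} \<union> (\<Union>s\<in>S. {D. dev (q s) D}))"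
  proof (rule measure_pmf.finite_measure_mono_AE)
    show "AE D in measure_pmf ?R. D \<in> {D. \<not> regular_step n N S C D} \<longrightarrow> D \<in> {D. dev 0 D} \<union> (\<Union>s\<in>S. {D. dev (q s) D})"
      using imp round_in_configs[OF proper_uniform_rule C] round_halves[OF C proper_uniform_rule]
      unfolding AE_measure_pmf_iff by blast
  qed simp
  also have "\<dots> \<le> measure_pmf.prob ?R {D. dev 0 D} + measure_pmf.prob ?R (\<Union>s\<in>S. {D. dev (q s) D})"
    by (rule measure_Un_le) auto
  also have "measure_pmf.prob ?R (\<Union>s\<in>S. {D. dev (q s) D}) \<le> (\<Sum>s\<in>S. measure_pmf.prob ?R {D. dev (q s) D})"
    by (rule measure_UNION_le) (use S in auto)
  also have "\<dots> \<le> (\<Sum>s\<in>S. 10 * N\<^sup>2 / ?k)"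
    using S(2) \<rho> by (intro sum_mono dev) (auto simp: q_def)
  also have "measure_pmf.prob ?R {D. dev 0 D} \<le> 10 * N\<^sup>2 / ?k" by (rule dev) auto
  finally show ?thesis by (simp add: algebra_simps add_divide_distrib)
qed

section \<open>Decay of the transform\<close>

context
  fixes h assumes h: "laplace_like h"
begin

text \<open>Comparison through the chord from \<open>p1\<close> to \<open>q2\<close>, which shares
  an endpoint with each of the two chords, so that the concavity inequality applies twice.\<close>

lemma laplace_like_slopes:
  assumes p: "0 \<le> p1" "p1 \<le> p2" and q: "q1 \<le> q2" and pq: "p1 \<le> q1" "p2 \<le> q2"
  shows "(h q2 - h q1) * (p2 - p1) \<le> (h p2 - h p1) * (q2 - q1)"
proof (cases "p1 = q2")
  case True
  then show ?thesis using assms by simp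
next
  case False
  then have L: "0 < q2 - p1" using assms by linarith
  have 1: "(h q2 - h q1) * (q2 - p1) \<le> (h q2 - h p1) * (q2 - q1)"
    using laplace_like_concave[OF h, of p1 q1 q2] assms by (simp add: algebra_simps)
  have 2: "(h q2 - h p1) * (p2 - p1) \<le> (h p2 - h p1) * (q2 - p1)"
    using laplace_like_concave[OF h, of p1 p2 q2] assms by (simp add: algebra_simps)
  have "(h q2 - h q1) * (q2 - p1) * (p2 - p1) \<le> (h q2 - h p1) * (q2 - q1) * (p2 - p1)"
    using 1 p by (intro mult_right_mono) auto
  also have "\<dots> = (h q2 - h p1) * (p2 - p1) * (q2 - q1)" by simp
  also have "\<dots> \<le> (h p2 - h p1) * (q2 - p1) * (q2 - q1)"
    using 2 q by (intro mult_right_mono) auto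
  finally have "(q2 - p1) * ((h q2 - h q1) * (p2 - p1)) \<le> (q2 - p1) * ((h p2 - h p1) * (q2 - q1))"
    by (simp only: mult_ac)
  then show ?thesis using L by (rule mult_left_le_imp_le)
qed

text \<open>Let \<open>a = h (1/2)\<close>, \<open>p = h \<rho>\<close> and
  \<open>q = h (\<rho> + 1/2)\<close>. Concavity on \<open>\<rho> \<le> 1 \<le> \<rho> + 1/2\<close>
  bounds \<open>a (q - p)\<close> by \<open>h 1 - p\<close>, and concavity on
  \<open>0 \<le> 1/2 \<le> \<rho>\<close> bounds \<open>p\<close> by \<open>2 \<rho> a\<close>;
  together they bound the gain \<open>p (q - p) / (2 \<rho>)\<close> by
  \<open>h 1 - p\<close>.\<close>

lemma laplace_step_1: "laplace_step h 1 \<le> h 1"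
proof -
  let ?\<rho> = "shrink_factor h"
  define a p q where "a = h (1/2)" and "p = h ?\<rho>" and "q = h (?\<rho> + 1/2)"
  have \<rho>: "3/4 \<le> ?\<rho>" "?\<rho> \<le> 1" by (rule shrink_factor_bounds[OF h])+
  have \<rho>a: "?\<rho> = 1 - a / 2" by (simp add: shrink_factor_def a_def)
  have "(q - h 1) * (1 - ?\<rho>) \<le> (h 1 - p) * (?\<rho> + 1/2 - 1)"
    unfolding p_def q_def using \<rho> by (intro laplace_like_concave[OF h]) auto
  then have 1: "(q - p) * a \<le> h 1 - p" unfolding \<rho>a by (simp add: field_simps)
  have "(p - a) * (1/2 - 0) \<le> (a - h 0) * (?\<rho> - 1/2)"
    unfolding p_def a_def using \<rho> by (intro laplace_like_concave[OF h]) auto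
  then have 2: "p \<le> 2 * ?\<rho> * a" using laplace_like_zero[OF h] by (simp add: field_simps)
  have 3: "0 \<le> q - p" unfolding p_def q_def using laplace_like_mono[OF h, of ?\<rho> "?\<rho> + 1/2"] \<rho> by simp
  have "p * (q - p) / (2 * ?\<rho>) \<le> a * (q - p)"
    using mult_right_mono[OF 2 3] \<rho> by (simp add: field_simps)
  then have "p + p * (q - p) / (2 * ?\<rho>) \<le> h 1" using 1 by (simp add: mult.commute)
  then show ?thesis unfolding laplace_step_def Let_def p_def q_def by (simp add: algebra_simps)
qed

text \<open>The second assumption says \<open>\<rho> s + 1/2 \<le> s\<close>. So the multiplicative
  gain recovers at most 2/3 of \<open>h s - h (\<rho> s)\<close>, and at least a third of this
  increment is lost.\<close>

lemma laplace_step_large: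
  assumes s: "0 \<le> s" "1 \<le> h (1/2) * s"
  shows "3 * laplace_step h s \<le> 2 * h s + h (shrink_factor h * s)"
proof -
  let ?\<rho> = "shrink_factor h"
  define p q where "p = h (?\<rho> * s)" and "q = h (?\<rho> * s + 1/2)"
  have \<rho>: "3/4 \<le> ?\<rho>" "?\<rho> \<le> 1" by (rule shrink_factor_bounds[OF h])+
  have "?\<rho> * s + 1/2 \<le> s" using s by (simp add: shrink_factor_def algebra_simps)
  then have q: "q \<le> h s" unfolding q_def using s \<rho> by (intro laplace_like_mono[OF h]) auto
  have p: "0 \<le> p" "p \<le> 1" "p \<le> q"
    unfolding p_def q_def using s \<rho> laplace_like_nonneg[OF h, of "?\<rho> * s"] laplace_like_le_1[OF h]
      laplace_like_mono[OF h, of "?\<rho> * s" "?\<rho> * s + 1/2"] by auto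
  have "p / (2 * ?\<rho>) \<le> 2/3" using p \<rho> by (simp add: field_simps)
  moreover define X where "X = p / (2 * ?\<rho>) * (q - p)"
  ultimately have "X \<le> 2/3 * (h s - p)" unfolding X_def using q p \<rho> by (intro mult_mono) auto
  then have "3 * (p + X) \<le> 2 * h s + p" by (simp add: field_simps)
  moreover have "p * (1 + (q - p) / (2 * ?\<rho>)) = p + X"
    by (simp add: X_def distrib_left)
  ultimately show ?thesis unfolding laplace_step_def Let_def p_def[symmetric] q_def[symmetric]
    by simp
qed

text \<open>The gain term can take away at most the fraction \<open>1 / (2 \<rho>) \<le> 2/3\<close>
  of an increment, which therefore survives the round up to the factor 1/3, moved to a larger
  scale.\<close>

lemma laplace_step_increment:
  assumes x: "0 \<le> x" "x \<le> y"
  shows "(h (shrink_factor h * y) - h (shrink_factor h * x)) / 3 \<le> laplace_step h y - laplace_step h x"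
proof -
  let ?\<rho> = "shrink_factor h"
  define p p' q q' where "p = h (?\<rho> * x)" and "p' = h (?\<rho> * x + 1/2)"
    and "q = h (?\<rho> * y)" and "q' = h (?\<rho> * y + 1/2)"
  have \<rho>: "3/4 \<le> ?\<rho>" "?\<rho> \<le> 1" by (rule shrink_factor_bounds[OF h])+
  have xy: "0 \<le> ?\<rho> * x" "?\<rho> * x \<le> ?\<rho> * y" using x \<rho> by (auto intro: mult_left_mono)
  have m: "0 \<le> p" "p \<le> 1" "p \<le> q" "q \<le> q'" "p' \<le> q'"
    unfolding p_def q_def p'_def q'_def
    using laplace_like_nonneg[OF h xy(1)] laplace_like_le_1[OF h] xy
    by (auto intro!: laplace_like_mono[OF h])
  have "(q - p) * (q' - q) + p * (q' - p') \<ge> 0" using m by simp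
  moreover have "p * (q - p) \<le> 1 * (q - p)" using m by (intro mult_right_mono) auto
  ultimately have "q * (q' - q) - p * (p' - p) \<ge> - (q - p)" by (simp add: algebra_simps)
  moreover define X where "X = (q * (q' - q) - p * (p' - p)) / (2 * ?\<rho>)"
  moreover define Y where "Y = (q - p) / (2 * ?\<rho>)"
  moreover have "(- (q - p)) / (2 * ?\<rho>) \<le> (q * (q' - q) - p * (p' - p)) / (2 * ?\<rho>)"
    using calculation(1) \<rho> by (intro divide_right_mono) auto
  ultimately have XY: "- Y \<le> X" by (simp only: minus_divide_left)
  have Y: "Y \<le> (q - p) * (2/3)"
    unfolding Y_def using m \<rho> mult_left_mono[of "3/2" "2 * ?\<rho>" "q - p"] by (simp add: field_simps)
  have "laplace_step h y - laplace_step h x = q - p + X"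
    unfolding laplace_step_def Let_def X_def p_def[symmetric] q_def[symmetric] p'_def[symmetric] q'_def[symmetric]
    by (simp add: algebra_simps diff_divide_distrib add_divide_distrib)
  then show ?thesis using XY Y unfolding p_def[symmetric] q_def[symmetric] by simp
qed

text \<open>Replaces the shrink factor, which varies from round to round, by a fixed ratio
  \<open>r\<close>, so that one grid of scales serves all rounds. Together with the 1/3 of
  \<open>laplace_step_increment\<close> the factor per round is 1/4.\<close>

lemma laplace_like_scale:
  assumes x: "0 \<le> x" "x \<le> y" and \<rho>: "3/4 \<le> \<rho>" "\<rho> \<le> r" "r \<le> 1"
  shows "3/4 * (h (r * y) - h (r * x)) \<le> h (\<rho> * y) - h (\<rho> * x)"
proof (cases "x = y")
  case False
  have "(h (r * y) - h (r * x)) * (\<rho> * y - \<rho> * x) \<le> (h (\<rho> * y) - h (\<rho> * x)) * (r * y - r * x)"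
    using x \<rho> by (intro laplace_like_slopes mult_nonneg_nonneg mult_left_mono mult_right_mono) auto
  moreover have "\<rho> * y - \<rho> * x = (y - x) * \<rho>" "r * y - r * x = (y - x) * r"
    by (simp_all add: algebra_simps)
  ultimately have "(y - x) * ((h (r * y) - h (r * x)) * \<rho>) \<le> (y - x) * ((h (\<rho> * y) - h (\<rho> * x)) * r)"
    by (simp only: mult.left_commute)
  moreover have "0 < y - x" using x False by simp
  ultimately have 1: "(h (r * y) - h (r * x)) * \<rho> \<le> (h (\<rho> * y) - h (\<rho> * x)) * r"
    by (rule mult_left_le_imp_le)
  have "(h (r * y) - h (r * x)) * (3/4) \<le> (h (r * y) - h (r * x)) * \<rho>"
    using x \<rho> by (intro mult_left_mono) (auto intro!: laplace_like_mono[OF h] mult_left_mono)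
  also note 1
  also have "(h (\<rho> * y) - h (\<rho> * x)) * r \<le> (h (\<rho> * y) - h (\<rho> * x)) * 1"
    using x \<rho> by (intro mult_left_mono) (auto intro!: laplace_like_mono[OF h] mult_left_mono)
  finally show ?thesis by simp
qed simp

lemma laplace_like_half: "h 1 / 2 \<le> h (1/2)"
  using laplace_like_concave[OF h, of 0 "1/2" 1] laplace_like_zero[OF h] by simp

end

text \<open>As long as \<open>h 1 \<ge> \<epsilon>\<close>, also
  \<open>h (1/2) \<ge> \<epsilon> / 2\<close>, and the shrink factor is at most
  \<open>1 - \<epsilon> / 4\<close>, the ratio of the grid; a round then feeds each cell from the
  next smaller one. The point 1 serves to follow \<open>h 1\<close> afterwards.\<close>

definition probe_points :: "real \<Rightarrow> nat \<Rightarrow> real set" where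
  "probe_points \<epsilon> k = insert 1 ((\<lambda>j. (1 - \<epsilon> / 4) ^ j * (2 / \<epsilon>)) ` {..k + 1})"

text \<open>If \<open>h t 1\<close> stayed above \<open>\<epsilon>\<close>, every round would shift mass from scale \<open>r s\<close> to scale \<open>s\<close>, so the
  increment of the transform at the scale \<open>2 / \<epsilon>\<close> would be bounded below; but the transform
  decreases there by a fixed proportion of this increment in each round.\<close>

lemma transform_gets_small:
  fixes h :: "nat \<Rightarrow> real \<Rightarrow> real"
  assumes h: "\<And>t. t \<le> T \<Longrightarrow> laplace_like (h t)"
    and \<epsilon>: "0 < \<epsilon>" "\<epsilon> \<le> 1" and k: "(1 - \<epsilon> / 4) ^ k \<le> \<epsilon>\<^sup>2 / 4"
    and \<eta>: "0 \<le> \<eta>" "\<eta> \<le> (1/16) ^ k * \<epsilon> / 96"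
    and T: "real k + 16 * 16 ^ k / \<epsilon> < real T"
    and step: "\<And>t s. t < T \<Longrightarrow> s \<in> probe_points \<epsilon> k \<Longrightarrow> \<bar>h (Suc t) s - laplace_step (h t) s\<bar> \<le> \<eta>"
  shows "\<exists>t\<le>T. h t 1 < \<epsilon>"
proof (rule ccontr)
  assume "\<not> ?thesis"
  then have big: "\<epsilon> \<le> h t 1" if "t \<le> T" for t using that by (auto simp: not_less)
  define r S where "r = 1 - \<epsilon> / 4" and "S = 2 / \<epsilon>"
  have r: "3/4 \<le> r" "r \<le> 1" using \<epsilon> by (auto simp: r_def)
  have S: "0 < S" using \<epsilon> by (simp add: S_def)
  have pts: "r ^ j * S \<in> probe_points \<epsilon> k" if "j \<le> k + 1" for j
    using that by (auto simp: probe_points_def r_def S_def)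
  define D where "D j t = h t (r ^ j * S) - h t (r ^ Suc j * S)" for j t
  have mid: "\<epsilon> / 2 \<le> h t (1/2)" if "t \<le> T" for t
    using laplace_like_half[OF h[OF that]] big[OF that] by simp
  have \<rho>: "shrink_factor (h t) \<le> r" "3/4 \<le> shrink_factor (h t)" if "t \<le> T" for t
    using mid[OF that] shrink_factor_bounds[OF h[OF that]] by (auto simp: shrink_factor_def r_def)
  \<comment> \<open>At the bottom of the grid \<open>p \<le> \<epsilon> / 2\<close>, hence
    \<open>h p \<le> \<epsilon> / 2\<close>, and \<open>h\<close> still rises by
    \<open>\<epsilon> / 2\<close> on \<open>[p, 1]\<close>; concavity transfers this slope to
    \<open>[r p, p]\<close>.\<close>
  have base: "\<epsilon> / 4 * (1/4) ^ k \<le> D k t" if t: "t \<le> T" for t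
  proof -
    define p where "p = r ^ k * S"
    have p: "0 \<le> p" "p \<le> \<epsilon> / 2"
      using k \<epsilon> r unfolding p_def r_def[symmetric] S_def by (auto simp: field_simps power2_eq_square)
    have rp: "r * p \<le> p" "0 \<le> r * p" using p r by (auto simp: mult_left_le_one_le)
    have 1: "(h t 1 - h t p) * (p - r * p) \<le> (h t p - h t (r * p)) * (1 - p)"
      using p rp \<epsilon> by (intro laplace_like_slopes[OF h[OF t]]) auto
    have "h t p - h t (r * p) \<ge> 0"
      using laplace_like_mono[OF h[OF t] rp(2,1)] by simp
    then have 2: "(h t p - h t (r * p)) * (1 - p) \<le> (h t p - h t (r * p)) * 1"
      using p by (intro mult_left_mono) auto
    have "\<epsilon> / 2 * (p - r * p) \<le> (h t 1 - h t p) * (p - r * p)"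
      using rp big[OF t] laplace_like_le[OF h[OF t] p(1)] p by (intro mult_right_mono) auto
    also note 1
    also note 2
    also have "(h t p - h t (r * p)) * 1 = D k t" by (simp add: D_def p_def mult.assoc)
    finally have le: "\<epsilon> / 2 * (p - r * p) \<le> D k t" .
    have eq: "\<epsilon> / 2 * (p - r * p) = \<epsilon> / 4 * r ^ k"
      using \<epsilon> by (simp add: p_def S_def r_def field_simps)
    have "\<epsilon> / 4 * (1/4) ^ k \<le> \<epsilon> / 4 * r ^ k" using r \<epsilon> by (intro mult_left_mono power_mono) auto
    then show ?thesis using le unfolding eq by linarith
  qed
  \<comment> \<open>One round moves the increment up one cell at the cost of a factor 1/4 and an
    error \<open>2 \<eta>\<close>; the errors form a geometric series with sum below
    \<open>3 \<eta>\<close>.\<close>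
  have propagate: "(1/4) ^ m * (\<epsilon> / 4 * (1/4) ^ k) - 3 * \<eta> \<le> D (k - m) (t + m)" if "m \<le> k" "t + m \<le> T" for m t
    using that
  proof (induction m)
    case 0
    then show ?case using base[of t] \<eta> by simp
  next
    case (Suc m)
    let ?j = "k - Suc m" and ?t = "t + m"
    have j: "k - m = Suc ?j" using Suc.prems by simp
    let ?y = "r ^ ?j * S" and ?x = "r ^ Suc ?j * S"
    have t: "?t < T" "?t \<le> T" using Suc.prems by auto
    have xy: "0 \<le> ?x" "?x \<le> ?y" using r S by (auto simp: mult_left_le_one_le)
    have "\<bar>h (Suc ?t) ?y - laplace_step (h ?t) ?y\<bar> \<le> \<eta>" "\<bar>h (Suc ?t) ?x - laplace_step (h ?t) ?x\<bar> \<le> \<eta>"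
      using t Suc.prems by (auto intro!: step pts simp del: power_Suc)
    then have "laplace_step (h ?t) ?y - laplace_step (h ?t) ?x - 2 * \<eta> \<le> D ?j (Suc ?t)"
      unfolding D_def by linarith
    moreover have "(h ?t (shrink_factor (h ?t) * ?y) - h ?t (shrink_factor (h ?t) * ?x)) / 3
        \<le> laplace_step (h ?t) ?y - laplace_step (h ?t) ?x"
      by (rule laplace_step_increment[OF h[OF t(2)] xy])
    moreover have "3/4 * (h ?t (r * ?y) - h ?t (r * ?x))
        \<le> h ?t (shrink_factor (h ?t) * ?y) - h ?t (shrink_factor (h ?t) * ?x)"
      using \<rho>[OF t(2)] r by (intro laplace_like_scale[OF h[OF t(2)] xy]) auto
    moreover have "h ?t (r * ?y) - h ?t (r * ?x) = D (k - m) ?t"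
      unfolding D_def j by (simp add: mult.assoc)
    moreover have "(1/4) ^ m * (\<epsilon> / 4 * (1/4) ^ k) - 3 * \<eta> \<le> D (k - m) ?t"
      using Suc by simp
    moreover have "(1/4) ^ Suc m * (\<epsilon> / 4 * (1/4) ^ k) = (1/4) ^ m * (\<epsilon> / 4 * (1/4) ^ k) / 4" by simp
    ultimately show ?case using \<eta> by simp
  qed
  \<comment> \<open>After \<open>k\<close> rounds the top increment is at least
    \<open>4 \<delta> - 3 \<eta>\<close>. In each further round \<open>h\<close> drops by a third of
    it, up to an error \<open>\<eta>\<close>; since \<open>\<eta> \<le> \<delta> / 6\<close>, which
    is the origin of the 96, the drop is at least \<open>\<delta>\<close>.\<close>
  define \<delta> where "\<delta> = (1/16) ^ k * \<epsilon> / 16"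
  have drop: "h (Suc t) S \<le> h t S - \<delta>" if t: "k \<le> t" "t < T" for t
  proof -
    have tT: "t \<le> T" using t by simp
    have p16: "(1/4::real) ^ k * (1/4) ^ k = (1/16) ^ k" by (simp add: power_mult_distrib[symmetric])
    have "4 * \<delta> - 3 * \<eta> \<le> D 0 t"
      using propagate[of k "t - k"] t by (simp add: \<delta>_def p16[symmetric] algebra_simps)
    moreover have "1 \<le> h t (1/2) * S" using mid[OF tT] \<epsilon> by (simp add: S_def field_simps)
    then have "3 * laplace_step (h t) S \<le> 2 * h t S + h t (shrink_factor (h t) * S)"
      using S by (intro laplace_step_large[OF h[OF tT]]) auto
    moreover have "h t (shrink_factor (h t) * S) \<le> h t (r * S)"
      using \<rho>[OF tT] S by (intro laplace_like_mono[OF h[OF tT]] mult_right_mono) auto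
    moreover have "h (Suc t) S \<le> laplace_step (h t) S + \<eta>" using step[OF t(2) pts[of 0]] by simp
    moreover have "\<eta> \<le> \<delta> / 6" using \<eta> by (simp add: \<delta>_def)
    moreover have "D 0 t = h t S - h t (r * S)" by (simp add: D_def)
    ultimately show ?thesis by linarith
  qed
  have tot: "h t S \<le> 1 - real (t - k) * \<delta>" if "k \<le> t" "t \<le> T" for t
    using that
  proof (induction t rule: dec_induct)
    case base
    then show ?case using laplace_like_le_1[OF h] by simp
  next
    case (step t)
    then show ?case using drop[of t] by (simp add: Suc_diff_le algebra_simps)
  qed
  have kT: "k \<le> T"
  proof -
    have "real k < real T" using T \<epsilon> by (smt (verit) divide_pos_pos zero_less_power mult_pos_pos)
    then show ?thesis by simp
  qed
  \<comment> \<open>\<open>16 * 16 ^ k / \<epsilon>\<close> is \<open>1 / \<delta>\<close>: more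
    than that many drops make a quantity negative that starts at most at 1.\<close>
  have "1 < real (T - k) * \<delta>"
  proof -
    have "16 * 16 ^ k / \<epsilon> * \<delta> < real (T - k) * \<delta>"
      using \<epsilon> T kT by (intro mult_strict_right_mono) (auto simp: \<delta>_def)
    also have "16 * 16 ^ k / \<epsilon> * \<delta> = 1" using \<epsilon> by (simp add: \<delta>_def power_one_over field_simps)
    finally show ?thesis .
  qed
  then have "h T S < 0" using tot[OF kT order.refl] by linarith
  moreover have "0 \<le> h T S" using laplace_like_nonneg[OF h] S by simp
  ultimately show False by simp
qed

section \<open>The number of clusters along a regular path\<close>

lemma singletons_card: "card (singletons n) = n"
  unfolding singletons_def by (subst card_image) auto

text \<open>Strong induction, because regularity is assumed only while \<open>sqrt n\<close>
  clusters are present. Until the transform at 1 falls below \<open>\<epsilon>\<close>, by time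
  \<open>T0\<close>, only the halving bound is used. Afterwards
  \<open>h 1 \<le> 2 \<epsilon>\<close>, as the errors over \<open>T\<close> rounds sum to at most
  \<open>\<epsilon>\<close>, and a round removes at most the fraction \<open>2 \<epsilon>\<close>:
  \<open>\<epsilon>\<close> in the mean and \<open>\<epsilon>\<close> for the fluctuation.\<close>

lemma slow_coalescence:
  fixes C :: "nat \<Rightarrow> cluster set"
  assumes n: "4 \<le> n" and conf: "\<And>t. t \<le> T \<Longrightarrow> C t \<in> configs n" and C0: "C 0 = singletons n"
    and half: "\<And>t. t < T \<Longrightarrow> card (C t) \<le> 2 * card (C (Suc t))"
    and \<epsilon>: "0 < \<epsilon>" "\<epsilon> \<le> 1/2" and k: "(1 - \<epsilon> / 4) ^ k \<le> \<epsilon>\<^sup>2 / 4" and N: "0 < N"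
    and \<eta>: "6 * (3 + 2 / \<epsilon>) / N \<le> (1/16) ^ k * \<epsilon> / 96" "real T * (6 * (3 + 2 / \<epsilon>) / N) \<le> \<epsilon>" "3 / N \<le> \<epsilon>"
    and T0: "real k + 16 * 16 ^ k / \<epsilon> < real T0"
    and step: "\<And>t. t < T \<Longrightarrow> sqrt n \<le> card (C t) \<Longrightarrow> regular_step n N (probe_points \<epsilon> k) (C t) (C (Suc t))"
    and final: "sqrt n \<le> real n * (1/2) ^ T0 * (1 - 2 * \<epsilon>) ^ T"
  shows "\<forall>t\<le>T. sqrt n \<le> card (C t)"
proof -
  define \<eta> where "\<eta> = 6 * (3 + 2 / \<epsilon>) / N"
  let ?h = "\<lambda>t. laplace n (C t)"
  have n0: "0 < n" using n by simp
  have halves: "real n * (1/2) ^ t \<le> real (card (C t))" if "t \<le> T" for t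
    using that
  proof (induction t)
    case 0
    then show ?case by (simp add: C0 singletons_card)
  next
    case (Suc t)
    then have "real n * (1/2) ^ t \<le> 2 * real (card (C (Suc t)))" using half[of t] by simp
    then show ?case by simp
  qed
  have pos: "0 < card (C t)" if "t \<le> T" for t
  proof -
    have "0 < real n * (1/2) ^ t" using n0 by simp
    then show ?thesis using halves[OF that] by linarith
  qed
  have h: "laplace_like (?h t)" if "t \<le> T" for t
    by (rule laplace_like_laplace[OF conf[OF that] n0 pos[OF that]])
  have pts: "s \<le> 2 / \<epsilon>" if "s \<in> probe_points \<epsilon> k" for s
  proof -
    have "1 \<le> 2 / \<epsilon>" using \<epsilon> by (simp add: field_simps)
    moreover have "(1 - \<epsilon> / 4) ^ j * (2 / \<epsilon>) \<le> 1 * (2 / \<epsilon>)" for j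
      using \<epsilon> by (intro mult_right_mono power_le_one) auto
    ultimately show ?thesis using that by (auto simp: probe_points_def)
  qed
  have q: "(1 - 2 * \<epsilon>) ^ T \<le> (1 - 2 * \<epsilon>) ^ m" if "m \<le> T" for m
    using \<epsilon> that by (intro power_decreasing) auto
  have "sqrt n \<le> card (C t)" if "t \<le> T" for t
    using that
  proof (induction t rule: less_induct)
    case (less t)
    have reg: "regular_step n N (probe_points \<epsilon> k) (C s) (C (Suc s))" if "s < t" for s
      using that less by (intro step) auto
    have err: "\<bar>?h (Suc s) x - laplace_step (?h s) x\<bar> \<le> \<eta>" if "s < t" "x \<in> probe_points \<epsilon> k" for s x
    proof -
      have "\<bar>?h (Suc s) x - laplace_step (?h s) x\<bar> \<le> 6 * (3 + x) / N"
        using reg[OF that(1)] that(2) unfolding regular_step_def by blast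
      also have "\<dots> \<le> \<eta>" unfolding \<eta>_def using pts[OF that(2)] N by (intro divide_right_mono) auto
      finally show ?thesis .
    qed
    show ?case
    proof (cases "t \<le> T0")
      case True
      have "real n * (1/2) ^ T0 * (1 - 2 * \<epsilon>) ^ T \<le> real n * (1/2) ^ T0 * 1"
        using \<epsilon> by (intro mult_left_mono power_le_one) auto
      also have "\<dots> \<le> real n * (1/2) ^ t" using True by (auto intro!: mult_left_mono power_decreasing)
      also have "\<dots> \<le> card (C t)" by (rule halves[OF less.prems])
      finally show ?thesis using final by linarith
    next
      case False
      have "\<exists>t\<le>T0. ?h t 1 < \<epsilon>"
        by (rule transform_gets_small[where \<eta> = \<eta> and k = k])
          (use False less.prems \<epsilon> k \<eta>(1) N T0 h err in \<open>auto simp: \<eta>_def\<close>)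
      then obtain t0 where t0: "t0 \<le> T0" "?h t0 1 < \<epsilon>" by blast
      have \<eta>0: "0 \<le> \<eta>" using \<epsilon> N by (simp add: \<eta>_def)
      have small: "?h s 1 \<le> \<epsilon> + real (s - t0) * \<eta>" if "t0 \<le> s" "s \<le> t" for s
        using that
      proof (induction s rule: dec_induct)
        case base
        then show ?case using t0 by simp
      next
        case (step s)
        have "?h (Suc s) 1 \<le> laplace_step (?h s) 1 + \<eta>"
          using err[of s 1] step by (auto simp: probe_points_def abs_le_iff)
        also have "laplace_step (?h s) 1 \<le> ?h s 1"
          using step less.prems by (intro laplace_step_1 h) auto
        finally show ?case using step by (simp add: Suc_diff_le algebra_simps)
      qed
      have "real (card (C t0)) * (1 - 2 * \<epsilon>) ^ (s - t0) \<le> real (card (C s))" if "t0 \<le> s" "s \<le> t" for s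
        using that
      proof (induction s rule: dec_induct)
        case base
        then show ?case by simp
      next
        case (step s)
        let ?k = "real (card (C s))"
        have sT: "s \<le> T" using step less.prems by simp
        have "real (s - t0) * \<eta> \<le> real T * \<eta>" using sT \<eta>0 by (intro mult_right_mono) auto
        then have "?h s 1 \<le> 2 * \<epsilon>" using small[of s] step \<eta>(2) by (simp add: \<eta>_def)
        then have "1 - \<epsilon> \<le> shrink_factor (?h s)"
          using laplace_like_mono[OF h[OF sT], of "1/2" 1] by (simp add: shrink_factor_def)
        then have "(1 - \<epsilon>) * ?k \<le> shrink_factor (?h s) * ?k" by (intro mult_right_mono) auto
        moreover have "3 * ?k / N \<le> \<epsilon> * ?k" using mult_right_mono[OF \<eta>(3), of ?k] by simp
        moreover have "shrink_factor (?h s) * ?k - 3 * ?k / N \<le> real (card (C (Suc s)))"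
          using reg[of s] step by (auto simp: regular_step_def abs_le_iff)
        ultimately have "(1 - 2 * \<epsilon>) * ?k \<le> real (card (C (Suc s)))" by (simp add: algebra_simps)
        moreover have "(1 - 2 * \<epsilon>) * (real (card (C t0)) * (1 - 2 * \<epsilon>) ^ (s - t0)) \<le> (1 - 2 * \<epsilon>) * ?k"
          using step \<epsilon> by (intro mult_left_mono) auto
        ultimately show ?case using step by (simp add: Suc_diff_le algebra_simps)
      qed
      from this[of t] have "real (card (C t0)) * (1 - 2 * \<epsilon>) ^ (t - t0) \<le> real (card (C t))"
        using False t0 by simp
      moreover have "real n * (1/2) ^ T0 * (1 - 2 * \<epsilon>) ^ T \<le> real (card (C t0)) * (1 - 2 * \<epsilon>) ^ (t - t0)"
      proof (rule mult_mono)
        have "real n * (1/2) ^ T0 \<le> real n * (1/2) ^ t0" using t0 by (auto intro!: mult_left_mono power_decreasing)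
        also have "\<dots> \<le> card (C t0)" using t0 False less.prems by (intro halves) auto
        finally show "real n * (1/2) ^ T0 \<le> card (C t0)" .
        show "(1 - 2 * \<epsilon>) ^ T \<le> (1 - 2 * \<epsilon>) ^ (t - t0)" using less.prems by (intro q) auto
      qed (use \<epsilon> in auto)
      ultimately show ?thesis using final by linarith
    qed
  qed
  then show ?thesis by blast
qed

section \<open>The uniform process\<close>

lemma trajectory_pmf_path:
  assumes \<rho>: "proper_rule n \<rho>" and h: "h \<in> set_pmf (trajectory_pmf n \<rho> t)"
  shows "h ! 0 = singletons n" "\<And>i. i < t \<Longrightarrow> card (h ! i) \<le> 2 * card (h ! Suc i)"
proof -
  have "h ! 0 = singletons n \<and> (\<forall>i<t. card (h ! i) \<le> 2 * card (h ! Suc i))"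
    using h
  proof (induction t arbitrary: h)
    case 0
    then show ?case by simp
  next
    case (Suc t)
    then obtain h0 D where h0: "h0 \<in> set_pmf (trajectory_pmf n \<rho> t)" "h = h0 @ [D]"
      and D: "D \<in> set_pmf (round_pmf n (\<rho> (butlast h0)) (last h0))" by auto
    have s: "length h0 = Suc t" "set h0 \<subseteq> configs n" using trajectory_pmf_support[OF \<rho> h0(1)] by auto
    then have "h0 \<noteq> []" by auto
    then have l: "last h0 = h0 ! t" "last h0 \<in> configs n"
      using s last_in_set[of h0] by (auto simp: last_conv_nth)
    have "card (h ! i) \<le> 2 * card (h ! Suc i)" if "i < Suc t" for i
    proof (cases "i < t")
      case True
      then show ?thesis using Suc.IH[OF h0(1)] s h0(2) by (simp add: nth_append)
    next
      case False
      then have "i = t" using that by simp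
      then show ?thesis using round_halves[OF l(2) \<rho> D] s l h0(2) by (simp add: nth_append)
    qed
    then show ?case using Suc.IH[OF h0(1)] s h0(2) by (simp add: nth_append)
  qed
  then show "h ! 0 = singletons n" "\<And>i. i < t \<Longrightarrow> card (h ! i) \<le> 2 * card (h ! Suc i)" by auto
qed

text \<open>The one-round bound holds for every history, so it can be integrated over the trajectory
  so far although the rule may look at the past.\<close>

lemma trajectory_pmf_union_bound:
  assumes \<rho>: "proper_rule n \<rho>" and \<beta>: "0 \<le> \<beta>"
    and step: "\<And>C hist. C \<in> configs n \<Longrightarrow> measure_pmf.prob (round_pmf n (\<rho> hist) C) {D. bad C D} \<le> \<beta>"
  shows "measure_pmf.prob (trajectory_pmf n \<rho> t) {h. \<exists>i<t. bad (h ! i) (h ! Suc i)} \<le> real t * \<beta>"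
proof (induction t)
  case 0
  then show ?case by simp
next
  case (Suc t)
  let ?T = "trajectory_pmf n \<rho> t"
  let ?R = "\<lambda>h. round_pmf n (\<rho> (butlast h)) (last h)"
  let ?A = "{h. \<exists>i<t. bad (h ! i) (h ! Suc i)}" and ?B = "{h. \<exists>i<Suc t. bad (h ! i) (h ! Suc i)}"
  have ind: "\<bar>indicator S h :: real\<bar> \<le> 1" for S and h :: "cluster set list" by (auto split: split_indicator)
  have "measure_pmf.prob (trajectory_pmf n \<rho> (Suc t)) ?B
      = measure_pmf.expectation (trajectory_pmf n \<rho> (Suc t)) (indicator ?B)" by simp
  also have "\<dots> = measure_pmf.expectation ?T (\<lambda>h. measure_pmf.expectation (map_pmf (\<lambda>C. h @ [C]) (?R h)) (indicator ?B))"
    unfolding trajectory_pmf.simps by (rule expectation_bind_pmf_bounded[OF ind])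
  also have "\<dots> \<le> measure_pmf.expectation ?T (\<lambda>h. indicator ?A h + \<beta>)"
  proof (rule integral_mono_AE)
    have "\<bar>measure_pmf.expectation M (indicator S) :: real\<bar> \<le> 1" for M :: "cluster set list pmf" and S
      by simp
    then show "integrable (measure_pmf ?T) (\<lambda>h. measure_pmf.expectation (map_pmf (\<lambda>C. h @ [C]) (?R h)) (indicator ?B) :: real)"
      by (intro integrable_pmf_bounded)
    show "integrable (measure_pmf ?T) (\<lambda>h. indicator ?A h + \<beta>)"
      by (intro Bochner_Integration.integrable_add integrable_pmf_bounded[OF ind]) simp
    show "AE h in measure_pmf ?T. measure_pmf.expectation (map_pmf (\<lambda>C. h @ [C]) (?R h)) (indicator ?B) \<le> indicator ?A h + \<beta>"
      unfolding AE_measure_pmf_iff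
    proof
      fix h assume "h \<in> set_pmf ?T"
      then have s: "length h = Suc t" "set h \<subseteq> configs n" using trajectory_pmf_support[OF \<rho>] by auto
      have l: "last h = h ! t" using s by (simp add: last_conv_nth flip: length_greater_0_conv)
      have lc: "last h \<in> configs n" using s last_in_set[of h] by (cases h) auto
      have "measure_pmf.expectation (map_pmf (\<lambda>C. h @ [C]) (?R h)) (indicator ?B)
          = measure_pmf.prob (?R h) {D. h @ [D] \<in> ?B}"
        by (simp add: vimage_def)
      also have "\<dots> \<le> indicator ?A h + \<beta>"
      proof (cases "h \<in> ?A")
        case True
        then show ?thesis using \<beta> by (simp add: add_increasing2)
      next
        case False
        have "{D. h @ [D] \<in> ?B} \<subseteq> {D. bad (last h) D}"
          using False s l by (auto simp: nth_append less_Suc_eq split: if_splits)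
        then have "measure_pmf.prob (?R h) {D. h @ [D] \<in> ?B} \<le> measure_pmf.prob (?R h) {D. bad (last h) D}"
          by (intro measure_pmf.finite_measure_mono) auto
        also have "\<dots> \<le> \<beta>" by (rule step[OF lc])
        finally show ?thesis using False by simp
      qed
      finally show "measure_pmf.expectation (map_pmf (\<lambda>C. h @ [C]) (?R h)) (indicator ?B) \<le> indicator ?A h + \<beta>" .
    qed
  qed
  also have "\<dots> = measure_pmf.prob ?T ?A + \<beta>"
    by (subst Bochner_Integration.integral_add) (auto intro: integrable_pmf_bounded[OF ind])
  also have "\<dots> \<le> real (Suc t) * \<beta>" using Suc.IH by (simp add: algebra_simps)
  finally show ?case .
qed

section \<open>Reading off the coalescence time\<close>

lemma coalescence_time_gtI:
  assumes "\<forall>D\<in>set (map \<omega> [0..<Suc T]). card D \<noteq> 1"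
  shows "enat (Suc T) \<le> coalescence_time \<omega>"
  unfolding coalescence_time_def
proof (rule Inf_greatest)
  fix x assume "x \<in> enat ` {t. card (\<omega> t) = 1}"
  then obtain t where t: "x = enat t" "card (\<omega> t) = 1" by auto
  have "\<not> t < Suc T"
  proof
    assume "t < Suc T"
    then have "\<omega> t \<in> set (map \<omega> [0..<Suc T])" by (simp del: upt_Suc)
    then show False using assms t by blast
  qed
  then show "enat (Suc T) \<le> x" using t by simp
qed

lemma coalescence_time_leI:
  assumes "card (\<omega> T) = 1"
  shows "coalescence_time \<omega> \<le> enat T"
  unfolding coalescence_time_def using assms by (intro Inf_lower) auto

lemma coalescence_time_sets:
  assumes "proper_rule n \<rho>"
  shows "{\<omega> \<in> space (process n \<rho>). Q (coalescence_time \<omega>)} \<in> sets (process n \<rho>)"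
proof -
  have "coalescence_time -` {x. Q x} \<inter> space (process n \<rho>) \<in> sets (process n \<rho>)"
    by (rule measurable_sets[OF coalescence_time_measurable[OF assms]]) simp
  moreover have "coalescence_time -` {x. Q x} \<inter> space (process n \<rho>) = {\<omega> \<in> space (process n \<rho>). Q (coalescence_time \<omega>)}"
    by auto
  ultimately show ?thesis by simp
qed

text \<open>All parameters are kept free, and the conditions on them are purely numerical. The
  factor \<open>k + 4\<close> counts at most \<open>k + 3\<close> probe points and the event for the
  number of clusters.\<close>

lemma uniform_coalescence_time_lower:
  assumes n: "4 \<le> n" and \<epsilon>: "0 < \<epsilon>" "\<epsilon> \<le> 1/2" and k: "(1 - \<epsilon> / 4) ^ k \<le> \<epsilon>\<^sup>2 / 4"
    and N: "0 < N" "N \<le> sqrt n"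
    and \<eta>: "6 * (3 + 2 / \<epsilon>) / N \<le> (1/16) ^ k * \<epsilon> / 96" "real T * (6 * (3 + 2 / \<epsilon>) / N) \<le> \<epsilon>" "3 / N \<le> \<epsilon>"
    and m: "real k + 16 * 16 ^ k / \<epsilon> < real m"
    and final: "sqrt n \<le> real n * (1/2) ^ m * (1 - 2 * \<epsilon>) ^ T"
    and x: "x \<le> real T"
  shows "1 - real T * (real (k + 4) * (10 * N\<^sup>2 / sqrt n))
    \<le> \<P>(\<omega> in process n uniform_rule. ereal_of_enat (coalescence_time \<omega>) \<ge> ereal x)"
proof -
  let ?P = "process n uniform_rule" and ?T = "trajectory_pmf n uniform_rule T"
  define \<beta> where "\<beta> = real (k + 4) * (10 * N\<^sup>2 / sqrt n)"
  \<comment> \<open>Irregularity counts only while at least \<open>sqrt n\<close> clusters remain;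
    this makes the one-round bound valid in every configuration, without a stopping time.\<close>
  define bad where "bad C D \<longleftrightarrow> sqrt n \<le> card C \<and> \<not> regular_step n N (probe_points \<epsilon> k) C D" for C D
  have \<rho>: "proper_rule n uniform_rule" by (rule proper_uniform_rule)
  have sq: "2 \<le> sqrt n" using real_sqrt_le_mono[of 4 n] n by simp
  have cardP: "card (probe_points \<epsilon> k) \<le> k + 3"
    unfolding probe_points_def
    by (rule order.trans[OF card_insert_le_m1[of "k + 3"]])
      (use card_image_le[of "{..k+1}" "\<lambda>j. (1 - \<epsilon> / 4) ^ j * (2 / \<epsilon>)"] in auto)
  have \<beta>0: "0 \<le> \<beta>" unfolding \<beta>_def by simp
  have "measure_pmf.prob (round_pmf n (uniform_rule hist) C) {D. bad C D} \<le> \<beta>" if C: "C \<in> configs n" for C hist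
  proof (cases "sqrt n \<le> card C")
    case True
    have "measure_pmf.prob (round_pmf n (uniform_rule hist) C) {D. bad C D}
        \<le> measure_pmf.prob (round_pmf n (uniform_rule hist) C) {D. \<not> regular_step n N (probe_points \<epsilon> k) C D}"
      by (intro measure_pmf.finite_measure_mono) (auto simp: bad_def)
    also have "\<dots> \<le> real (card (probe_points \<epsilon> k) + 1) * (10 * N\<^sup>2 / real (card C))"
    proof (rule prob_not_regular_step[OF C])
      show "2 \<le> card C" using True sq by linarith
      show "N \<le> real (card C)" using True N by linarith
      show "finite (probe_points \<epsilon> k)" by (simp add: probe_points_def)
      show "0 \<le> s" if "s \<in> probe_points \<epsilon> k" for s using that \<epsilon> by (auto simp: probe_points_def)
    qed (use n N in auto)
    also have "\<dots> \<le> \<beta>"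
    proof -
      have "0 < sqrt n" "0 < real (card C)" using True sq by linarith+
      then show ?thesis unfolding \<beta>_def using cardP True
        by (intro mult_mono divide_left_mono mult_pos_pos) auto
    qed
    finally show ?thesis .
  qed (use \<beta>0 in \<open>simp add: bad_def\<close>)
  then have union: "measure_pmf.prob ?T {h. \<exists>i<T. bad (h ! i) (h ! Suc i)} \<le> real T * \<beta>"
    by (rule trajectory_pmf_union_bound[OF \<rho> \<beta>0])
  let ?G = "{h. \<forall>D\<in>set h. card D \<noteq> 1}"
  have good: "h \<in> ?G" if h: "h \<in> set_pmf ?T" and nb: "\<not> (\<exists>i<T. bad (h ! i) (h ! Suc i))" for h
  proof -
    have s: "length h = Suc T" "set h \<subseteq> configs n" using trajectory_pmf_support[OF \<rho> h] by auto
    have "\<forall>t\<le>T. sqrt n \<le> card (h ! t)"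
      by (rule slow_coalescence[OF n _ _ _ \<epsilon> k N(1) \<eta> m _ final])
        (use s trajectory_pmf_path[OF \<rho> h] nb in \<open>auto simp: bad_def\<close>)
    then have "2 \<le> real (card (h ! t))" if "t < length h" for t
      using that s sq order.trans[OF sq, of "real (card (h ! t))"] by simp
    then show ?thesis by (fastforce simp: in_set_conv_nth)
  qed
  have "1 - real T * \<beta> \<le> 1 - measure_pmf.prob ?T {h. \<exists>i<T. bad (h ! i) (h ! Suc i)}" using union by simp
  also have "\<dots> = measure_pmf.prob ?T (- {h. \<exists>i<T. bad (h ! i) (h ! Suc i)})"
    by (subst measure_pmf.prob_compl[symmetric]) (auto simp: Compl_eq_Diff_UNIV)
  also have "\<dots> \<le> measure_pmf.prob ?T ?G"
    by (rule measure_pmf.finite_measure_mono_AE) (auto simp: AE_measure_pmf_iff dest: good)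
  also have "\<dots> = measure ?P {\<omega> \<in> space ?P. \<forall>D\<in>set (map \<omega> [0..<Suc T]). card D \<noteq> 1}"
    unfolding measure_def using emeasure_process[OF \<rho>, of "\<lambda>h. \<forall>D\<in>set h. card D \<noteq> 1" T] by simp
  also have "\<dots> \<le> \<P>(\<omega> in ?P. ereal_of_enat (coalescence_time \<omega>) \<ge> ereal x)"
  proof -
    interpret prob_space ?P by (rule prob_space_process[OF \<rho>])
    have "ereal x \<le> ereal_of_enat (coalescence_time \<omega>)" if "\<forall>D\<in>set (map \<omega> [0..<Suc T]). card D \<noteq> 1" for \<omega>
    proof -
      have "ereal x \<le> ereal_of_enat (enat (Suc T))" using x by simp
      also have "\<dots> \<le> ereal_of_enat (coalescence_time \<omega>)"
        using coalescence_time_gtI[OF that] by (simp only: ereal_of_enat_le_iff)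
      finally show ?thesis .
    qed
    then show ?thesis
      by (intro finite_measure_mono coalescence_time_sets[OF \<rho>]) (auto simp del: set_map)
  qed
  finally show ?thesis unfolding \<beta>_def .
qed

lemma uniform_coalescence_time:
  "(\<lambda>n. \<P>(\<omega> in process n uniform_rule. ereal_of_enat (coalescence_time \<omega>)
      \<ge> ereal (1/3200 * ln (real n) * (ln (ln (real n)) / ln (ln (ln (real n))))))) \<longlonglongrightarrow> 1"
proof -
  \<comment> \<open>In terms of \<open>x = ln (ln n)\<close> one has \<open>ln n = exp x\<close> and
    \<open>sqrt n = exp (exp x / 2)\<close>, so every condition becomes an asymptotic inequality in
    one real variable.\<close>
  let ?x = "\<lambda>n. ln (ln (real n))"
  let ?err = "\<lambda>x::real. (exp x * x + 1) * ((8/100 * x + 5) * (10 * exp (- exp x / 4)))"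
  let ?p = "\<lambda>n. \<P>(\<omega> in process n uniform_rule. ereal_of_enat (coalescence_time \<omega>)
      \<ge> ereal (1/3200 * ln (real n) * (ln (ln (real n)) / ln (ln (ln (real n))))))"
  have lim: "filterlim ?x at_top sequentially" by real_asymp
  have a: "\<forall>\<^sub>F x::real in at_top. 1 \<le> ln x" by real_asymp
  have a': "\<forall>\<^sub>F x::real in at_top. 100 * ln x / x \<le> 1/4" by real_asymp
  have b: "\<forall>\<^sub>F x::real in at_top. 8/100 * x + 1 + 16 * exp (3 * (8/100 * x + 1)) * x < exp (x/2)" by real_asymp
  have c: "\<forall>\<^sub>F x::real in at_top. 6 * (3 + 2 * x) * exp (- exp x / 8) \<le> exp (- 3 * (8/100 * x + 1)) * (100 * ln x / x) / 96"
    by real_asymp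
  have d: "\<forall>\<^sub>F x::real in at_top. (exp x * x + 1) * (6 * (3 + 2 * x) * exp (- exp x / 8)) \<le> 100 * ln x / x" by real_asymp
  have e: "\<forall>\<^sub>F x::real in at_top. 3 * exp (- exp x / 8) \<le> 100 * ln x / x" by real_asymp
  have f: "\<forall>\<^sub>F x::real in at_top. exp x / 2 + exp (x/2) + 2 + exp x / 8 + 1 \<le> exp x" by real_asymp
  note evs = eventually_conj[OF a eventually_conj[OF a' eventually_conj[OF b eventually_conj[OF c
    eventually_conj[OF d eventually_conj[OF e f]]]]]]
  have lower: "\<forall>\<^sub>F n in sequentially. 1 - ?err (?x n) \<le> ?p n"
    using eventually_compose_filterlim[OF evs lim] eventually_gt_at_top[of 4]
  proof eventually_elim
    case (elim n)
    define x where "x = ?x n"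
    have n: "4 < n" using elim by simp
    have 1: "1 \<le> ln x" and 2: "100 * ln x / x \<le> 1/4"
      and 3: "8/100 * x + 1 + 16 * exp (3 * (8/100 * x + 1)) * x < exp (x/2)"
      and 4: "6 * (3 + 2 * x) * exp (- exp x / 8) \<le> exp (- 3 * (8/100 * x + 1)) * (100 * ln x / x) / 96"
      and 5: "(exp x * x + 1) * (6 * (3 + 2 * x) * exp (- exp x / 8)) \<le> 100 * ln x / x"
      and 6: "3 * exp (- exp x / 8) \<le> 100 * ln x / x"
      and 7: "exp x / 2 + exp (x/2) + 2 + exp x / 8 + 1 \<le> exp x"
      using elim by (simp_all add: x_def)
    have ln1: "1 < ln (real n)"
    proof -
      have "exp 1 < real n" using n exp_le by linarith
      then have "ln (exp 1) < ln (real n)" using n by (subst ln_less_cancel_iff) auto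
      then show ?thesis by simp
    qed
    have xp: "0 < x" using ln1 by (simp add: x_def)
    have "0 < ln x" using 1 by linarith
    then have x1: "1 < x" using xp by simp
    have ex: "exp x = ln (real n)" using ln1 by (simp add: x_def)
    have nx: "real n = exp (exp x)" using ex n by simp
    \<comment> \<open>The factor 100 makes \<open>k\<close> at most \<open>8 x / 100 + 1\<close>;
      then \<open>16 ^ k \<le> exp (3 k)\<close> stays well below
      \<open>exp (x / 2) = sqrt (ln n)\<close>.\<close>
    define \<epsilon> where "\<epsilon> = 100 * ln x / x"
    have \<epsilon>: "0 < \<epsilon>" "\<epsilon> \<le> 1/4" using 1 2 xp by (auto simp: \<epsilon>_def)
    have inv: "1 / \<epsilon> \<le> x" "2 / \<epsilon> \<le> x"
    proof -
      have "x / (100 * ln x) \<le> x / 1" "x / (50 * ln x) \<le> x / 1"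
        by (rule divide_left_mono; use 1 xp in linarith)+
      then show "1 / \<epsilon> \<le> x" "2 / \<epsilon> \<le> x" by (simp_all add: \<epsilon>_def)
    qed
    \<comment> \<open>By \<open>(1 - \<epsilon> / 4) ^ k \<le> exp (- \<epsilon> k / 4)\<close>, so
      many cells bring the grid from \<open>2 / \<epsilon>\<close> down to
      \<open>\<epsilon> / 2\<close>.\<close>
    define k where "k = nat \<lceil>8 / \<epsilon> * ln (2 / \<epsilon>)\<rceil>"
    have k_lo: "8 / \<epsilon> * ln (2 / \<epsilon>) \<le> real k" unfolding k_def by linarith
    have lnpos: "0 \<le> ln (2 / \<epsilon>)" using \<epsilon> by (simp add: field_simps)
    have k_hi: "real k \<le> 8/100 * x + 1"
    proof -
      have "ln (2 / \<epsilon>) \<le> ln x" using inv \<epsilon> xp by (subst ln_le_cancel_iff) auto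
      then have "8 / \<epsilon> * ln (2 / \<epsilon>) \<le> 8 / \<epsilon> * ln x" using \<epsilon> by (intro mult_left_mono) auto
      also have "\<dots> = 8/100 * x" using 1 x1 xp by (simp add: \<epsilon>_def)
      finally have "8 / \<epsilon> * ln (2 / \<epsilon>) \<le> 8/100 * x" .
      moreover have "0 \<le> 8 / \<epsilon> * ln (2 / \<epsilon>)" using \<epsilon> lnpos by simp
      ultimately show ?thesis unfolding k_def by linarith
    qed
    have k: "(1 - \<epsilon> / 4) ^ k \<le> \<epsilon>\<^sup>2 / 4"
    proof -
      have "(1 - \<epsilon> / 4) ^ k \<le> exp (- (\<epsilon> / 4)) ^ k"
        using exp_ge_add_one_self[of "- (\<epsilon> / 4)"] \<epsilon> by (intro power_mono) auto
      also have "\<dots> = exp (- (\<epsilon> / 4 * real k))" by (simp add: exp_of_nat_mult[symmetric] mult.commute)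
      also have "\<dots> \<le> exp (- (2 * ln (2 / \<epsilon>)))"
        using mult_left_mono[OF k_lo, of "\<epsilon> / 4"] \<epsilon> by simp
      also have "\<dots> = \<epsilon>\<^sup>2 / 4"
      proof -
        have "exp (- (2 * ln y)) = inverse (y\<^sup>2)" if "0 < y" for y :: real
          unfolding exp_minus mult_2 exp_add using that by (simp add: power2_eq_square)
        from this[of "2 / \<epsilon>"] show ?thesis using \<epsilon> by (simp only: zero_less_divide_iff) (simp add: power_divide)
      qed
      finally show ?thesis .
    qed
    have k16: "16 ^ k \<le> exp (3 * (8/100 * x + 1))"
    proof -
      have "(16::real) \<le> exp 3"
      proof -
        have "(13/8 :: real) \<le> exp (1/2)"
          using exp_lower_Taylor_quadratic[of "1/2"] by (simp add: power2_eq_square)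
        then have "(13/8 :: real) ^ 6 \<le> exp (1/2) ^ 6" by (intro power_mono) auto
        also have "exp (1/2) ^ 6 = exp (3::real)" by (simp add: exp_of_nat_mult[symmetric])
        finally show ?thesis by (simp add: power_divide)
      qed
      then have "(16::real) ^ k \<le> exp 3 ^ k" by (intro power_mono) auto
      also have "\<dots> = exp (3 * real k)" by (simp add: exp_of_nat_mult[symmetric] mult.commute)
      also have "\<dots> \<le> exp (3 * (8/100 * x + 1))" using k_hi by simp
      finally show ?thesis .
    qed
    \<comment> \<open>This is \<open>n ^ (1/8)\<close>: the precision beats all polylogarithmic
      factors, while \<open>N^2 / sqrt n = n ^ (-1/4)\<close> keeps the union bound small.\<close>
    define N where "N = exp (exp x / 8)"
    have N: "0 < N" "1 / N = exp (- exp x / 8)" by (simp_all add: N_def exp_minus field_simps)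
    have sqn: "sqrt n = exp (exp x / 2)"
      by (rule real_sqrt_unique) (simp_all add: nx power2_eq_square exp_add[symmetric])
    have T_pos: "0 \<le> 1/3200 * exp x * (x / ln x)" using 1 x1 xp by simp
    define T where "T = nat \<lceil>1/3200 * exp x * (x / ln x)\<rceil>"
    have T_lo: "1/3200 * exp x * (x / ln x) \<le> real T" unfolding T_def by linarith
    have T_hi: "real T \<le> 1/3200 * exp x * (x / ln x) + 1" unfolding T_def using T_pos by linarith
    have T_hi': "real T \<le> exp x * x + 1"
    proof -
      have "1/3200 * exp x * (x / ln x) \<le> 1 * exp x * (x / 1)"
        using 1 x1 xp by (intro mult_mono divide_left_mono) auto
      then show ?thesis using T_hi by simp
    qed
    \<comment> \<open>About \<open>sqrt (ln n)\<close> initial rounds, in which even halving leaves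
      \<open>n ^ (1 - o(1))\<close> clusters.\<close>
    define T0 where "T0 = nat \<lceil>exp (x/2)\<rceil>"
    have T0_lo: "exp (x/2) \<le> real T0" unfolding T0_def by linarith
    have T0_hi: "real T0 \<le> exp (x/2) + 1" unfolding T0_def by (smt (verit) exp_gt_zero of_nat_ceiling of_int_ceiling_le_add_one of_nat_nat zero_le_ceiling)
    have \<eta>1: "6 * (3 + 2 / \<epsilon>) / N \<le> 6 * (3 + 2 * x) * exp (- exp x / 8)"
    proof -
      have "6 * (3 + 2 / \<epsilon>) * (1 / N) \<le> 6 * (3 + 2 * x) * (1 / N)"
        using inv xp N(1) by (intro mult_right_mono) auto
      then show ?thesis by (simp only: N(2)[symmetric] times_divide_eq_right mult_1_right)
    qed
    have "1 - real T * (real (k + 4) * (10 * N\<^sup>2 / sqrt n)) \<le> ?p n"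
    proof (rule uniform_coalescence_time_lower[where \<epsilon> = \<epsilon> and m = T0])
      show "4 \<le> n" using n by simp
      show "0 < \<epsilon>" "\<epsilon> \<le> 1/2" "(1 - \<epsilon> / 4) ^ k \<le> \<epsilon>\<^sup>2 / 4" "0 < N" using \<epsilon> k N by auto
      show "N \<le> sqrt n" unfolding sqn N_def by simp
      show "6 * (3 + 2 / \<epsilon>) / N \<le> (1/16) ^ k * \<epsilon> / 96"
      proof -
        have "exp (- 3 * (8/100 * x + 1)) \<le> (1/16) ^ k"
          using le_imp_inverse_le[OF k16] unfolding mult_minus_left exp_minus
          by (simp add: power_one_over inverse_eq_divide)
        then have "exp (- 3 * (8/100 * x + 1)) * \<epsilon> / 96 \<le> (1/16) ^ k * \<epsilon> / 96"
          using \<epsilon> by (intro divide_right_mono mult_right_mono) auto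
        then show ?thesis using \<eta>1 4 unfolding \<epsilon>_def by linarith
      qed
      have "real T * (6 * (3 + 2 / \<epsilon>) / N) \<le> (exp x * x + 1) * (6 * (3 + 2 * x) * exp (- exp x / 8))"
        using T_hi' \<eta>1 \<epsilon> N xp by (intro mult_mono) auto
      also have "\<dots> \<le> \<epsilon>" using 5 by (simp add: \<epsilon>_def)
      finally show "real T * (6 * (3 + 2 / \<epsilon>) / N) \<le> \<epsilon>" .
      have "3 / N = 3 * (1 / N)" by simp
      then show "3 / N \<le> \<epsilon>" unfolding N(2) using 6 by (simp only: \<epsilon>_def)
      have "16 ^ k * (1 / \<epsilon>) \<le> exp (3 * (8/100 * x + 1)) * x"
        using k16 inv \<epsilon> by (intro mult_mono) auto
      then have "real k + 16 * (16 ^ k * (1 / \<epsilon>)) < real T0" using k_hi 3 T0_lo by linarith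
      then show "real k + 16 * 16 ^ k / \<epsilon> < real T0" by simp
      have "exp (- (4 * \<epsilon>)) \<le> 1 - 2 * \<epsilon>"
      proof -
        have "(1 + 4 * \<epsilon>) * (1 - 2 * \<epsilon>) \<ge> 1" using \<epsilon> mult_nonneg_nonneg[of \<epsilon> "1/4 - \<epsilon>"] by (simp add: algebra_simps)
        moreover have "exp (4 * \<epsilon>) * (1 - 2 * \<epsilon>) \<ge> (1 + 4 * \<epsilon>) * (1 - 2 * \<epsilon>)"
          using \<epsilon> exp_ge_add_one_self[of "4 * \<epsilon>"] by (intro mult_right_mono) auto
        ultimately show ?thesis by (simp add: exp_minus field_simps)
      qed
      then have "exp (- (4 * \<epsilon>)) ^ T \<le> (1 - 2 * \<epsilon>) ^ T" by (intro power_mono) auto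
      then have A: "exp (- (4 * \<epsilon> * real T)) \<le> (1 - 2 * \<epsilon>) ^ T"
        by (simp add: exp_of_nat_mult[symmetric] mult.commute)
      have "exp (- 1) \<le> (1/2 :: real)" using exp_ge_add_one_self[of 1] by (simp add: exp_minus field_simps)
      then have "exp (- 1) ^ T0 \<le> (1/2 :: real) ^ T0" by (intro power_mono) auto
      then have B: "exp (- real T0) \<le> (1/2) ^ T0" by (simp add: exp_of_nat_mult[symmetric])
      have "4 * \<epsilon> * real T \<le> 4 * \<epsilon> * (1/3200 * exp x * (x / ln x) + 1)"
        using T_hi \<epsilon> by (intro mult_left_mono) auto
      \<comment> \<open>The constant 1/3200 enters here: \<open>4 * 100 / 3200 = 1/8\<close>, so the
        slow phase costs about a factor \<open>n ^ (1/8)\<close> and at least \<open>sqrt n\<close>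
        clusters remain.\<close>
      also have "\<dots> = exp x / 8 + 4 * \<epsilon>" using 1 x1 xp by (simp add: \<epsilon>_def field_simps)
      finally have "4 * \<epsilon> * real T \<le> exp x / 8 + 1" using \<epsilon> by simp
      then have "exp x / 2 \<le> exp x + - real T0 + - (4 * \<epsilon> * real T)" using 7 T0_hi by linarith
      then have "exp (exp x / 2) \<le> exp (exp x) * exp (- real T0) * exp (- (4 * \<epsilon> * real T))"
        by (simp only: exp_add[symmetric] exp_le_cancel_iff)
      also have "\<dots> \<le> exp (exp x) * (1/2) ^ T0 * (1 - 2 * \<epsilon>) ^ T"
        using A B by (intro mult_mono) auto
      finally show "sqrt n \<le> real n * (1/2) ^ T0 * (1 - 2 * \<epsilon>) ^ T" unfolding sqn by (simp only: nx)
      show "1/3200 * ln (real n) * (ln (ln (real n)) / ln (ln (ln (real n)))) \<le> real T"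
        using T_lo unfolding ex by (simp add: x_def)
    qed
    moreover have "real T * (real (k + 4) * (10 * N\<^sup>2 / sqrt n)) \<le> ?err x"
    proof (rule mult_mono[OF T_hi'] , rule mult_mono)
      show "real (k + 4) \<le> 8/100 * x + 5" using k_hi by simp
      have "N\<^sup>2 / sqrt n = exp (- exp x / 4)"
        unfolding N_def sqn by (simp add: power2_eq_square exp_add[symmetric] exp_diff[symmetric])
      then show "10 * N\<^sup>2 / sqrt n \<le> 10 * exp (- exp x / 4)" by (simp add: times_divide_eq_right[symmetric] del: times_divide_eq_right)
    qed (use xp in auto)
    ultimately show ?case unfolding x_def by linarith
  qed
  have "((\<lambda>x. 1 - ?err x) \<longlongrightarrow> 1) at_top" by real_asymp
  then have lim1: "(\<lambda>n. 1 - ?err (?x n)) \<longlonglongrightarrow> 1" by (rule filterlim_compose[OF _ lim])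
  have "?p n \<le> 1" for n
    by (rule prob_space.prob_le_1[OF prob_space_process[OF proper_uniform_rule]])
  then show ?thesis
    by (intro tendsto_sandwich[OF lower _ lim1 tendsto_const]) auto
qed

section \<open>One round of the size-biased process\<close>

lemma configs_card_ge_1:
  assumes "C \<in> configs n" "0 < n"
  shows "1 \<le> card C"
proof -
  have "C \<noteq> {}" using configs_sum_card[OF assms(1)] assms(2) by auto
  then show ?thesis using config_finite[OF assms(1)] by (simp add: Suc_le_eq card_gt_0_iff)
qed

lemma finite_set_pmf_actions:
  assumes "0 < n" "C \<in> configs n"
  shows "finite (set_pmf (actions_pmf n C))"
proof -
  have "set_pmf (request_pmf n) \<subseteq> insert None (Some ` {..<n})"
    using assms(1) by (auto simp: request_pmf_def lessThan_empty_iff split: if_splits)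
  then have "finite (set_pmf (request_pmf n))" by (rule finite_subset) simp
  then show ?thesis unfolding actions_pmf_eq set_Pi_pmf[OF config_finite[OF assms(2)]]
    using config_finite[OF assms(2)] by (intro finite_PiE_dflt) auto
qed

definition relative_size :: "nat \<Rightarrow> cluster set \<Rightarrow> cluster \<Rightarrow> real" where
  "relative_size n C i = real (card C) * real (card i) / real n"

definition truncated_mean :: "nat \<Rightarrow> cluster set \<Rightarrow> real" where
  "truncated_mean n C = (\<Sum>i\<in>C. min 1 (relative_size n C i)) / real (card C)"

text \<open>The mean of the squared relative sizes, see \<open>sum_square_relative_size\<close>.
  This form separates the factor \<open>card C\<close>, which shrinks in a round, from the sum of
  squares, which grows.\<close>

definition susceptibility :: "nat \<Rightarrow> cluster set \<Rightarrow> real" where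
  "susceptibility n C = real (card C) * (\<Sum>i\<in>C. (real (card i) / real n)\<^sup>2)"

definition successful :: "cluster set \<Rightarrow> actions \<Rightarrow> cluster set" where
  "successful C act = {i \<in> C. act i = None \<and> smallest_incoming C act i \<noteq> {}}"

text \<open>All smallest requests come from clusters of equal size, so the value does not depend on
  the choice. It is a function of the actions alone, however ties are broken.\<close>

definition partner_size :: "nat \<Rightarrow> cluster set \<Rightarrow> actions \<Rightarrow> cluster \<Rightarrow> real" where
  "partner_size n C act i = (if i \<in> successful C act
     then relative_size n C (SOME j. j \<in> smallest_incoming C act i) else 0)"

text \<open>The increase of \<open>susceptibility\<close> through the mixed terms
  \<open>2 a b\<close> of \<open>(a + b)^2\<close>, with the factor \<open>card C\<close> held
  fixed. Being a mean with weights \<open>card i / n\<close>, it is open to Jensen's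
  inequality.\<close>

definition mean_partner_size :: "nat \<Rightarrow> cluster set \<Rightarrow> actions \<Rightarrow> real" where
  "mean_partner_size n C act = (\<Sum>i\<in>C. real (card i) / real n * (2 * partner_size n C act i))"

text \<open>The number of merges in units of \<open>k A\<close>, its natural order: in these units
  the mean is bounded below and the second moment above by constants.\<close>

definition merge_ratio :: "nat \<Rightarrow> cluster set \<Rightarrow> actions \<Rightarrow> real" where
  "merge_ratio n C act = real (card (successful C act)) / (truncated_mean n C * real (card C))"

lemma smallest_incoming_card:
  assumes "j \<in> smallest_incoming C act i" "j' \<in> smallest_incoming C act i"
  shows "card j = card j'"
  using assms by (auto simp: smallest_incoming_def is_arg_min_def) (meson nat_neq_iff)

lemma smallest_incoming_nonempty_iff:
  assumes "finite C"
  shows "smallest_incoming C act i \<noteq> {} \<longleftrightarrow> (\<exists>j\<in>incoming C act i. card j \<le> card i)"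
proof
  assume "\<exists>j\<in>incoming C act i. card j \<le> card i"
  then obtain j0 where "j0 \<in> incoming C act i" "card j0 \<le> card i" by blast
  then obtain j where "is_arg_min card (\<lambda>j. j \<in> incoming C act i \<and> card j \<le> card i) j"
    using ex_is_arg_min_if_finite[of "{j \<in> incoming C act i. card j \<le> card i}" card] assms
    by (fastforce simp: incoming_def)
  then show "smallest_incoming C act i \<noteq> {}" by (auto simp: smallest_incoming_def)
qed (auto simp: smallest_incoming_def is_arg_min_def)

lemma one_minus_exp_ge: "0 \<le> z \<Longrightarrow> min 1 z / 2 \<le> 1 - exp (- z)" for z :: real
proof (cases "z \<le> 1")
  case True
  assume z: "0 \<le> z"
  have "1 \<le> (1 - z / 2) * (1 + z)" using z True mult_nonneg_nonneg[of z "1 - z"] by (simp add: algebra_simps)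
  also have "\<dots> \<le> (1 - z / 2) * exp z" using z True by (intro mult_left_mono exp_ge_add_one_self) auto
  finally have "1 \<le> exp z * (1 - z / 2)" by (simp only: mult.commute)
  then show ?thesis using True by (simp add: exp_minus field_simps)
next
  case False
  then have "2 \<le> exp z" using exp_ge_add_one_self[of z] by linarith
  then show ?thesis using False by (simp add: exp_minus field_simps)
qed

context
  fixes C :: "cluster set" and n :: nat
  assumes C: "C \<in> configs n" and n: "0 < n"
begin

private abbreviation x where "x \<equiv> relative_size n C"
private abbreviation \<kappa> where "\<kappa> \<equiv> real (card C)"
private abbreviation w where "w \<equiv> \<lambda>i. real (card i) / real n"
private abbreviation A where "A \<equiv> truncated_mean n C"
private abbreviation f where "f \<equiv> \<lambda>i. min 1 (x i)"

section \<open>Normalised sizes and the change of the potential\<close>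

lemma card_C_pos: "0 < \<kappa>" using configs_card_ge_1[OF C n] by simp

lemma finite_C: "finite C" by (rule config_finite[OF C])

lemma relative_size_nonneg: "0 \<le> x i" by (simp add: relative_size_def)

lemma relative_size_le_iff: "x i \<le> x j \<longleftrightarrow> card i \<le> card j"
  using card_C_pos n by (simp add: relative_size_def field_simps)

lemma sum_relative_size: "(\<Sum>i\<in>C. x i) = \<kappa>"
  using configs_sum_weight[OF C n]
  by (simp add: relative_size_def sum_distrib_left[symmetric] times_divide_eq_right[symmetric] del: times_divide_eq_right)

lemma truncated_mean_sum: "(\<Sum>i\<in>C. f i) = \<kappa> * A"
  using card_C_pos by (simp add: truncated_mean_def)

text \<open>Either one cluster already contributes 1, or nothing is truncated and the sum is
  \<open>k\<close>. This later absorbs the diagonal of a second moment.\<close>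

lemma truncated_mean_ge: "1 \<le> \<kappa> * A"
proof (cases "\<exists>i\<in>C. 1 \<le> x i")
  case True
  then obtain i where "i \<in> C" "1 \<le> x i" by blast
  then have "1 \<le> f i" by simp
  also have "\<dots> \<le> (\<Sum>i\<in>C. f i)"
    using \<open>i \<in> C\<close> finite_C relative_size_nonneg by (intro member_le_sum) auto
  finally show ?thesis by (simp only: truncated_mean_sum)
next
  case False
  then have "(\<Sum>i\<in>C. f i) = (\<Sum>i\<in>C. x i)" by (intro sum.cong) auto
  then show ?thesis using card_C_pos configs_card_ge_1[OF C n] by (simp only: truncated_mean_sum sum_relative_size)
qed

lemma truncated_mean_pos: "0 < A"
  using truncated_mean_ge card_C_pos by (metis mult_nonneg_nonpos not_less not_one_le_zero order.trans less_imp_le)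

lemma truncated_mean_le_1: "A \<le> 1"
proof -
  have "(\<Sum>i\<in>C. f i) \<le> (\<Sum>i\<in>C. 1)" by (intro sum_mono) auto
  then have "\<kappa> * A \<le> \<kappa> * 1" by (simp add: truncated_mean_sum)
  then show ?thesis using card_C_pos by (rule mult_left_le_imp_le)
qed

lemma sum_square_relative_size: "(\<Sum>i\<in>C. (x i)\<^sup>2) = \<kappa> * susceptibility n C"
  by (simp add: relative_size_def susceptibility_def sum_distrib_left power2_eq_square algebra_simps)

lemma susceptibility_ge_1: "1 \<le> susceptibility n C"
proof -
  have "0 \<le> (\<Sum>i\<in>C. (x i - 1)\<^sup>2)" by (intro sum_nonneg) simp
  also have "\<dots> = (\<Sum>i\<in>C. (x i)\<^sup>2) - 2 * (\<Sum>i\<in>C. x i) + \<kappa>"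
    by (simp add: power2_diff sum.distrib sum_subtractf sum_distrib_left)
  also have "\<dots> = \<kappa> * susceptibility n C - \<kappa>" by (simp add: sum_square_relative_size sum_relative_size)
  finally have "\<kappa> * 1 \<le> \<kappa> * susceptibility n C" by simp
  then show ?thesis using card_C_pos by (rule mult_left_le_imp_le)
qed

text \<open>When most clusters are small, few merges occur but the susceptibility is large.\<close>

lemma susceptibility_truncated_mean: "1/2 \<le> susceptibility n C * A"
proof (cases "A \<le> 1/2")
  case False
  have "1 * (1/2) \<le> susceptibility n C * A" using susceptibility_ge_1 False by (intro mult_mono) auto
  then show ?thesis by simp
next
  case True
  \<comment> \<open>In \<open>x \<le> t min 1 x + x^2 / (2 t)\<close> the left side averages to 1;
    with this \<open>t\<close> the first term on the right averages to 1/2 and the second to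
    \<open>Q A\<close>.\<close>
  define t where "t = 1 / (2 * A)"
  have t: "1 \<le> t" "0 < t" using True truncated_mean_pos by (auto simp: t_def field_simps)
  have "x i \<le> t * f i + (x i)\<^sup>2 / (2 * t)" if "i \<in> C" for i
  proof (cases "x i \<le> 1")
    case True
    then have "1 * f i \<le> t * f i" using t relative_size_nonneg[of i] by (intro mult_right_mono) auto
    moreover have "0 \<le> (x i)\<^sup>2 / (2 * t)" using t by simp
    ultimately show ?thesis using True by simp
  next
    case False
    have "0 \<le> (x i - t)\<^sup>2" by simp
    then have "2 * t * x i \<le> t * t + (x i)\<^sup>2" by (simp add: power2_eq_square algebra_simps)
    then have "x i \<le> t / 2 + (x i)\<^sup>2 / (2 * t)" using t by (simp add: field_simps power2_eq_square)
    then show ?thesis using False t by simp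
  qed
  then have "(\<Sum>i\<in>C. x i) \<le> (\<Sum>i\<in>C. t * f i + (x i)\<^sup>2 / (2 * t))" by (rule sum_mono)
  then have "\<kappa> \<le> t * (\<kappa> * A) + \<kappa> * susceptibility n C / (2 * t)"
    by (simp add: sum.distrib sum_distrib_left[symmetric] sum_divide_distrib[symmetric]
        sum_relative_size truncated_mean_sum sum_square_relative_size del: min_less_iff_conj)
  also have "\<dots> = \<kappa> * (1/2 + susceptibility n C * A)"
    using truncated_mean_pos by (simp add: t_def field_simps)
  finally have "\<kappa> * 1 \<le> \<kappa> * (1/2 + susceptibility n C * A)" by simp
  then have "1 \<le> 1/2 + susceptibility n C * A" using card_C_pos by (rule mult_left_le_imp_le)
  then show ?thesis by simp
qed

lemma successful_subset: "successful C act \<subseteq> C" by (auto simp: successful_def)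

lemma successful_iff: "i \<in> successful C act \<longleftrightarrow> i \<in> C \<and> act i = None \<and> (\<exists>j\<in>C - {i}. card j \<le> card i \<and> (\<exists>a\<in>i. act j = Some a))"
proof -
  have "smallest_incoming C act i \<noteq> {} \<longleftrightarrow> (\<exists>j\<in>C - {i}. card j \<le> card i \<and> (\<exists>a\<in>i. act j = Some a))" if "act i = None"
    unfolding smallest_incoming_nonempty_iff[OF finite_C] using that by (auto simp: incoming_def)
  then show ?thesis unfolding successful_def by auto
qed

text \<open>The last fact of the second case drives the tail bounds: a partner larger than
  \<open>v\<close> forces all clusters of size at most \<open>v\<close> to miss
  \<open>i\<close>.\<close>

lemma partner_size_cases:
  obtains (none) "i \<notin> successful C act" "partner_size n C act i = 0"
  | (some) j where "i \<in> successful C act" "j \<in> C - {i}" "card j \<le> card i" "\<exists>a\<in>i. act j = Some a"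
      "partner_size n C act i = x j"
      "\<And>k. k \<in> C \<Longrightarrow> card k < card j \<Longrightarrow> \<not> (\<exists>a\<in>i. act k = Some a)"
proof (cases "i \<in> successful C act")
  case False
  then show ?thesis using none by (simp add: partner_size_def)
next
  case True
  define j where "j = (SOME j. j \<in> smallest_incoming C act i)"
  have "j \<in> smallest_incoming C act i"
    using True unfolding j_def successful_def by (simp add: some_in_eq)
  then have j: "j \<in> incoming C act i" "card j \<le> card i"
    "\<And>k. k \<in> incoming C act i \<Longrightarrow> card k \<le> card i \<Longrightarrow> \<not> card k < card j"
    by (auto simp: smallest_incoming_def is_arg_min_def)
  show ?thesis
  proof (rule some[of j])
    show "j \<in> C - {i}" using j True by (auto simp: incoming_def successful_def)
    show "\<exists>a\<in>i. act j = Some a" using j by (auto simp: incoming_def)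
    show "partner_size n C act i = x j" using True by (simp add: partner_size_def j_def)
    show "\<not> (\<exists>a\<in>i. act k = Some a)" if "k \<in> C" "card k < card j" for k
      using j(2,3) that by (force simp: incoming_def)
  qed (use True j in auto)
qed

lemma partner_size_nonneg: "0 \<le> partner_size n C act i"
  by (cases rule: partner_size_cases[of i act]) (auto simp: relative_size_nonneg)

lemma partner_size_le: "partner_size n C act i \<le> x i"
  by (cases rule: partner_size_cases[of i act]) (auto simp: relative_size_nonneg relative_size_le_iff)

lemma mean_partner_size_nonneg: "0 \<le> mean_partner_size n C act"
  unfolding mean_partner_size_def by (intro sum_nonneg mult_nonneg_nonneg) (auto simp: partner_size_nonneg)

lemma merge_ratio_nonneg: "0 \<le> merge_ratio n C act"
  using truncated_mean_pos by (simp add: merge_ratio_def)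

text \<open>Ties affect neither which clusters accept nor the size of their partners, so the change
  of the potential is governed by the actions.\<close>

lemma size_biased_merging:
  assumes "selects_from (smallest_incoming C act) C act s"
  shows "valid_selection C s" "merging C s = successful C act"
    "\<And>i. i \<in> merging C s \<Longrightarrow> x (the (s i)) = partner_size n C act i"
proof -
  show "valid_selection C s"
    by (rule valid_selectionI[OF C _ assms]) (auto simp: smallest_incoming_def is_arg_min_def)
  have si: "i \<in> successful C act \<and> j \<in> smallest_incoming C act i" if "s i = Some j" for i j
    using selects_from_SomeD[OF assms that] by (auto simp: successful_def)
  have "s i \<noteq> None" if "i \<in> successful C act" for i
    using assms that unfolding selects_from_def successful_def
    by (metis (mono_tags, lifting) mem_Collect_eq option.distinct(1))
  then show m: "merging C s = successful C act"
    using si by (auto simp: merging_def successful_def)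
  show "x (the (s i)) = partner_size n C act i" if i: "i \<in> merging C s" for i
  proof -
    obtain j where j: "s i = Some j" using i by (auto simp: merging_def)
    have "(SOME j. j \<in> smallest_incoming C act i) \<in> smallest_incoming C act i"
      using si[OF j] by (metis someI)
    then have "card (SOME j. j \<in> smallest_incoming C act i) = card j"
      using si[OF j] smallest_incoming_card by blast
    then show ?thesis using si[OF j] j by (simp add: partner_size_def relative_size_def)
  qed
qed

text \<open>Let \<open>R\<close> be the merge ratio and \<open>m = k A R\<close> the number of
  merges. The factor \<open>k - m\<close> lowers \<open>Q\<close> by \<open>Q A R\<close>, at least
  \<open>R / 2\<close>; the logarithm falls by at least \<open>m / k = A R\<close>; the mixed terms
  add at most \<open>mean_partner_size\<close>.\<close>

lemma potential_change:
  assumes s: "selects_from (smallest_incoming C act) C act s" and c: "0 \<le> c"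
  shows "susceptibility n (merge_clusters C s) + c * ln (real (card (merge_clusters C s)))
    \<le> susceptibility n C + c * ln \<kappa> + mean_partner_size n C act - (1/2 + c * A) * merge_ratio n C act"
proof -
  note sb = size_biased_merging[OF s]
  let ?D = "merge_clusters C s" and ?m = "real (card (successful C act))"
  have cardD: "real (card ?D) = \<kappa> - ?m" using card_merge_clusters[OF C sb(1)] sb(2) by simp
  have m2: "2 * ?m \<le> \<kappa>" using merging_card[OF C sb(1)] sb(2) by simp
  have mR: "?m = A * \<kappa> * merge_ratio n C act"
    using truncated_mean_pos card_C_pos by (simp add: merge_ratio_def)
  have "(\<Sum>i\<in>?D. (w i)\<^sup>2) = (\<Sum>i\<in>C. (w i)\<^sup>2)
      + (\<Sum>i\<in>merging C s. (real (card i + card (the (s i))) / real n)\<^sup>2 - (w i)\<^sup>2 - (w (the (s i)))\<^sup>2)"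
    by (rule sum_merge_clusters[OF C sb(1), of "\<lambda>k. (real k / real n)\<^sup>2"])
  also have "(\<Sum>i\<in>merging C s. (real (card i + card (the (s i))) / real n)\<^sup>2 - (w i)\<^sup>2 - (w (the (s i)))\<^sup>2)
    = (\<Sum>i\<in>merging C s. w i * (2 * w (the (s i))))"
    by (intro sum.cong refl) (simp add: add_divide_distrib power2_eq_square algebra_simps)
  finally have sq: "(\<Sum>i\<in>?D. (w i)\<^sup>2) = (\<Sum>i\<in>C. (w i)\<^sup>2) + (\<Sum>i\<in>merging C s. w i * (2 * w (the (s i))))" .
  have "\<kappa> * (\<Sum>i\<in>merging C s. w i * (2 * w (the (s i)))) = (\<Sum>i\<in>merging C s. w i * (2 * partner_size n C act i))"
    unfolding sum_distrib_left using sb(3)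
    by (intro sum.cong refl) (simp add: relative_size_def[of n C "the (s _)"] algebra_simps flip: sb(3))
  also have "\<dots> = mean_partner_size n C act"
    unfolding mean_partner_size_def sb(2)
    by (rule sum.mono_neutral_left[OF finite_C successful_subset]) (simp add: partner_size_def)
  finally have G: "\<kappa> * (\<Sum>i\<in>merging C s. w i * (2 * w (the (s i)))) = mean_partner_size n C act" .
  have S0: "0 \<le> (\<Sum>i\<in>merging C s. w i * (2 * w (the (s i))))" by (intro sum_nonneg) simp
  have "susceptibility n ?D = (\<kappa> - ?m) * (\<Sum>i\<in>C. (w i)\<^sup>2) + (\<kappa> - ?m) * (\<Sum>i\<in>merging C s. w i * (2 * w (the (s i))))"
    unfolding susceptibility_def cardD sq by (simp add: distrib_left)
  also have "(\<kappa> - ?m) * (\<Sum>i\<in>merging C s. w i * (2 * w (the (s i)))) \<le> \<kappa> * (\<Sum>i\<in>merging C s. w i * (2 * w (the (s i))))"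
    using S0 by (intro mult_right_mono) auto
  also have "(\<kappa> - ?m) * (\<Sum>i\<in>C. (w i)\<^sup>2) = susceptibility n C - (susceptibility n C * A) * merge_ratio n C act"
    unfolding susceptibility_def by (simp add: mR algebra_simps)
  also have "\<dots> \<le> susceptibility n C - 1/2 * merge_ratio n C act"
    using mult_right_mono[OF susceptibility_truncated_mean merge_ratio_nonneg[of act]] by simp
  finally have Q: "susceptibility n ?D \<le> susceptibility n C - 1/2 * merge_ratio n C act + mean_partner_size n C act"
    unfolding G by simp
  have pos: "0 < \<kappa> - ?m" "0 < 1 - ?m / \<kappa>" using m2 card_C_pos by (auto simp: field_simps)
  have "ln (real (card ?D)) = ln (\<kappa> * (1 - ?m / \<kappa>))" unfolding cardD using card_C_pos by (simp add: right_diff_distrib)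
  also have "\<dots> = ln \<kappa> + ln (1 - ?m / \<kappa>)" using card_C_pos pos by (simp add: ln_mult)
  also have "ln (1 - ?m / \<kappa>) \<le> - (?m / \<kappa>)" using ln_add_one_self_le_self2[of "- (?m / \<kappa>)"] pos by simp
  also have "?m / \<kappa> = A * merge_ratio n C act" using card_C_pos mR by simp
  finally have "c * ln (real (card ?D)) \<le> c * (ln \<kappa> + - (A * merge_ratio n C act))" using c by (intro mult_left_mono) auto
  then show ?thesis using Q by (simp add: algebra_simps)
qed

section \<open>Number of merges in a round\<close>

lemma weight_bounds: "i \<in> C \<Longrightarrow> 0 \<le> w i / 2 \<and> w i / 2 \<le> 1/2"
  using card_mono[OF _ configs_subset[OF C]] n by (fastforce simp: field_simps)

lemma prob_hits:
  assumes i: "i \<in> C" and L: "L \<subseteq> C" and K: "K \<subseteq> C" and LK: "L \<inter> K = {}"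
  shows "measure_pmf.prob (actions_pmf n C) {act. (\<forall>k\<in>K. \<exists>a\<in>i. act k = Some a) \<and> (\<forall>k\<in>L. \<not> (\<exists>a\<in>i. act k = Some a))}
    = (w i / 2) ^ card K * (1 - w i / 2) ^ card L"
proof -
  let ?H = "{v. \<exists>a\<in>i. v = Some a}"
  let ?B = "\<lambda>k. if k \<in> K then ?H else - ?H"
  have hit: "measure_pmf.prob (request_pmf n) ?H = w i / 2"
    using prob_request_pmf_hit[OF n configs_subset[OF C i]] by simp
  then have miss: "measure_pmf.prob (request_pmf n) (- ?H) = 1 - w i / 2"
    using measure_pmf.prob_compl[of ?H "request_pmf n"] by (simp add: Compl_eq_Diff_UNIV)
  have fin: "finite K" "finite L" using L K finite_C by (auto intro: finite_subset)
  have "{act. (\<forall>k\<in>K. \<exists>a\<in>i. act k = Some a) \<and> (\<forall>k\<in>L. \<not> (\<exists>a\<in>i. act k = Some a))} = {act. \<forall>k\<in>K \<union> L. act k \<in> ?B k}"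
    using LK by auto
  then have "measure_pmf.prob (actions_pmf n C) {act. (\<forall>k\<in>K. \<exists>a\<in>i. act k = Some a) \<and> (\<forall>k\<in>L. \<not> (\<exists>a\<in>i. act k = Some a))}
    = (\<Prod>k\<in>K \<union> L. measure_pmf.prob (request_pmf n) (?B k))"
    unfolding actions_pmf_eq using Pi_pmf_prob_subset[OF finite_C, of "K \<union> L" None "\<lambda>_. request_pmf n" ?B] L K by simp
  also have "\<dots> = (\<Prod>k\<in>K. w i / 2) * (\<Prod>k\<in>L. 1 - w i / 2)"
  proof -
    have "(\<Prod>k\<in>L. measure_pmf.prob (request_pmf n) (?B k)) = (\<Prod>k\<in>L. 1 - w i / 2)"
      using LK by (intro prod.cong refl) (auto simp: miss)
    moreover have "(\<Prod>k\<in>K. measure_pmf.prob (request_pmf n) (?B k)) = (\<Prod>k\<in>K. w i / 2)"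
      by (intro prod.cong refl) (auto simp: hit)
    ultimately show ?thesis using LK fin by (subst prod.union_disjoint) auto
  qed
  finally show ?thesis by simp
qed

lemma prob_successful:
  assumes i: "i \<in> C"
  shows "measure_pmf.prob (actions_pmf n C) {act. i \<in> successful C act}
    = (1 - (1 - w i / 2) ^ card {j \<in> C - {i}. card j \<le> card i}) / 2"
proof -
  let ?P = "actions_pmf n C"
  let ?L = "{j \<in> C - {i}. card j \<le> card i}"
  let ?H = "{v. \<exists>a\<in>i. v = Some a}"
  let ?B = "\<lambda>k. if k = i then {None} else - ?H"
  have hit: "measure_pmf.prob (request_pmf n) ?H = w i / 2"
    using prob_request_pmf_hit[OF n configs_subset[OF C i]] by simp
  then have miss: "measure_pmf.prob (request_pmf n) (- ?H) = 1 - w i / 2"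
    using measure_pmf.prob_compl[of ?H "request_pmf n"] by (simp add: Compl_eq_Diff_UNIV)
  have none: "measure_pmf.prob (request_pmf n) {None} = 1/2"
    using prob_request_pmf[OF n, of "{None}"] by simp
  have p1: "measure_pmf.prob ?P {act. act i = None} = 1/2"
    using Pi_pmf_prob_subset[OF finite_C, of "{i}" None "\<lambda>_. request_pmf n" "\<lambda>_. {None}"] i none
    unfolding actions_pmf_eq by simp
  have "{act. act i = None \<and> (\<forall>j\<in>?L. \<not> (\<exists>a\<in>i. act j = Some a))} = {act. \<forall>k\<in>insert i ?L. act k \<in> ?B k}"
    by auto
  then have "measure_pmf.prob ?P {act. act i = None \<and> (\<forall>j\<in>?L. \<not> (\<exists>a\<in>i. act j = Some a))}
      = (\<Prod>k\<in>insert i ?L. measure_pmf.prob (request_pmf n) (?B k))"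
    using Pi_pmf_prob_subset[OF finite_C, of "insert i ?L" None "\<lambda>_. request_pmf n" ?B] i
    unfolding actions_pmf_eq by auto
  also have "\<dots> = 1/2 * (\<Prod>k\<in>?L. 1 - w i / 2)"
    using finite_C by (subst prod.insert) (auto intro!: prod.cong simp: none miss)
  finally have p2: "measure_pmf.prob ?P {act. act i = None \<and> (\<forall>j\<in>?L. \<not> (\<exists>a\<in>i. act j = Some a))}
    = 1/2 * (1 - w i / 2) ^ card ?L" by simp
  have "{act. i \<in> successful C act} = {act. act i = None} - {act. act i = None \<and> (\<forall>j\<in>?L. \<not> (\<exists>a\<in>i. act j = Some a))}"
    using i by (auto simp: successful_iff)
  then have "measure_pmf.prob ?P {act. i \<in> successful C act}
      = measure_pmf.prob ?P {act. act i = None} - measure_pmf.prob ?P {act. act i = None \<and> (\<forall>j\<in>?L. \<not> (\<exists>a\<in>i. act j = Some a))}"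
    by (simp only:) (subst measure_pmf.finite_measure_Diff, auto)
  then show ?thesis unfolding p1 p2 by (simp add: field_simps)
qed

lemma expectation_card_successful:
  "measure_pmf.expectation (actions_pmf n C) (\<lambda>act. real (card (successful C act)))
    = (\<Sum>i\<in>C. measure_pmf.prob (actions_pmf n C) {act. i \<in> successful C act})"
proof -
  have "real (card (successful C act)) = (\<Sum>i\<in>C. indicator {act. i \<in> successful C act} act)" for act
  proof -
    have "real (card (successful C act)) = (\<Sum>i\<in>successful C act. 1)" by simp
    also have "\<dots> = (\<Sum>i\<in>C. indicator {act. i \<in> successful C act} act)"
      using successful_subset finite_C by (intro sum.mono_neutral_cong_left) (auto simp: indicator_def)
    finally show ?thesis .
  qed
  then have "measure_pmf.expectation (actions_pmf n C) (\<lambda>act. real (card (successful C act)))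
      = measure_pmf.expectation (actions_pmf n C) (\<lambda>act. \<Sum>i\<in>C. indicator {act. i \<in> successful C act} act)" by presburger
  also have "\<dots> = (\<Sum>i\<in>C. measure_pmf.prob (actions_pmf n C) {act. i \<in> successful C act})"
    using finite_set_pmf_actions[OF n C]
    by (subst Bochner_Integration.integral_sum) (auto intro!: integrable_measure_pmf_finite)
  finally show ?thesis .
qed

text \<open>\<open>i\<close> can accept only from the \<open>?n i\<close> other clusters not larger
  than itself, and succeeds with probability at least \<open>?n i * f i / (8 k)\<close>. In each
  pair the larger cluster is such a receiver and has the larger \<open>f\<close>, so the sum of
  \<open>?n i * f i\<close> is at least half of \<open>(k - 1) k A\<close>: ignoring larger issuers
  loses only a constant factor.\<close>

lemma merge_ratio_expectation_lower:
  assumes k: "2 \<le> card C"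
  shows "1/32 \<le> measure_pmf.expectation (actions_pmf n C) (merge_ratio n C)"
proof -
  let ?n = "\<lambda>i. real (card {j \<in> C - {i}. card j \<le> card i})"
  have each: "?n i * f i / (8 * \<kappa>) \<le> measure_pmf.prob (actions_pmf n C) {act. i \<in> successful C act}" if i: "i \<in> C" for i
  proof -
    let ?z = "w i / 2 * ?n i"
    have wb: "0 \<le> w i / 2" "w i / 2 \<le> 1/2" using weight_bounds[OF i] by auto
    have ncard: "?n i \<le> \<kappa>" using card_mono[OF finite_C, of "{j \<in> C - {i}. card j \<le> card i}"] by auto
    have "(1 - w i / 2) ^ card {j \<in> C - {i}. card j \<le> card i} \<le> exp (- (w i / 2)) ^ card {j \<in> C - {i}. card j \<le> card i}"
      using wb exp_ge_add_one_self[of "- (w i / 2)"] by (intro power_mono) auto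
    also have "\<dots> = exp (- ?z)" by (simp add: exp_of_nat_mult[symmetric] mult.commute)
    finally have 1: "1 - exp (- ?z) \<le> 1 - (1 - w i / 2) ^ card {j \<in> C - {i}. card j \<le> card i}" by simp
    have 2: "min 1 ?z / 2 \<le> 1 - exp (- ?z)" using wb by (intro one_minus_exp_ge) auto
    \<comment> \<open>A factor \<open>\<theta> \<le> 1\<close> passes through the truncation:
      \<open>\<theta> min 1 x \<le> min 1 (\<theta> x)\<close>.\<close>
    define \<theta> where "\<theta> = ?n i / (2 * \<kappa>)"
    have \<theta>: "0 \<le> \<theta>" "\<theta> \<le> 1" using ncard card_C_pos by (auto simp: \<theta>_def field_simps)
    have "?z = \<theta> * x i" using card_C_pos by (simp add: \<theta>_def relative_size_def mult_ac)
    moreover have "\<theta> * f i \<le> 1" "\<theta> * f i \<le> \<theta> * x i"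
      using \<theta> relative_size_nonneg[of i] by (auto intro: mult_le_one mult_left_mono)
    ultimately have "\<theta> * f i \<le> min 1 ?z" by simp
    moreover have "a / 4 \<le> p / 2" if "a \<le> m" "m / 2 \<le> e" "e \<le> p" for a m e p :: real using that by simp
    ultimately have "\<theta> * f i / 4 \<le> (1 - (1 - w i / 2) ^ card {j \<in> C - {i}. card j \<le> card i}) / 2" using 1 2 by blast
    then show ?thesis unfolding prob_successful[OF i] by (simp add: \<theta>_def)
  qed
  have "(\<kappa> - 1) * (\<kappa> * A) \<le> 2 * (\<Sum>i\<in>C. ?n i * f i)"
  proof -
    have fn: "f j \<le> f i" if "card j \<le> card i" for i j using relative_size_le_iff[of j i] that by auto
    have sym: "(\<Sum>i\<in>C. \<Sum>j\<in>C. if j \<noteq> i then g i j else 0) = (\<Sum>i\<in>C. \<Sum>j\<in>C. if j \<noteq> i then g j i else 0)"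
      for g :: "cluster \<Rightarrow> cluster \<Rightarrow> real"
      by (subst sum.swap) (intro sum.cong refl, auto)
    have E: "(\<Sum>i\<in>C. ?n i * f i) = (\<Sum>i\<in>C. \<Sum>j\<in>C. if j \<noteq> i then (if card j \<le> card i then f i else 0) else 0)"
    proof (intro sum.cong refl)
      fix i
      have "?n i * f i = (\<Sum>j\<in>{j \<in> C - {i}. card j \<le> card i}. f i)" by simp
      also have "\<dots> = (\<Sum>j\<in>C. if j \<noteq> i then (if card j \<le> card i then f i else 0) else 0)"
        using finite_C by (intro sum.mono_neutral_cong_left) auto
      finally show "?n i * f i = (\<Sum>j\<in>C. if j \<noteq> i then (if card j \<le> card i then f i else 0) else 0)" .
    qed
    have F: "(\<Sum>i\<in>C. \<Sum>j\<in>C. if j \<noteq> i then f i else 0) = (\<kappa> - 1) * (\<kappa> * A)"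
    proof -
      have "(\<Sum>j\<in>C. if j \<noteq> i then f i else 0) = (\<kappa> - 1) * f i" if i: "i \<in> C" for i
      proof -
        have "(\<Sum>j\<in>C. if j \<noteq> i then f i else 0) = (\<Sum>j\<in>C - {i}. f i)"
          using finite_C by (intro sum.mono_neutral_cong_right) auto
        then show ?thesis using i k finite_C by (simp add: card_Diff_singleton of_nat_diff)
      qed
      then show ?thesis by (simp add: sum_distrib_left[symmetric] truncated_mean_sum)
    qed
    \<comment> \<open>Each pair is seen from both sides, so that the larger of the two values, which
      occurs, can be compared with their mean.\<close>
    have "2 * (\<Sum>i\<in>C. ?n i * f i) = (\<Sum>i\<in>C. \<Sum>j\<in>C. if j \<noteq> i then (if card j \<le> card i then f i else 0) else 0)
        + (\<Sum>i\<in>C. \<Sum>j\<in>C. if j \<noteq> i then (if card i \<le> card j then f j else 0) else 0)"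
      unfolding E using sym[of "\<lambda>i j. if card j \<le> card i then f i else 0"] by simp
    also have "\<dots> = (\<Sum>i\<in>C. \<Sum>j\<in>C. if j \<noteq> i then (if card j \<le> card i then f i else 0) + (if card i \<le> card j then f j else 0) else 0)"
      unfolding sum.distrib[symmetric] by (intro sum.cong refl) auto
    also have "\<dots> \<ge> (\<Sum>i\<in>C. \<Sum>j\<in>C. if j \<noteq> i then (f i + f j) / 2 else 0)"
    proof (intro sum_mono)
      fix i j
      have 0: "0 \<le> f i" "0 \<le> f j" using relative_size_nonneg by auto
      show "(if j \<noteq> i then (f i + f j) / 2 else 0)
          \<le> (if j \<noteq> i then (if card j \<le> card i then f i else 0) + (if card i \<le> card j then f j else 0) else 0)"
      proof -
        have gen: "(if P then (a + b) / 2 else 0) \<le> (if P then (if Q then a else 0) + (if R then b else 0) else 0)"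
          if "0 \<le> a" "0 \<le> b" "Q \<Longrightarrow> b \<le> a" "R \<Longrightarrow> a \<le> b" "Q \<or> R" for P Q R and a b :: real
          using that by auto
        show ?thesis by (rule gen[OF 0 fn fn linear])
      qed
    qed
    also have "(\<Sum>i\<in>C. \<Sum>j\<in>C. if j \<noteq> i then (f i + f j) / 2 else 0)
        = ((\<Sum>i\<in>C. \<Sum>j\<in>C. if j \<noteq> i then f i else 0) + (\<Sum>i\<in>C. \<Sum>j\<in>C. if j \<noteq> i then f j else 0)) / 2"
      unfolding sum.distrib[symmetric] sum_divide_distrib by (intro sum.cong refl) auto
    also have "\<dots> = (\<kappa> - 1) * (\<kappa> * A)"
      using sym[of "\<lambda>i j. f i"] F by simp
    finally show ?thesis .
  qed
  moreover have "\<kappa> / 2 * (\<kappa> * A) \<le> (\<kappa> - 1) * (\<kappa> * A)"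
    using k truncated_mean_ge by (intro mult_right_mono) auto
  ultimately have 3: "\<kappa> / 4 * (\<kappa> * A) \<le> (\<Sum>i\<in>C. ?n i * f i)" by linarith
  have "\<kappa> * A / 32 = \<kappa> / 4 * (\<kappa> * A) / (8 * \<kappa>)" using card_C_pos by simp
  also have "\<dots> \<le> (\<Sum>i\<in>C. ?n i * f i) / (8 * \<kappa>)" using 3 card_C_pos by (intro divide_right_mono) auto
  also have "\<dots> = (\<Sum>i\<in>C. ?n i * f i / (8 * \<kappa>))" by (simp add: sum_divide_distrib)
  also have "\<dots> \<le> measure_pmf.expectation (actions_pmf n C) (\<lambda>act. real (card (successful C act)))"
    unfolding expectation_card_successful by (rule sum_mono[OF each])
  finally have "\<kappa> * A / 32 \<le> measure_pmf.expectation (actions_pmf n C) (\<lambda>act. real (card (successful C act)))" .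
  then have "(\<kappa> * A / 32) / (A * \<kappa>) \<le> measure_pmf.expectation (actions_pmf n C) (\<lambda>act. real (card (successful C act))) / (A * \<kappa>)"
    using card_C_pos truncated_mean_pos by (intro divide_right_mono) auto
  then show ?thesis using card_C_pos truncated_mean_pos unfolding merge_ratio_def by simp
qed

lemma prob_successful_le:
  assumes i: "i \<in> C"
  shows "measure_pmf.prob (actions_pmf n C) {act. i \<in> successful C act} \<le> f i"
proof -
  let ?m = "card {j \<in> C - {i}. card j \<le> card i}"
  have wb: "0 \<le> w i / 2" "w i / 2 \<le> 1/2" using weight_bounds[OF i] by auto
  have "1 - real ?m * (w i / 2) \<le> (1 - w i / 2) ^ ?m"
    using Bernoulli_inequality[of "- (w i / 2)" ?m] wb by simp
  moreover have "real ?m * (w i / 2) \<le> \<kappa> * (w i / 2)"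
    using card_mono[OF finite_C, of "{j \<in> C - {i}. card j \<le> card i}"] wb by (intro mult_right_mono) auto
  moreover have "\<kappa> * (w i / 2) = x i / 2" by (simp add: relative_size_def)
  ultimately have "1 - (1 - w i / 2) ^ ?m \<le> 2 * x i"
    using relative_size_nonneg[of i] by linarith
  then have "measure_pmf.prob (actions_pmf n C) {act. i \<in> successful C act} \<le> x i"
    unfolding prob_successful[OF i] by simp
  then show ?thesis by simp
qed

text \<open>Two clusters can succeed only through requests of two different issuers, since a request
  names one agent; these are independent, and a union over ordered pairs of issuers gives the
  product. If one factor is 1, the bound for the other cluster is enough.\<close>

lemma prob_successful_pair_le:
  assumes i: "i \<in> C" and j: "j \<in> C" and ij: "i \<noteq> j"
  shows "measure_pmf.prob (actions_pmf n C) {act. i \<in> successful C act \<and> j \<in> successful C act} \<le> f i * f j"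
proof -
  let ?P = "actions_pmf n C" and ?E = "{act. i \<in> successful C act \<and> j \<in> successful C act}"
  have le: "measure_pmf.prob ?P ?E \<le> f i" "measure_pmf.prob ?P ?E \<le> f j"
    using measure_pmf.finite_measure_mono[of ?E "{act. i \<in> successful C act}" ?P] prob_successful_le[OF i]
      measure_pmf.finite_measure_mono[of ?E "{act. j \<in> successful C act}" ?P] prob_successful_le[OF j] by fastforce+
  consider "1 \<le> x i" | "1 \<le> x j" | "x i < 1" "x j < 1" by linarith
  then show ?thesis
  proof cases
    case 3
    let ?hit = "\<lambda>l k. {act :: actions. \<exists>a\<in>l. act k = Some a}"
    let ?S = "{(k, l) \<in> C \<times> C. k \<noteq> l}"
    have finS: "finite ?S" using finite_C by (auto intro: finite_subset[of _ "C \<times> C"])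
    have sub: "?E \<subseteq> (\<Union>(k, l)\<in>?S. ?hit i k \<inter> ?hit j l)"
    proof
      fix act assume "act \<in> ?E"
      then obtain k l a b where kl: "k \<in> C" "l \<in> C" "a \<in> i" "act k = Some a" "b \<in> j" "act l = Some b"
        by (auto simp: successful_iff)
      moreover have "k \<noteq> l"
      proof
        assume "k = l"
        then have "a = b" using kl by simp
        then show False using configs_disjoint[OF C i j, of a] kl ij by simp
      qed
      ultimately show "act \<in> (\<Union>(k, l)\<in>?S. ?hit i k \<inter> ?hit j l)" by blast
    qed
    have pair: "measure_pmf.prob ?P (?hit i k \<inter> ?hit j l) = w i / 2 * (w j / 2)" if "(k, l) \<in> ?S" for k l
    proof -
      let ?B = "\<lambda>z. if z = k then {v. \<exists>a\<in>i. v = Some a} else {v. \<exists>a\<in>j. v = Some a}"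
      have "?hit i k \<inter> ?hit j l = {act. \<forall>z\<in>{k, l}. act z \<in> ?B z}" using that by auto
      then have "measure_pmf.prob ?P (?hit i k \<inter> ?hit j l) = (\<Prod>z\<in>{k, l}. measure_pmf.prob (request_pmf n) (?B z))"
        using Pi_pmf_prob_subset[OF finite_C, of "{k, l}" None "\<lambda>_. request_pmf n" ?B] that unfolding actions_pmf_eq by simp
      also have "\<dots> = measure_pmf.prob (request_pmf n) {v. \<exists>a\<in>i. v = Some a} * measure_pmf.prob (request_pmf n) {v. \<exists>a\<in>j. v = Some a}"
        using that by (subst prod.insert) auto
      finally show ?thesis
        using prob_request_pmf_hit[OF n configs_subset[OF C i]] prob_request_pmf_hit[OF n configs_subset[OF C j]] by simp
    qed
    have "measure_pmf.prob ?P ?E \<le> measure_pmf.prob ?P (\<Union>(k, l)\<in>?S. ?hit i k \<inter> ?hit j l)"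
      using sub by (intro measure_pmf.finite_measure_mono) auto
    also have "\<dots> \<le> (\<Sum>p\<in>?S. measure_pmf.prob ?P (case p of (k, l) \<Rightarrow> ?hit i k \<inter> ?hit j l))"
      by (rule measure_UNION_le[OF finS]) auto
    also have "\<dots> = (\<Sum>p\<in>?S. w i / 2 * (w j / 2))"
      using pair by (intro sum.cong refl) auto
    also have "\<dots> \<le> \<kappa> * \<kappa> * (w i / 2 * (w j / 2))"
    proof -
      have "card ?S \<le> card (C \<times> C)" using finite_C by (intro card_mono) auto
      then have "real (card ?S) \<le> \<kappa> * \<kappa>" by (simp add: card_cartesian_product flip: of_nat_mult)
      then show ?thesis by (simp only: sum_constant) (intro mult_right_mono, auto)
    qed
    also have "\<dots> = x i * x j / 4" by (simp add: relative_size_def mult_ac)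
    also have "\<dots> \<le> x i * x j" using relative_size_nonneg by simp
    also have "\<dots> = f i * f j" using 3 by simp
    finally show ?thesis .
  qed (use le in auto)
qed

text \<open>The pair bounds sum to at most \<open>(k A)^2\<close>, and the diagonal contributes at
  most \<open>k A\<close>, which is at most \<open>(k A)^2\<close> because
  \<open>k A \<ge> 1\<close>.\<close>

lemma merge_ratio_second_moment:
  "measure_pmf.expectation (actions_pmf n C) (\<lambda>act. (merge_ratio n C act)\<^sup>2) \<le> 2"
proof -
  let ?P = "actions_pmf n C"
  let ?E = "\<lambda>i j. {act. i \<in> successful C act \<and> j \<in> successful C act}"
  have sq: "(real (card (successful C act)))\<^sup>2 = (\<Sum>i\<in>C. \<Sum>j\<in>C. indicator (?E i j) act)" for act
  proof -
    have 1: "real (card (successful C act)) = (\<Sum>i\<in>C. of_bool (i \<in> successful C act))"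
    proof -
      have "real (card (successful C act)) = (\<Sum>i\<in>successful C act. 1)" by simp
      also have "\<dots> = (\<Sum>i\<in>C. of_bool (i \<in> successful C act))"
        using successful_subset finite_C by (intro sum.mono_neutral_cong_left) auto
      finally show ?thesis .
    qed
    show ?thesis unfolding 1 power2_eq_square sum_product
      by (intro sum.cong refl) (auto simp: indicator_def)
  qed
  have fin: "finite (set_pmf ?P)" by (rule finite_set_pmf_actions[OF n C])
  have f0: "0 \<le> f i" for i using relative_size_nonneg by simp
  have "measure_pmf.expectation ?P (\<lambda>act. (real (card (successful C act)))\<^sup>2) = (\<Sum>i\<in>C. \<Sum>j\<in>C. measure_pmf.prob ?P (?E i j))"
    unfolding sq using fin
    by (simp add: Bochner_Integration.integral_sum integrable_measure_pmf_finite)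
  also have "\<dots> \<le> (\<Sum>i\<in>C. \<Sum>j\<in>C. f i * f j + (if j = i then f i else 0))"
  proof (intro sum_mono)
    fix i j assume i: "i \<in> C" and j: "j \<in> C"
    show "measure_pmf.prob ?P (?E i j) \<le> f i * f j + (if j = i then f i else 0)"
    proof (cases "j = i")
      case True
      have "measure_pmf.prob ?P {act. i \<in> successful C act} \<le> f i" by (rule prob_successful_le[OF i])
      then have "measure_pmf.prob ?P {act. i \<in> successful C act} \<le> f i * f i + f i"
        by (rule add_increasing[OF mult_nonneg_nonneg[OF f0 f0]])
      then show ?thesis using True by simp
    next
      case False
      then show ?thesis using prob_successful_pair_le[OF i j] by auto
    qed
  qed
  also have "\<dots> = (\<Sum>i\<in>C. f i) * (\<Sum>j\<in>C. f j) + (\<Sum>i\<in>C. f i)"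
    unfolding sum_product sum.distrib using finite_C by simp
  also have "\<dots> \<le> 2 * (\<kappa> * A)\<^sup>2"
  proof -
    have "z * z + z \<le> 2 * z\<^sup>2" if "1 \<le> z" for z :: real
      using mult_right_mono[OF that, of z] that by (simp add: power2_eq_square)
    from this[OF truncated_mean_ge] show ?thesis unfolding truncated_mean_sum .
  qed
  finally have "measure_pmf.expectation ?P (\<lambda>act. (real (card (successful C act)))\<^sup>2) / (\<kappa> * A)\<^sup>2 \<le> 2 * (\<kappa> * A)\<^sup>2 / (\<kappa> * A)\<^sup>2"
    by (intro divide_right_mono) auto
  then show ?thesis using card_C_pos truncated_mean_pos
    unfolding merge_ratio_def by (simp add: power_divide mult.commute)
qed

text \<open>Markov's inequality: for \<open>sqrt A \<le> 1/2\<close> it is applied to the truncated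
  sizes at \<open>v = 2 sqrt A\<close>, otherwise to the sizes themselves at
  \<open>v = 2\<close>.\<close>

lemma size_threshold:
  obtains v where "0 < v" "v \<le> 2" "v \<le> 4 * sqrt A"
    "real (card {j \<in> C. v < x j}) \<le> \<kappa> * sqrt A" "\<kappa> / 2 \<le> real (card {j \<in> C. x j \<le> v})"
proof -
  let ?a = "sqrt A"
  have a: "0 < ?a" "?a * ?a = A" "?a \<le> 1" using truncated_mean_pos truncated_mean_le_1 by auto
  have compl: "real (card {j \<in> C. x j \<le> v}) = \<kappa> - real (card {j \<in> C. v < x j})" for v
  proof -
    have "{j \<in> C. x j \<le> v} = C - {j \<in> C. v < x j}" by auto
    then have "card {j \<in> C. x j \<le> v} = card C - card {j \<in> C. v < x j}"
      using finite_C by (simp add: card_Diff_subset)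
    moreover have "card {j \<in> C. v < x j} \<le> card C" using finite_C by (intro card_mono) auto
    ultimately show ?thesis by simp
  qed
  have markov: "v * real (card {j \<in> C. v < x j}) \<le> (\<Sum>j\<in>C. g j)"
    if "\<And>j. j \<in> C \<Longrightarrow> 0 \<le> g j" "\<And>j. j \<in> C \<Longrightarrow> v < x j \<Longrightarrow> v \<le> g j" for v and g :: "cluster \<Rightarrow> real"
  proof -
    have "v * real (card {j \<in> C. v < x j}) = (\<Sum>j\<in>{j \<in> C. v < x j}. v)" by simp
    also have "\<dots> \<le> (\<Sum>j\<in>{j \<in> C. v < x j}. g j)" using that by (intro sum_mono) auto
    also have "\<dots> \<le> (\<Sum>j\<in>C. g j)" using that finite_C by (intro sum_mono2) auto
    finally show ?thesis .
  qed
  show ?thesis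
  proof (cases "?a \<le> 1/2")
    case True
    have "2 * ?a * real (card {j \<in> C. 2 * ?a < x j}) \<le> (\<Sum>j\<in>C. f j)"
      using True relative_size_nonneg by (intro markov) auto
    also have "\<dots> = 2 * ?a * (\<kappa> * ?a / 2)" using a(2) by (simp add: truncated_mean_sum)
    finally have "real (card {j \<in> C. 2 * ?a < x j}) \<le> \<kappa> * ?a / 2" using a(1) by simp
    moreover have "\<kappa> * ?a / 2 \<le> \<kappa> / 2" using a card_C_pos by simp
    moreover have "0 \<le> \<kappa> * ?a" using a card_C_pos by simp
    ultimately show ?thesis using a True that[of "2 * ?a"] compl[of "2 * ?a"] by simp
  next
    case False
    have "2 * real (card {j \<in> C. 2 < x j}) \<le> (\<Sum>j\<in>C. x j)"
      using relative_size_nonneg by (intro markov) auto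
    then have h: "real (card {j \<in> C. 2 < x j}) \<le> \<kappa> / 2" by (simp add: sum_relative_size)
    moreover have "\<kappa> * (1/2) \<le> \<kappa> * ?a" using False by (intro mult_left_mono) auto
    ultimately show ?thesis using False that[of 2] compl[of 2] by simp
  qed
qed

lemma miss_prob_le:
  assumes i: "i \<in> C" and m: "\<kappa> / 2 \<le> real m"
  shows "(1 - w i / 2) ^ m \<le> exp (- (x i / 4))"
proof -
  have wb: "0 \<le> w i / 2" "w i / 2 \<le> 1/2" using weight_bounds[OF i] by auto
  have "(1 - w i / 2) ^ m \<le> exp (- (w i / 2)) ^ m"
    using wb exp_ge_add_one_self[of "- (w i / 2)"] by (intro power_mono) auto
  also have "\<dots> = exp (- (w i / 2 * real m))" by (simp add: exp_of_nat_mult[symmetric] mult.commute)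
  also have "\<dots> \<le> exp (- (w i / 2 * (\<kappa> / 2)))" using mult_left_mono[OF m wb(1)] by simp
  also have "w i / 2 * (\<kappa> / 2) = x i / 4" by (simp add: relative_size_def mult_ac)
  finally show ?thesis .
qed

text \<open>A partner above \<open>v\<close> needs a request from one of at most
  \<open>k sqrt A\<close> large clusters while at least \<open>k / 2\<close> small ones miss
  \<open>i\<close>, which has probability at most \<open>exp (- x i / 4)\<close>. This factor
  outweighs the bound \<open>x i\<close> on the partner, since
  \<open>x^2 exp (- x / 4) / 2 \<le> 16\<close>. With \<open>v \<le> 4 sqrt A\<close> the constant
  is \<open>4 + 16\<close>.\<close>

lemma expectation_partner_size:
  assumes i: "i \<in> C"
  shows "measure_pmf.expectation (actions_pmf n C) (\<lambda>act. partner_size n C act i) \<le> 20 * sqrt A"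
proof -
  let ?P = "actions_pmf n C"
  obtain v where v: "0 < v" "v \<le> 2" "v \<le> 4 * sqrt A"
    "real (card {j \<in> C. v < x j}) \<le> \<kappa> * sqrt A" "\<kappa> / 2 \<le> real (card {j \<in> C. x j \<le> v})"
    by (rule size_threshold)
  define L H where "L = {j \<in> C. x j \<le> v}" and "H = {j \<in> C. v < x j}"
  let ?E = "\<lambda>j. {act :: actions. (\<forall>k\<in>{j}. \<exists>a\<in>i. act k = Some a) \<and> (\<forall>k\<in>L. \<not> (\<exists>a\<in>i. act k = Some a))}"
  have finH: "finite H" using finite_C by (simp add: H_def)
  have fin: "finite (set_pmf ?P)" by (rule finite_set_pmf_actions[OF n C])
  have pE: "measure_pmf.prob ?P (?E j) \<le> w i / 2 * exp (- (x i / 4))" if j: "j \<in> H" for j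
  proof -
    have "measure_pmf.prob ?P (?E j) = (w i / 2) ^ card {j} * (1 - w i / 2) ^ card L"
      using j by (intro prob_hits[OF i]) (auto simp: L_def H_def)
    also have "\<dots> \<le> w i / 2 * exp (- (x i / 4))"
      using miss_prob_le[OF i v(5)] by (simp add: L_def divide_right_mono mult_left_mono)
    finally show ?thesis .
  qed
  have pt: "partner_size n C act i \<le> v + x i * (\<Sum>j\<in>H. indicator (?E j) act)" for act
  proof (cases rule: partner_size_cases[of i act])
    case none
    then show ?thesis using v(1) relative_size_nonneg[of i] by (auto intro!: add_nonneg_nonneg mult_nonneg_nonneg sum_nonneg)
  next
    case (some j)
    show ?thesis
    proof (cases "x j \<le> v")
      case True
      then show ?thesis using some(5) relative_size_nonneg[of i] by (auto intro!: add_increasing2 mult_nonneg_nonneg sum_nonneg)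
    next
      case False
      then have jH: "j \<in> H" using some(2) by (auto simp: H_def)
      have "\<not> (\<exists>a\<in>i. act k = Some a)" if "k \<in> L" for k
        using that False relative_size_le_iff[of j k] by (intro some(6)) (auto simp: L_def)
      then have "act \<in> ?E j" using some(4) by blast
      then have "1 \<le> (\<Sum>j\<in>H. indicator (?E j) act :: real)"
        using member_le_sum[OF jH, of "\<lambda>j. indicator (?E j) act :: real"] finH by simp
      then have "x i * 1 \<le> x i * (\<Sum>j\<in>H. indicator (?E j) act)"
        using relative_size_nonneg[of i] by (intro mult_left_mono) auto
      then show ?thesis using partner_size_le[of act i] v(1) by linarith
    qed
  qed
  have "measure_pmf.expectation ?P (\<lambda>act. partner_size n C act i)
      \<le> measure_pmf.expectation ?P (\<lambda>act. v + x i * (\<Sum>j\<in>H. indicator (?E j) act))"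
    using fin pt by (intro integral_mono integrable_measure_pmf_finite)
  also have "\<dots> = v + x i * (\<Sum>j\<in>H. measure_pmf.prob ?P (?E j))"
    using fin by (simp add: Bochner_Integration.integral_sum integrable_measure_pmf_finite)
  also have "(\<Sum>j\<in>H. measure_pmf.prob ?P (?E j)) \<le> (\<Sum>j\<in>H. w i / 2 * exp (- (x i / 4)))"
    by (rule sum_mono) (rule pE)
  also have "(\<Sum>j\<in>H. w i / 2 * exp (- (x i / 4))) = real (card H) * (w i / 2 * exp (- (x i / 4)))" by simp
  also have "\<dots> \<le> \<kappa> * sqrt A * (w i / 2 * exp (- (x i / 4)))"
    using v(4) weight_bounds[OF i] by (intro mult_right_mono) (auto simp: H_def)
  also have "\<dots> = sqrt A * (x i / 2 * exp (- (x i / 4)))" by (simp add: relative_size_def)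
  finally have 1: "measure_pmf.expectation ?P (\<lambda>act. partner_size n C act i) \<le> v + x i * (sqrt A * (x i / 2 * exp (- (x i / 4))))"
    using relative_size_nonneg[of i] by (auto intro: mult_left_mono)
  have "x i * x i / 2 * exp (- (x i / 4)) \<le> 16"
  proof -
    have "1 + x i / 4 + (x i / 4)\<^sup>2 / 2 \<le> exp (x i / 4)"
      using relative_size_nonneg[of i] by (intro exp_lower_Taylor_quadratic) auto
    then have "x i * x i / 32 \<le> exp (x i / 4)" using relative_size_nonneg[of i] by (simp add: power2_eq_square)
    then show ?thesis by (simp add: exp_minus field_simps)
  qed
  then have "sqrt A * (x i * x i / 2 * exp (- (x i / 4))) \<le> sqrt A * 16"
    using truncated_mean_pos by (intro mult_left_mono) auto
  then show ?thesis using 1 v(3) by (simp add: algebra_simps)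
qed

text \<open>The exponent 1/4 matches the probability \<open>exp (- x i / 4)\<close> that all small
  clusters miss \<open>i\<close>: the rare value \<open>exp (x i / 4)\<close> then contributes at
  most 1, and otherwise the partner has relative size at most 2.\<close>

lemma exp_partner_size:
  assumes i: "i \<in> C"
  shows "measure_pmf.expectation (actions_pmf n C) (\<lambda>act. exp (partner_size n C act i / 4)) \<le> 3"
proof -
  let ?P = "actions_pmf n C"
  obtain v where v: "0 < v" "v \<le> 2" "\<kappa> / 2 \<le> real (card {j \<in> C. x j \<le> v})"
    by (rule size_threshold)
  define L where "L = {j \<in> C. x j \<le> v}"
  let ?E = "{act :: actions. (\<forall>k\<in>{}. \<exists>a\<in>i. act k = Some a) \<and> (\<forall>k\<in>L. \<not> (\<exists>a\<in>i. act k = Some a))}"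
  have fin: "finite (set_pmf ?P)" by (rule finite_set_pmf_actions[OF n C])
  have "measure_pmf.prob ?P ?E = (w i / 2) ^ card ({} :: cluster set) * (1 - w i / 2) ^ card L"
    by (rule prob_hits[OF i]) (auto simp: L_def)
  then have pE: "measure_pmf.prob ?P ?E \<le> exp (- (x i / 4))"
    using miss_prob_le[OF i v(3)] by (simp add: L_def)
  have half: "exp (1/2 :: real) \<le> 2" using exp_bound_half[of "1/2 :: real"] by simp
  have pt: "exp (partner_size n C act i / 4) \<le> 2 + exp (x i / 4) * indicator ?E act" for act
  proof -
    have small: "exp (y / 4) \<le> 2 + exp (x i / 4) * indicator ?E act" if "y \<le> 2" for y
    proof -
      have "exp (y / 4) \<le> exp (1/2)" using that by simp
      moreover have "0 \<le> exp (x i / 4) * (indicator ?E act :: real)" by (auto split: split_indicator)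
      ultimately show ?thesis using half by linarith
    qed
    show ?thesis
    proof (cases rule: partner_size_cases[of i act])
      case none
      then show ?thesis using small[of 0] by simp
    next
      case (some j)
      show ?thesis
      proof (cases "x j \<le> v")
        case True
        then show ?thesis using small[of "x j"] v(2) some(5) by simp
      next
        case False
        have "\<not> (\<exists>a\<in>i. act k = Some a)" if "k \<in> L" for k
          using that False relative_size_le_iff[of j k] by (intro some(6)) (auto simp: L_def)
        then have "act \<in> ?E" by blast
        then show ?thesis using partner_size_le[of act i] by (simp add: add_increasing)
      qed
    qed
  qed
  have "measure_pmf.expectation ?P (\<lambda>act. exp (partner_size n C act i / 4))
      \<le> measure_pmf.expectation ?P (\<lambda>act. 2 + exp (x i / 4) * indicator ?E act)"
    using fin pt by (intro integral_mono integrable_measure_pmf_finite)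
  also have "\<dots> = 2 + exp (x i / 4) * measure_pmf.prob ?P ?E"
    using fin by (subst Bochner_Integration.integral_add) (auto intro: integrable_measure_pmf_finite)
  also have "\<dots> \<le> 2 + exp (x i / 4) * exp (- (x i / 4))"
    using pE by (intro add_left_mono mult_left_mono) auto
  also have "\<dots> = 3" by (simp add: exp_add[symmetric])
  finally show ?thesis .
qed

lemma expectation_mean_partner_size:
  "measure_pmf.expectation (actions_pmf n C) (mean_partner_size n C) \<le> 40 * sqrt A"
proof -
  let ?P = "actions_pmf n C"
  have fin: "finite (set_pmf ?P)" by (rule finite_set_pmf_actions[OF n C])
  have "measure_pmf.expectation ?P (mean_partner_size n C)
      = (\<Sum>i\<in>C. w i * (2 * measure_pmf.expectation ?P (\<lambda>act. partner_size n C act i)))"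
    unfolding mean_partner_size_def using fin
    by (subst Bochner_Integration.integral_sum) (auto intro: integrable_measure_pmf_finite)
  also have "\<dots> \<le> (\<Sum>i\<in>C. w i * (2 * (20 * sqrt A)))"
    by (intro sum_mono mult_left_mono expectation_partner_size) auto
  also have "\<dots> = 40 * sqrt A" unfolding sum_distrib_right[symmetric] configs_sum_weight[OF C n] by simp
  finally show ?thesis .
qed

text \<open>Jensen's inequality for the weights \<open>w i\<close>, by the tangent of the
  exponential at the mean; 1/8 times the factor 2 in \<open>mean_partner_size\<close> is the 1/4 of
  \<open>exp_partner_size\<close>.\<close>

lemma exp_mean_partner_size:
  "measure_pmf.expectation (actions_pmf n C) (\<lambda>act. exp (mean_partner_size n C act / 8)) \<le> 3"
proof -
  let ?P = "actions_pmf n C"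
  have fin: "finite (set_pmf ?P)" by (rule finite_set_pmf_actions[OF n C])
  have jensen: "exp (mean_partner_size n C act / 8) \<le> (\<Sum>i\<in>C. w i * exp (partner_size n C act i / 4))" for act
  proof -
    let ?g = "mean_partner_size n C act / 8" and ?y = "\<lambda>i. partner_size n C act i / 4"
    have g: "(\<Sum>i\<in>C. w i * ?y i) = ?g" unfolding mean_partner_size_def sum_divide_distrib by (intro sum.cong refl) simp
    have "exp ?g * (1 + ?y i - ?g) \<le> exp (?y i)" for i
    proof -
      have "exp ?g * (1 + (?y i - ?g)) \<le> exp ?g * exp (?y i - ?g)" by (intro mult_left_mono exp_ge_add_one_self) auto
      then show ?thesis by (simp add: exp_add[symmetric] algebra_simps)
    qed
    then have "(\<Sum>i\<in>C. w i * (exp ?g * (1 + ?y i - ?g))) \<le> (\<Sum>i\<in>C. w i * exp (?y i))"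
      by (intro sum_mono mult_left_mono) auto
    moreover have "(\<Sum>i\<in>C. w i * (exp ?g * (1 + ?y i - ?g)))
        = exp ?g * ((\<Sum>i\<in>C. w i) * (1 - ?g) + (\<Sum>i\<in>C. w i * ?y i))"
      unfolding sum_distrib_left sum_distrib_right sum.distrib[symmetric] by (intro sum.cong refl) (simp add: algebra_simps)
    ultimately show ?thesis unfolding configs_sum_weight[OF C n] g by simp
  qed
  have "measure_pmf.expectation ?P (\<lambda>act. exp (mean_partner_size n C act / 8))
      \<le> measure_pmf.expectation ?P (\<lambda>act. \<Sum>i\<in>C. w i * exp (partner_size n C act i / 4))"
    using fin jensen by (intro integral_mono integrable_measure_pmf_finite)
  also have "\<dots> = (\<Sum>i\<in>C. w i * measure_pmf.expectation ?P (\<lambda>act. exp (partner_size n C act i / 4)))"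
    using fin by (subst Bochner_Integration.integral_sum) (auto intro: integrable_measure_pmf_finite)
  also have "\<dots> \<le> (\<Sum>i\<in>C. w i * 3)"
    by (intro sum_mono mult_left_mono exp_partner_size) auto
  also have "\<dots> = 3" unfolding sum_distrib_right[symmetric] configs_sum_weight[OF C n] by simp
  finally show ?thesis .
qed

end

section \<open>The size-biased process\<close>

text \<open>The quadratic errors are kept apart: \<open>q\<close> will be the merge ratio,
  controlled by its second moment, and \<open>p\<close> the partner sizes, controlled by an
  exponential moment.\<close>

lemma exp_diff_le:
  fixes p q :: real
  assumes "0 \<le> p" "0 \<le> q"
  shows "exp (p - q) \<le> 1 + p - q + q\<^sup>2 + p\<^sup>2 * exp p"
proof (cases "p \<le> q")
  case True
  define z where "z = q - p"
  have z: "0 \<le> z" "z \<le> q" using True assms by (auto simp: z_def)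
  have "1 \<le> (1 - z + z\<^sup>2) * (1 + z)" using z by (simp add: power2_eq_square algebra_simps)
  also have "\<dots> \<le> (1 - z + z\<^sup>2) * exp z"
  proof (rule mult_left_mono)
    have "0 \<le> (z - 1/2)\<^sup>2" by simp
    then show "0 \<le> 1 - z + z\<^sup>2" by (simp add: power2_eq_square algebra_simps)
  qed (rule exp_ge_add_one_self)
  finally have "exp (- z) \<le> 1 - z + z\<^sup>2" by (simp add: exp_minus field_simps)
  moreover have "z\<^sup>2 \<le> q\<^sup>2" using z by (intro power_mono) auto
  moreover have "0 \<le> p\<^sup>2 * exp p" by simp
  ultimately have "exp (- z) \<le> 1 - z + q\<^sup>2 + p\<^sup>2 * exp p" by linarith
  then show ?thesis by (simp add: z_def)
next
  case False
  define z where "z = p - q"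
  have z: "0 \<le> z" "z \<le> p" using False assms by (auto simp: z_def)
  have e: "exp z - 1 \<le> z * exp z"
    using mult_right_mono[OF exp_ge_add_one_self[of "- z"], of "exp z"] by (simp add: exp_minus algebra_simps)
  have "z * exp z - z = z * (exp z - 1)" by (simp add: algebra_simps)
  also have "\<dots> \<le> z * (z * exp z)" using e z by (intro mult_left_mono) auto
  also have "\<dots> \<le> p * (p * exp p)" using z by (intro mult_mono) auto
  finally have "exp z \<le> 1 + z + p\<^sup>2 * exp p" using e by (simp add: power2_eq_square)
  moreover have "0 \<le> q\<^sup>2" by simp
  ultimately show ?thesis unfolding z_def by linarith
qed

text \<open>The scale is fixed by the quadratic error in \<open>exponential_drift\<close>:
  \<open>1 / 10 ^ 16\<close> times \<open>2 * 1638401^2 + 1536\<close> is at most 1/256, half of the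
  linear drift 1/128. The other half gives the rate in \<open>contraction\<close>.\<close>

definition potential :: "nat \<Rightarrow> cluster set \<Rightarrow> real" where
  "potential n C = exp (1 / 10 ^ 16 * (susceptibility n C + 1638400 * ln (real (card C))))"

definition contraction :: real where
  "contraction = 1 - 1 / 10 ^ 16 / 256"

text \<open>The weight \<open>1638400\<close> of the logarithm makes \<open>40 a - (1/2 + 1638400 a\<^sup>2) / 32 \<le> - 1/128\<close> for all \<open>a\<close>.\<close>

lemma exponential_drift:
  assumes C: "C \<in> configs n" and n: "0 < n" and k: "2 \<le> card C"
  shows "measure_pmf.expectation (actions_pmf n C) (\<lambda>act. exp (1 / 10 ^ 16 *
    (mean_partner_size n C act - (1/2 + 1638400 * truncated_mean n C) * merge_ratio n C act))) \<le> contraction"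
proof -
  let ?P = "actions_pmf n C" and ?G = "mean_partner_size n C" and ?R = "merge_ratio n C"
  define l b where "l = (1 / 10 ^ 16 :: real)" and "b = 1/2 + 1638400 * truncated_mean n C"
  define a where "a = sqrt (truncated_mean n C)"
  have A: "0 < truncated_mean n C" "truncated_mean n C \<le> 1"
    using truncated_mean_pos[OF C n] truncated_mean_le_1[OF C n] by auto
  have a2: "a * a = truncated_mean n C" using A by (simp add: a_def)
  have b: "0 \<le> b" "b \<le> 1638401" using A by (auto simp: b_def)
  have l: "0 < l" "l \<le> 1/16" by (auto simp: l_def)
  have fin: "finite (set_pmf ?P)" by (rule finite_set_pmf_actions[OF n C])
  have int: "integrable (measure_pmf ?P) g" for g :: "actions \<Rightarrow> real"
    by (rule integrable_measure_pmf_finite[OF fin])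
  have pt: "exp (l * (?G act - b * ?R act)) \<le> 1 + l * ?G act - l * b * ?R act + (l * b)\<^sup>2 * (?R act)\<^sup>2
      + l\<^sup>2 * 512 * exp (?G act / 8)" for act
  proof -
    have G: "0 \<le> ?G act" and R: "0 \<le> ?R act"
      by (rule mean_partner_size_nonneg[OF C n] merge_ratio_nonneg[OF C n])+
    have "exp (l * ?G act - l * b * ?R act) \<le> 1 + l * ?G act - l * b * ?R act + (l * b * ?R act)\<^sup>2 + (l * ?G act)\<^sup>2 * exp (l * ?G act)"
      using G R l b by (intro exp_diff_le) auto
    moreover have "(l * ?G act)\<^sup>2 * exp (l * ?G act) \<le> l\<^sup>2 * 512 * exp (?G act / 8)"
    proof -
      \<comment> \<open>One factor \<open>exp (G / 16)\<close> absorbs the square, another the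
        exponential, as \<open>l \<le> 1/16\<close>; together they are the moment bounded in
        \<open>exp_mean_partner_size\<close>.\<close>
      let ?y = "?G act / 16"
      have "1 + ?y + ?y\<^sup>2 / 2 \<le> exp ?y" using G by (intro exp_lower_Taylor_quadratic) auto
      then have "?y\<^sup>2 / 2 \<le> exp ?y" using G by simp
      then have "(?G act)\<^sup>2 \<le> 512 * exp ?y" by (simp add: power2_eq_square)
      moreover have "l * ?G act \<le> ?y" using l G mult_right_mono[of l "1/16" "?G act"] by simp
      then have "exp (l * ?G act) \<le> exp ?y" by simp
      ultimately have "(?G act)\<^sup>2 * exp (l * ?G act) \<le> 512 * exp ?y * exp ?y" by (intro mult_mono) auto
      also have "\<dots> = 512 * exp (?G act / 8)" by (simp add: exp_add[symmetric])
      finally have "l\<^sup>2 * ((?G act)\<^sup>2 * exp (l * ?G act)) \<le> l\<^sup>2 * (512 * exp (?G act / 8))" by (intro mult_left_mono) auto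
      then show ?thesis by (simp add: power_mult_distrib mult.assoc)
    qed
    ultimately show ?thesis by (simp add: right_diff_distrib power_mult_distrib mult.assoc)
  qed
  have "measure_pmf.expectation ?P (\<lambda>act. exp (l * (?G act - b * ?R act)))
    \<le> measure_pmf.expectation ?P (\<lambda>act. 1 + l * ?G act - l * b * ?R act + (l * b)\<^sup>2 * (?R act)\<^sup>2 + l\<^sup>2 * 512 * exp (?G act / 8))"
    by (rule integral_mono[OF int int pt])
  also have "\<dots> = 1 + l * measure_pmf.expectation ?P ?G - l * b * measure_pmf.expectation ?P ?R
      + (l * b)\<^sup>2 * measure_pmf.expectation ?P (\<lambda>act. (?R act)\<^sup>2) + l\<^sup>2 * 512 * measure_pmf.expectation ?P (\<lambda>act. exp (?G act / 8))"
    by (simp add: int)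
  also have "\<dots> \<le> 1 + l * (40 * a) - l * b * (1/32) + (l * b)\<^sup>2 * 2 + l\<^sup>2 * 512 * 3"
    unfolding a_def using l b
      expectation_mean_partner_size[OF C n] merge_ratio_expectation_lower[OF C n k]
      merge_ratio_second_moment[OF C n] exp_mean_partner_size[OF C n]
    by (intro add_mono diff_mono mult_left_mono) auto
  also have "\<dots> = 1 + l * (40 * a - b / 32 + l * (2 * b\<^sup>2 + 1536))"
    by (simp add: power2_eq_square algebra_simps)
  also have "\<dots> \<le> 1 + l * (- (1/256))"
  proof -
    \<comment> \<open>Completing the square:
      \<open>40 a - 1/64 - 51200 a^2 = - 1/128 - 51200 (a - 1/2560)^2\<close>.\<close>
    have "0 \<le> 51200 * (a - 1/2560)\<^sup>2" by simp
    then have "40 * a - b / 32 \<le> - (1/128)"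
      unfolding b_def a2[symmetric] by (simp add: power2_eq_square field_simps)
    moreover have "l * (2 * b\<^sup>2 + 1536) \<le> 1/256"
    proof -
      have "b\<^sup>2 \<le> 1638401\<^sup>2" using b by (intro power_mono) auto
      then have "l * (2 * b\<^sup>2 + 1536) \<le> l * (2 * 1638401\<^sup>2 + 1536)" using l by (intro mult_left_mono) auto
      also have "\<dots> \<le> 1/256" by (simp add: l_def)
      finally show ?thesis .
    qed
    ultimately have "40 * a - b / 32 + l * (2 * b\<^sup>2 + 1536) \<le> - (1/256)" by linarith
    then show ?thesis using l by (intro add_left_mono mult_left_mono) auto
  qed
  finally show ?thesis by (simp add: l_def b_def contraction_def)
qed

text \<open>The cutoff at two clusters extends the drift bound to the absorbed states, since
  clusters never split. The pointwise bound is the same for all ways of breaking ties.\<close>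

lemma potential_contraction:
  assumes \<rho>: "size_biased_rule \<rho>" and C: "C \<in> configs n" and n: "0 < n"
  shows "(\<integral>\<^sup>+D. ennreal (if 2 \<le> card D then potential n D else 0) \<partial>round_pmf n (\<rho> hist) C)
    \<le> ennreal contraction * ennreal (if 2 \<le> card C then potential n C else 0)"
proof -
  let ?g = "\<lambda>D. if 2 \<le> card D then potential n D else 0"
  let ?Z = "\<lambda>act. exp (1 / 10 ^ 16 * (mean_partner_size n C act - (1/2 + 1638400 * truncated_mean n C) * merge_ratio n C act))"
  have sel: "selects_from (smallest_incoming C act) C act s" if "s \<in> set_pmf (\<rho> hist C act)" for act s
    using \<rho> that unfolding size_biased_rule_def by blast
  have round: "(\<integral>\<^sup>+D. ennreal (?g D) \<partial>round_pmf n (\<rho> hist) C)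
      = (\<integral>\<^sup>+act. \<integral>\<^sup>+s. ennreal (?g (merge_clusters C s)) \<partial>\<rho> hist C act \<partial>actions_pmf n C)"
    by (simp add: round_pmf_def)
  show ?thesis
  proof (cases "2 \<le> card C")
    case False
    have "?g (merge_clusters C s) = 0" if "s \<in> set_pmf (\<rho> hist C act)" for act s
      using card_merge_clusters[OF C size_biased_merging(1)[OF C n sel[OF that]]] False by simp
    then have "(\<integral>\<^sup>+s. ennreal (?g (merge_clusters C s)) \<partial>\<rho> hist C act) = 0" for act
      by (subst nn_integral_0_iff_AE) (auto simp: AE_measure_pmf_iff)
    then show ?thesis unfolding round by simp
  next
    case True
    have fin: "finite (set_pmf (actions_pmf n C))" by (rule finite_set_pmf_actions[OF n C])
    have pt: "?g (merge_clusters C s) \<le> potential n C * ?Z act" if "s \<in> set_pmf (\<rho> hist C act)" for act s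
    proof -
      have "?g (merge_clusters C s) \<le> potential n (merge_clusters C s)" by (simp add: potential_def)
      also have "\<dots> \<le> exp (1 / 10 ^ 16 * (susceptibility n C + 1638400 * ln (real (card C)) + mean_partner_size n C act
          - (1/2 + 1638400 * truncated_mean n C) * merge_ratio n C act))"
        unfolding potential_def using potential_change[OF C n sel[OF that], of 1638400] by simp
      also have "\<dots> = potential n C * ?Z act"
        unfolding potential_def exp_add[symmetric] by (intro arg_cong[where f=exp]) (simp add: field_simps)
      finally show ?thesis .
    qed
    have "(\<integral>\<^sup>+s. ennreal (?g (merge_clusters C s)) \<partial>\<rho> hist C act) \<le> ennreal (potential n C * ?Z act)" for act
    proof -
      have "(\<integral>\<^sup>+s. ennreal (?g (merge_clusters C s)) \<partial>\<rho> hist C act) \<le> (\<integral>\<^sup>+s. ennreal (potential n C * ?Z act) \<partial>\<rho> hist C act)"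
        by (rule nn_integral_mono_AE, unfold AE_measure_pmf_iff, rule ballI, rule ennreal_leI, rule pt)
      then show ?thesis by simp
    qed
    then have "(\<integral>\<^sup>+act. \<integral>\<^sup>+s. ennreal (?g (merge_clusters C s)) \<partial>\<rho> hist C act \<partial>actions_pmf n C)
        \<le> (\<integral>\<^sup>+act. ennreal (potential n C * ?Z act) \<partial>actions_pmf n C)"
      by (intro nn_integral_mono)
    also have "\<dots> = ennreal (measure_pmf.expectation (actions_pmf n C) (\<lambda>act. potential n C * ?Z act))"
      by (rule nn_integral_eq_integral[OF integrable_measure_pmf_finite[OF fin]]) (simp add: potential_def)
    also have "\<dots> = ennreal (potential n C * measure_pmf.expectation (actions_pmf n C) ?Z)"
      by simp
    also have "\<dots> \<le> ennreal (potential n C * contraction)"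
      using exponential_drift[OF C n True] by (intro ennreal_leI mult_left_mono) (auto simp: potential_def)
    also have "\<dots> = ennreal contraction * ennreal (?g C)"
      using True by (simp add: ennreal_mult potential_def contraction_def mult.commute flip: ennreal_mult)
    finally show ?thesis unfolding round .
  qed
qed

lemma trajectory_potential:
  assumes \<rho>: "size_biased_rule \<rho>" and n: "0 < n"
  shows "(\<integral>\<^sup>+h. ennreal (if 2 \<le> card (last h) then potential n (last h) else 0) \<partial>trajectory_pmf n \<rho> t)
    \<le> ennreal (contraction ^ t * potential n (singletons n))"
proof (induction t)
  case 0
  then show ?case by (auto simp: potential_def)
next
  case (Suc t)
  let ?g = "\<lambda>D. if 2 \<le> card D then potential n D else 0"
  let ?T = "trajectory_pmf n \<rho> t"
  have c0: "0 \<le> contraction" by (simp add: contraction_def)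
  have "(\<integral>\<^sup>+h. ennreal (?g (last h)) \<partial>trajectory_pmf n \<rho> (Suc t))
      = (\<integral>\<^sup>+h. \<integral>\<^sup>+D. ennreal (?g D) \<partial>round_pmf n (\<rho> (butlast h)) (last h) \<partial>?T)"
    by (simp only: trajectory_pmf.simps nn_integral_bind_pmf nn_integral_map_pmf last_snoc cong: if_cong)
  also have "\<dots> \<le> (\<integral>\<^sup>+h. ennreal contraction * ennreal (?g (last h)) \<partial>?T)"
  proof (rule nn_integral_mono_AE, unfold AE_measure_pmf_iff, rule ballI)
    fix h assume "h \<in> set_pmf ?T"
    then have "length h = Suc t" "set h \<subseteq> configs n"
      using trajectory_pmf_support[OF proper_size_biased_rule[OF \<rho>]] by auto
    then have "last h \<in> configs n" using last_in_set[of h] by (cases h) auto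
    then show "(\<integral>\<^sup>+D. ennreal (?g D) \<partial>round_pmf n (\<rho> (butlast h)) (last h)) \<le> ennreal contraction * ennreal (?g (last h))"
      by (rule potential_contraction[OF \<rho> _ n])
  qed
  also have "\<dots> = ennreal contraction * (\<integral>\<^sup>+h. ennreal (?g (last h)) \<partial>?T)"
    by (rule nn_integral_cmult) simp
  also have "\<dots> \<le> ennreal contraction * ennreal (contraction ^ t * potential n (singletons n))"
    by (rule mult_left_mono[OF Suc.IH]) simp
  also have "\<dots> = ennreal (contraction ^ Suc t * potential n (singletons n))"
    using c0 by (subst ennreal_mult[symmetric]) (auto simp: potential_def mult.assoc)
  finally show ?case .
qed

lemma potential_singletons:
  assumes "0 < n"
  shows "potential n (singletons n) = exp (1 / 10 ^ 16 * (1 + 1638400 * ln (real n)))"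
proof -
  have "(\<Sum>i\<in>singletons n. (real (card i) / real n)\<^sup>2) = (\<Sum>i\<in>singletons n. (1 / real n)\<^sup>2)"
    by (intro sum.cong) (auto simp: singletons_def)
  then have "susceptibility n (singletons n) = 1"
    using assms by (simp add: susceptibility_def singletons_card power2_eq_square)
  then show ?thesis by (simp add: potential_def singletons_card)
qed

text \<open>Markov's inequality: \<open>potential\<close> is at least 1 before coalescence, and
  initially it is a constant times a power of \<open>n\<close>, which a large multiple of
  \<open>ln n\<close> contractions defeats.\<close>

lemma size_biased_not_coalesced:
  assumes \<rho>: "size_biased_rule \<rho>" and n: "0 < n"
  shows "measure_pmf.prob (trajectory_pmf n \<rho> t) {h. 2 \<le> card (last h)}
    \<le> exp (- (1 / 10 ^ 16 / 256 * real t)) * exp (1 / 10 ^ 16 * (1 + 1638400 * ln (real n)))"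
proof -
  let ?g = "\<lambda>D. if 2 \<le> card D then potential n D else 0"
  let ?T = "trajectory_pmf n \<rho> t"
  have "emeasure ?T {h. 2 \<le> card (last h)} = (\<integral>\<^sup>+h. indicator {h. 2 \<le> card (last h)} h \<partial>?T)" by simp
  also have "\<dots> \<le> (\<integral>\<^sup>+h. ennreal (?g (last h)) \<partial>?T)"
  proof (rule nn_integral_mono_AE, unfold AE_measure_pmf_iff, rule ballI)
    fix h assume "h \<in> set_pmf ?T"
    have "1 \<le> potential n (last h)" if "2 \<le> card (last h)"
      using that by (auto simp: potential_def susceptibility_def intro!: sum_nonneg add_nonneg_nonneg mult_nonneg_nonneg)
    then have "2 \<le> card (last h) \<Longrightarrow> ennreal 1 \<le> ennreal (potential n (last h))" by (intro ennreal_leI)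
    then show "indicator {h. 2 \<le> card (last h)} h \<le> ennreal (?g (last h))"
      by (auto split: split_indicator)
  qed
  also have "\<dots> \<le> ennreal (contraction ^ t * potential n (singletons n))" by (rule trajectory_potential[OF \<rho> n])
  finally have "measure_pmf.prob ?T {h. 2 \<le> card (last h)} \<le> contraction ^ t * potential n (singletons n)"
    by (simp add: measure_pmf.emeasure_eq_measure contraction_def potential_def)
  also have "\<dots> \<le> exp (- (1 / 10 ^ 16 / 256)) ^ t * potential n (singletons n)"
    using exp_ge_add_one_self[of "- (1 / 10 ^ 16 / 256) :: real"]
    by (intro mult_right_mono power_mono) (auto simp: contraction_def potential_def)
  also have "exp (- (1 / 10 ^ 16 / 256)) ^ t = exp (- (1 / 10 ^ 16 / 256 * real t :: real))"
    by (simp add: exp_of_nat_mult[symmetric])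
  finally show ?thesis unfolding potential_singletons[OF n] .
qed

section \<open>Both bounds for the coalescence time\<close>

lemma trajectory_halving:
  assumes \<rho>: "proper_rule n \<rho>" and h: "h \<in> set_pmf (trajectory_pmf n \<rho> T)" and t: "t \<le> T"
  shows "n \<le> 2 ^ t * card (h ! t)"
  using t
proof (induction t)
  case 0
  then show ?case using trajectory_pmf_path(1)[OF \<rho> h] by (simp add: singletons_card)
next
  case (Suc t)
  then have "n \<le> 2 ^ t * card (h ! t)" by simp
  also have "\<dots> \<le> 2 ^ t * (2 * card (h ! Suc t))"
    using trajectory_pmf_path(2)[OF \<rho> h, of t] Suc.prems by (intro mult_left_mono) auto
  finally show ?case by simp
qed

lemma size_biased_coalescence_time_bounds:
  assumes \<rho>: "size_biased_rule \<rho>" and n: "3 \<le> n" and K: "2 \<le> K"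
  shows "1 - exp (- (1 / 10 ^ 16 / 256 * (K * ln (real n) - 1))) * exp (1 / 10 ^ 16 * (1 + 1638400 * ln (real n)))
    \<le> \<P>(\<omega> in process n \<rho>. ereal (1 * ln (real n)) \<le> ereal_of_enat (coalescence_time \<omega>)
        \<and> ereal_of_enat (coalescence_time \<omega>) \<le> ereal (K * ln (real n)))"
proof -
  have pr: "proper_rule n \<rho>" by (rule proper_size_biased_rule[OF \<rho>])
  have n0: "0 < n" using n by simp
  have "exp 1 \<le> real n" using n exp_le by linarith
  then have ln1: "1 \<le> ln (real n)" using n0 by (simp add: ln_ge_iff)
  define T where "T = nat \<lfloor>K * ln (real n)\<rfloor>"
  have Kln: "2 \<le> K * ln (real n)" using mult_mono[OF K ln1] K by simp
  have T: "real T \<le> K * ln (real n)" "K * ln (real n) - 1 \<le> real T" unfolding T_def using Kln by linarith+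
  have lnT: "ln (real n) \<le> real T"
  proof -
    have "2 * ln (real n) \<le> K * ln (real n)" using K ln1 by (intro mult_right_mono) auto
    then show ?thesis using T(2) ln1 by linarith
  qed
  \<comment> \<open>The first half of \<open>E\<close> holds on every possible trajectory, since
    \<open>t\<close> rounds leave at least \<open>n / 2 ^ t\<close> clusters and
    \<open>2 \<le> exp 1\<close>; only the second half, coalescence by time \<open>T\<close>, can
    fail.\<close>
  define E where "E h \<longleftrightarrow> (\<forall>t\<le>T. real t < ln (real n) \<longrightarrow> card (h ! t) \<noteq> 1) \<and> card (h ! T) = 1"
    for h :: "cluster set list"
  let ?T = "trajectory_pmf n \<rho> T" and ?P = "process n \<rho>"
  have E: "E h" if h: "h \<in> set_pmf ?T" "\<not> 2 \<le> card (last h)" for h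
  proof -
    have s: "length h = Suc T" "set h \<subseteq> configs n" using trajectory_pmf_support[OF pr h(1)] by auto
    have "card (h ! t) \<noteq> 1" if t: "t \<le> T" "real t < ln (real n)" for t
    proof
      assume "card (h ! t) = 1"
      then have "n \<le> 2 ^ t" using trajectory_halving[OF pr h(1) t(1)] by simp
      then have "real n \<le> 2 ^ t" by (metis of_nat_le_iff of_nat_numeral of_nat_power)
      also have "(2::real) ^ t \<le> exp 1 ^ t" using exp_ge_add_one_self[of 1] by (intro power_mono) auto
      also have "\<dots> = exp (real t)" by (simp add: exp_of_nat_mult[symmetric])
      finally have "ln (real n) \<le> ln (exp (real t))" using n0 by (subst ln_le_cancel_iff) auto
      then have "ln (real n) \<le> real t" by simp
      then show False using t by simp
    qed
    moreover have l: "last h = h ! T" using s by (subst last_conv_nth) auto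
    moreover have "1 \<le> card (h ! T)" using s by (intro configs_card_ge_1[OF _ n0]) (metis lessI nth_mem subsetD)
    ultimately show ?thesis using h(2) by (auto simp: E_def)
  qed
  have sets: "ereal (1 * ln (real n)) \<le> ereal_of_enat (coalescence_time \<omega>) \<and> ereal_of_enat (coalescence_time \<omega>) \<le> ereal (K * ln (real n))"
    if "E (map \<omega> [0..<Suc T])" for \<omega>
  proof
    have nth: "map \<omega> [0..<Suc T] ! t = \<omega> t" if "t \<le> T" for t using that by (simp del: upt_Suc)
    \<comment> \<open>Rounding up covers all integer times below \<open>ln n\<close>; as
      \<open>N > 0\<close>, it is a successor, the form required by
      \<open>coalescence_time_gtI\<close>.\<close>
    define N where "N = nat \<lceil>ln (real n)\<rceil>"
    have N: "ln (real n) \<le> real N" unfolding N_def by linarith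
    have "\<forall>D\<in>set (map \<omega> [0..<N]). card D \<noteq> 1"
    proof
      fix D assume "D \<in> set (map \<omega> [0..<N])"
      then obtain t where t: "t < N" "D = \<omega> t" by auto
      then have "real t < ln (real n)" unfolding N_def by linarith
      moreover then have "t \<le> T" using lnT by linarith
      ultimately show "card D \<noteq> 1" using \<open>E _\<close> nth t(2) by (auto simp: E_def simp del: upt_Suc)
    qed
    moreover have "0 < N" using ln1 N by linarith
    then obtain N' where "N = Suc N'" using gr0_implies_Suc by blast
    ultimately have "enat N \<le> coalescence_time \<omega>" using coalescence_time_gtI[of \<omega> N'] by simp
    have "ereal (1 * ln (real n)) \<le> ereal_of_enat (enat N)" using N by simp
    also have "\<dots> \<le> ereal_of_enat (coalescence_time \<omega>)"
      using \<open>enat N \<le> _\<close> by (simp only: ereal_of_enat_le_iff)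
    finally show "ereal (1 * ln (real n)) \<le> ereal_of_enat (coalescence_time \<omega>)" .
    have "card (\<omega> T) = 1" using \<open>E _\<close> nth[of T] by (simp add: E_def del: upt_Suc)
    then have "ereal_of_enat (coalescence_time \<omega>) \<le> ereal_of_enat (enat T)"
      using coalescence_time_leI[of \<omega> T] by (simp only: ereal_of_enat_le_iff)
    also have "\<dots> \<le> ereal (K * ln (real n))" using T by simp
    finally show "ereal_of_enat (coalescence_time \<omega>) \<le> ereal (K * ln (real n))" .
  qed
  let ?e = "exp (1 / 10 ^ 16 * (1 + 1638400 * ln (real n)))"
  have "1 - exp (- (1 / 10 ^ 16 / 256 * (K * ln (real n) - 1))) * ?e \<le> 1 - exp (- (1 / 10 ^ 16 / 256 * real T)) * ?e"
    using T(2) by (intro diff_mono mult_right_mono) auto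
  also have "\<dots> \<le> 1 - measure_pmf.prob ?T {h. 2 \<le> card (last h)}"
    using size_biased_not_coalesced[OF \<rho> n0, of T] by simp
  also have "\<dots> = measure_pmf.prob ?T (- {h. 2 \<le> card (last h)})"
    by (subst measure_pmf.prob_compl[symmetric]) (auto simp: Compl_eq_Diff_UNIV)
  also have "\<dots> \<le> measure_pmf.prob ?T {h. E h}"
    by (rule measure_pmf.finite_measure_mono_AE) (auto simp: AE_measure_pmf_iff intro: E)
  also have "\<dots> = measure ?P {\<omega> \<in> space ?P. E (map \<omega> [0..<Suc T])}"
    unfolding measure_def using emeasure_process[OF pr, of E T] by simp
  also have "\<dots> \<le> \<P>(\<omega> in ?P. ereal (1 * ln (real n)) \<le> ereal_of_enat (coalescence_time \<omega>)
        \<and> ereal_of_enat (coalescence_time \<omega>) \<le> ereal (K * ln (real n)))"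
  proof -
    interpret prob_space ?P by (rule prob_space_process[OF pr])
    show ?thesis
      by (intro finite_measure_mono coalescence_time_sets[OF pr, of "\<lambda>y. ereal (1 * ln (real n)) \<le> ereal_of_enat y \<and> ereal_of_enat y \<le> ereal (K * ln (real n))"])
        (use sets in blast)
  qed
  finally show ?thesis .
qed

lemma size_biased_coalescence_time:
  assumes "\<And>n. size_biased_rule (\<rho> n)"
  shows "(\<lambda>n. \<P>(\<omega> in process n (\<rho> n). ereal (1 * ln (real n)) \<le> ereal_of_enat (coalescence_time \<omega>)
        \<and> ereal_of_enat (coalescence_time \<omega>) \<le> ereal (10 ^ 9 * ln (real n)))) \<longlonglongrightarrow> 1"
    (is "?p \<longlonglongrightarrow> 1")
proof -
  \<comment> \<open>\<open>10 ^ 9 / 256\<close> exceeds 1638400, so the error is a negative power of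
    \<open>n\<close> up to a constant.\<close>
  let ?err = "\<lambda>n. exp (- (1 / 10 ^ 16 / 256 * (10 ^ 9 * ln (real n) - 1))) * exp (1 / 10 ^ 16 * (1 + 1638400 * ln (real n)))"
  have lower: "\<forall>\<^sub>F n in sequentially. 1 - ?err n \<le> ?p n"
    using eventually_ge_at_top[of 3]
    by eventually_elim (rule size_biased_coalescence_time_bounds[OF assms], auto)
  have lim: "(\<lambda>n. 1 - ?err n) \<longlonglongrightarrow> 1" by real_asymp
  have "?p n \<le> 1" for n
    by (rule prob_space.prob_le_1[OF prob_space_process[OF proper_size_biased_rule[OF assms]]])
  then show ?thesis
    by (intro tendsto_sandwich[OF lower _ lim tendsto_const]) auto
qed

theorem theorem1p1:
  shows "(\<exists>c>0::real.
            (\<lambda>n. \<P>(\<omega> in process n uniform_rule.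
                   ereal_of_enat (coalescence_time \<omega>)
                     \<ge> ereal (c * ln (real n) * (ln (ln (real n)) / ln (ln (ln (real n)))))))
              \<longlonglongrightarrow> 1)
       \<and> (\<exists>c' C' :: real. 0 < c' \<and> c' < C' \<and>
            (\<forall>\<rho> :: nat \<Rightarrow> rule. (\<forall>n. size_biased_rule (\<rho> n)) \<longrightarrow>
               (\<lambda>n. \<P>(\<omega> in process n (\<rho> n).
                      ereal (c' * ln (real n)) \<le> ereal_of_enat (coalescence_time \<omega>)
                    \<and> ereal_of_enat (coalescence_time \<omega>) \<le> ereal (C' * ln (real n))))
                 \<longlonglongrightarrow> 1))"
proof
  show "\<exists>c>0::real.
            (\<lambda>n. \<P>(\<omega> in process n uniform_rule.
                   ereal_of_enat (coalescence_time \<omega>)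
                     \<ge> ereal (c * ln (real n) * (ln (ln (real n)) / ln (ln (ln (real n)))))))
              \<longlonglongrightarrow> 1"
    using uniform_coalescence_time by (intro exI[of _ "1/3200"] conjI) (simp, assumption)
  show "\<exists>c' C' :: real. 0 < c' \<and> c' < C' \<and>
            (\<forall>\<rho> :: nat \<Rightarrow> rule. (\<forall>n. size_biased_rule (\<rho> n)) \<longrightarrow>
               (\<lambda>n. \<P>(\<omega> in process n (\<rho> n).
                      ereal (c' * ln (real n)) \<le> ereal_of_enat (coalescence_time \<omega>)
                    \<and> ereal_of_enat (coalescence_time \<omega>) \<le> ereal (C' * ln (real n))))
                 \<longlonglongrightarrow> 1)"
    by (intro exI[of _ 1] exI[of _ "10 ^ 9"] conjI allI impI size_biased_coalescence_time) auto
qed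

end
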